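(* Let $\alpha,\beta\ge 0$ be two distinct numbers. Let $X$ and $Y$ be independent random matrices with values in $\Omega_+$, each having a density which is strictly positive and twice differentiable on $\Omega_+$. Define $$U=(\alpha X+Y)^{-1}(\beta X+Y)Y^{-1},\qquad V=(\alpha X+Y)^{-1}(\beta X+Y)X^{-1}$$ (these are $\Omega_+$-valued). If $U$ and $V$ are independent, then there exist $\lambda\in\mathbb R$ and $a,b\in\Omega_+$ such that $$X\sim\mathrm{MGIG}(\lambda,\alpha a,b),\quad Y\sim\mathrm{MGIG}(-\lambda,a,\beta b),\quad U\sim\mathrm{MGIG}(\lambda,\alpha b,a),\quad V\sim\mathrm{MGIG}(-\lambda,b,\beta a).$$
   Context: Fix an integer $r\ge1$. $\Omega$ denotes the space of real symmetric $r\times r$ matrices with inner product $\langle x,y\rangle=\mathrm{tr}(xy)$, and $\Omega_+\subset\Omega$ the open cone of positive definite matrices. For $\lambda\in\mathbb R$ and symmetric positive semidefinite $a,b$ (such that the function below is integrable), $\mathrm{MGIG}(\lambda,a,b)$ is the probability distribution on $\Omega_+$ with density proportional to $(\det x)^{\lambda-\frac{r+1}{2}}\exp\left(-\mathrm{tr}(ax)-\mathrm{tr}(bx^{-1})\right)\mathbf 1_{\Omega_+}(x)$. Densities are with respect to Lebesgue measure on $\Omega$. *)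

theory Defs
  imports "HOL-Analysis.Analysis" "HOL-Probability.Probability"
begin

definition sym_mats :: "(real^'n^'n) set" where
  "sym_mats = {x. transpose x = x}"

definition posdef_mats :: "(real^'n::finite^'n) set" where
  "posdef_mats = {x. transpose x = x \<and> (\<forall>v::real^'n. v \<noteq> 0 \<longrightarrow> v \<bullet> (x *v v) > 0)}"

text \<open>Coordinates of the space of symmetric matrices: one real coordinate for each
  unordered pair {i,j} (i.e. the entries on and above the diagonal).\<close>

definition sym_index :: "'n set set" where
  "sym_index = {{i, j} | i j. True}"

definition sym_of_coords :: "('n set \<Rightarrow> real) \<Rightarrow> real^'n^'n" where
  "sym_of_coords f = (\<chi> i j. f {i, j})"

text \<open>Lebesgue measure on the space of symmetric matrices (image of Lebesgue measure on
  the coordinates; it agrees with the Lebesgue measure of the Euclidean space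
  (Omega, tr(xy)) up to a positive constant factor, which is irrelevant below).\<close>

definition lebesgue_sym :: "(real^'n::finite^'n) measure" where
  "lebesgue_sym = distr (PiM sym_index (\<lambda>_. lborel)) borel sym_of_coords"

definition twice_diff_on_posdef :: "(real^'n::finite^'n \<Rightarrow> real) \<Rightarrow> bool" where
  "twice_diff_on_posdef f \<longleftrightarrow>
     (\<exists>D :: (real^'n^'n) \<Rightarrow> ((real^'n^'n) \<Rightarrow>\<^sub>L real).
        (\<forall>x\<in>posdef_mats. (f has_derivative blinfun_apply (D x)) (at x within posdef_mats)) \<and>
        (\<forall>x\<in>posdef_mats. D differentiable (at x within posdef_mats)))"

definition mgig_kernel :: "real \<Rightarrow> real^'n::finite^'n \<Rightarrow> real^'n^'n \<Rightarrow> real^'n^'n \<Rightarrow> real" where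
  "mgig_kernel lam a b x =
     (if x \<in> posdef_mats
      then det x powr (lam - (real CARD('n) + 1) / 2) * exp (- trace (a ** x) - trace (b ** matrix_inv x))
      else 0)"

definition MGIG :: "real \<Rightarrow> real^'n::finite^'n \<Rightarrow> real^'n^'n \<Rightarrow> (real^'n^'n) measure" where
  "MGIG lam a b = density lebesgue_sym
     (\<lambda>x. ennreal (mgig_kernel lam a b x) / (\<integral>\<^sup>+ y. ennreal (mgig_kernel lam a b y) \<partial>lebesgue_sym))"

end

theory Submission
  imports Defs
begin

text \<open>
  Put \<open>\<delta> = \<beta> - \<alpha>\<close>, \<open>s = \<alpha> x + y\<close>. Then \<open>v = x\<^sup>-\<^sup>1 + \<delta> s\<^sup>-\<^sup>1\<close> and \<open>u\<^sup>-\<^sup>1 = s - \<beta> v\<^sup>-\<^sup>1\<close>, so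
  \<open>(x, y) \<mapsto> (u, v)\<close> is a composition of inversions and shears; it is an involution with
  \<open>\<alpha> u + v = x\<^sup>-\<^sup>1 + \<beta> y\<^sup>-\<^sup>1\<close>, and its Jacobian only requires that of the inversion. Independence
  of \<open>U\<close> and \<open>V\<close> says that \<open>g\<^sub>1(x) + g\<^sub>2(y)\<close> splits as a function of \<open>u\<close> plus a function of \<open>v\<close>, where
  \<open>g\<^sub>i\<close> is the log density corrected by \<open>(r+1)/2\<close> times the log determinant.

  Differentiating in \<open>v\<close> at fixed \<open>u\<close>, some combination of \<open>q(x) = x \<nabla>g\<^sub>1(x) x\<close> and \<open>p(y) = y \<nabla>g\<^sub>2(y) y\<close>
  depends on \<open>v\<close> alone. Differentiating this once more at fixed \<open>v\<close>, at points \<open>x = \<rho> y\<close>, gives a linear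
  differential equation in \<open>\<rho>\<close> which forces \<open>q(\<rho> y) = b(y) + \<rho> l(y) - \<alpha> \<rho>\<^sup>2 a(y)\<close>. Comparing powers of
  \<open>\<rho>\<close> yields that \<open>b\<close> is constant, \<open>a(y) = y a y\<close> and \<open>2 Dl(y)[n] = n y\<^sup>-\<^sup>1 l + l y\<^sup>-\<^sup>1 n\<close>. Letting \<open>y\<close> tend to
  infinity in the equation satisfied by \<open>l\<close> shows that \<open>l\<close> is linear, whence \<open>l(y) = \<lambda> y\<close>.

  If \<open>a\<close> had a unit eigenvector with eigenvalue at most zero, stretching a neighbourhood of the identity
  by \<open>2\<^sup>k\<close> in that direction would give infinitely many disjoint sets on which the sum of the kernels of
  \<open>X\<close> and \<open>Y\<close>, whose exponents \<open>\<plusminus>\<lambda>\<close> are opposite, has integral bounded below. The inversion exchanges the roles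
  of \<open>a\<close> and \<open>b\<close>.
\<close>

subsection \<open>Matrix calculus\<close>

text \<open>The correction (r+1)/2 is half of the Jacobian exponent. The Jacobian is (det x / det
  u)^(r+1), and det u det y = det v det x turns it into the power (r+1)/2 of det x det y / (det u
  det v), which splits evenly between the four variables. The density is only twice differentiable,
  so the gradient can be differentiated once and no more. The functions b, l, a must inherit their
  differentiability from values of q at y, 2y and 3y, because their definition already contains a
  derivative of p. The case \<beta> = 0 is degenerate: one of the relations obtained from the powers
  of \<rho> becomes empty, and homogeneity of a has to replace it. Since \<alpha> or \<beta> may
  vanish, the kernel of X or that of Y may lack a or b altogether. Positive definiteness therefore
  uses both kernels at once: a stretch multiplies their lower bounds by reciprocal powers of its
  determinant, and one of the two powers is at least 1. The laws of U and V come last: with the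
  kernels of X and Y known, the joint density of (U, V) is an explicit product.\<close>

lemma bounded_bilinear_matrix_mult:
  "bounded_bilinear ((**) :: real^'n::finite^'m::finite \<Rightarrow> real^'p::finite^'n \<Rightarrow> real^'p^'m)"
proof -
  have "bilinear ((**) :: real^'n::finite^'m::finite \<Rightarrow> real^'p::finite^'n \<Rightarrow> real^'p^'m)"
    unfolding bilinear_def
    by (auto intro!: linearI simp: matrix_add_ldistrib matrix_matrix_mult_def vec_eq_iff
        sum.distrib sum_distrib_left algebra_simps)
  then show ?thesis
    by (simp add: bilinear_conv_bounded_bilinear)
qed

interpretation matrix_mult: bounded_bilinear "(**) :: real^'n::finite^'m::finite \<Rightarrow> real^'p::finite^'n \<Rightarrow> real^'p^'m"
  by (rule bounded_bilinear_matrix_mult)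

lemmas matrix_algebra =
  matrix_mul_assoc matrix_mult.add_left matrix_mult.add_right
  matrix_mult.diff_left matrix_mult.diff_right matrix_mult.minus_left matrix_mult.minus_right
  matrix_mult.scaleR_left matrix_mult.scaleR_right

lemma bounded_bilinear_matrix_vector_mult:
  "bounded_bilinear ((*v) :: real^'n::finite^'m::finite \<Rightarrow> real^'n \<Rightarrow> real^'m)"
proof -
  have "bilinear ((*v) :: real^'n::finite^'m::finite \<Rightarrow> real^'n \<Rightarrow> real^'m)"
    unfolding bilinear_def
    by (auto intro!: linearI simp: matrix_vector_mult_def vec_eq_iff
        sum.distrib sum_distrib_left algebra_simps)
  then show ?thesis
    by (simp add: bilinear_conv_bounded_bilinear)
qed

interpretation matrix_vector_mult: bounded_bilinear "(*v) :: real^'n::finite^'m::finite \<Rightarrow> real^'n \<Rightarrow> real^'m"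
  by (rule bounded_bilinear_matrix_vector_mult)

lemma bounded_linear_transpose: "bounded_linear (transpose :: real^'n::finite^'m::finite \<Rightarrow> real^'m^'n)"
  unfolding linear_conv_bounded_linear[symmetric]
  by (auto intro!: linearI simp: transpose_def vec_eq_iff)

lemma bounded_linear_trace: "bounded_linear (trace :: real^'n::finite^'n \<Rightarrow> real)"
  unfolding linear_conv_bounded_linear[symmetric]
  by (auto intro!: linearI simp: trace_def sum.distrib sum_distrib_left)

lemmas transpose_algebra =
  linear_add[OF bounded_linear.linear[OF bounded_linear_transpose]]
  linear_diff[OF bounded_linear.linear[OF bounded_linear_transpose]]
  linear_neg[OF bounded_linear.linear[OF bounded_linear_transpose]]
  linear_scale[OF bounded_linear.linear[OF bounded_linear_transpose]]
  matrix_transpose_mul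

lemmas trace_algebra =
  linear_add[OF bounded_linear.linear[OF bounded_linear_trace]]
  linear_diff[OF bounded_linear.linear[OF bounded_linear_trace]]
  linear_neg[OF bounded_linear.linear[OF bounded_linear_trace]]
  linear_scale[OF bounded_linear.linear[OF bounded_linear_trace]]

lemma trace_matrix_mult_commute: "trace (A ** B) = trace (B ** (A :: real^'n::finite^'n))"
  unfolding trace_def matrix_matrix_mult_def
  by (simp, subst sum.swap, simp add: mult.commute)

lemma trace_mult_transpose_eq_0:
  fixes A :: "real^'n::finite^'n"
  assumes "trace (A ** transpose A) = 0"
  shows "A = 0"
proof -
  have "trace (A ** transpose A) = (\<Sum>i\<in>UNIV. \<Sum>j\<in>UNIV. (A$i$j)^2)"
    unfolding trace_def matrix_matrix_mult_def transpose_def by (simp add: power2_eq_square)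
  with assms have "(\<Sum>i\<in>UNIV. \<Sum>j\<in>UNIV. (A$i$j)^2) = 0"
    by simp
  then have "\<forall>i j. A$i$j = 0"
    by (simp add: sum_nonneg_eq_0_iff sum_nonneg)
  then show ?thesis
    by (simp add: vec_eq_iff)
qed

section \<open>Inverses and Cramer's rule\<close>

lemma matrix_inv_props:
  fixes A :: "real^'n::finite^'n"
  assumes "invertible A"
  shows "A ** matrix_inv A = mat 1" "matrix_inv A ** A = mat 1"
    "C ** A ** matrix_inv A = C" "C ** matrix_inv A ** A = C"
proof -
  have "A ** matrix_inv A = mat 1 \<and> matrix_inv A ** A = mat 1"
    unfolding matrix_inv_def by (rule someI_ex) (use assms in \<open>simp add: invertible_def\<close>)
  then show *: "A ** matrix_inv A = mat 1" "matrix_inv A ** A = mat 1"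
    by auto
  show "C ** A ** matrix_inv A = C" "C ** matrix_inv A ** A = C"
    by (simp_all add: matrix_mul_assoc[symmetric] *)
qed

lemma matrix_inv_unique:
  fixes A :: "real^'n::finite^'n"
  assumes "A ** B = mat 1"
  shows "invertible A" "matrix_inv A = B"
proof -
  have BA: "B ** A = mat 1"
    using assms by (simp add: matrix_left_right_inverse)
  then show inv: "invertible A"
    using assms invertible_def by blast
  show "matrix_inv A = B"
    by (metis BA inv matrix_inv_props(1) matrix_mul_assoc matrix_mul_lid matrix_mul_rid)
qed

lemma invertible_matrix_inv:
  fixes A :: "real^'n::finite^'n"
  assumes "invertible A"
  shows "invertible (matrix_inv A)" "matrix_inv (matrix_inv A) = A"
  using matrix_inv_unique[of "matrix_inv A" A] matrix_inv_props[OF assms] by auto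

lemma matrix_inv_mult:
  fixes A B :: "real^'n::finite^'n"
  assumes "invertible A" "invertible B"
  shows "invertible (A ** B)" "matrix_inv (A ** B) = matrix_inv B ** matrix_inv A"
proof -
  have "A ** B ** (matrix_inv B ** matrix_inv A) = mat 1"
    using assms by (simp add: matrix_mul_assoc matrix_inv_props)
  from matrix_inv_unique[OF this]
  show "invertible (A ** B)" "matrix_inv (A ** B) = matrix_inv B ** matrix_inv A"
    by auto
qed

lemma matrix_inv_scaleR:
  fixes A :: "real^'n::finite^'n"
  assumes "invertible A" "c \<noteq> 0"
  shows "invertible (c *\<^sub>R A)" "matrix_inv (c *\<^sub>R A) = (1/c) *\<^sub>R matrix_inv A"
proof -
  have "(c *\<^sub>R A) ** ((1/c) *\<^sub>R matrix_inv A) = mat 1"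
    using assms by (simp add: matrix_algebra matrix_inv_props)
  from matrix_inv_unique[OF this]
  show "invertible (c *\<^sub>R A)" "matrix_inv (c *\<^sub>R A) = (1/c) *\<^sub>R matrix_inv A"
    by auto
qed

lemma matrix_inv_mat_1 [simp]: "matrix_inv (mat 1 :: real^'n::finite^'n) = mat 1"
  by (rule matrix_inv_unique) simp

lemma transpose_matrix_inv:
  fixes A :: "real^'n::finite^'n"
  assumes "invertible A"
  shows "transpose (matrix_inv A) = matrix_inv (transpose A)"
proof -
  have "transpose A ** transpose (matrix_inv A) = mat 1"
    using assms by (simp add: matrix_transpose_mul[symmetric] matrix_inv_props)
  from matrix_inv_unique(2)[OF this] show ?thesis by simp
qed

lemma det_matrix_inv:
  fixes A :: "real^'n::finite^'n"
  assumes "invertible A"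
  shows "det (matrix_inv A) = 1 / det A"
proof -
  have "det A * det (matrix_inv A) = 1"
    by (metis assms det_I det_mul matrix_inv_props(1))
  then show ?thesis
    by (metis eq_divide_imp mult.commute mult_zero_left zero_neq_one)
qed

lemma matrix_inv_diff:
  fixes A B :: "real^'n::finite^'n"
  assumes "invertible A" "invertible B"
  shows "matrix_inv B - matrix_inv A = - (matrix_inv B ** (B - A) ** matrix_inv A)"
  using assms by (simp add: matrix_algebra matrix_inv_props)

text \<open>For singular matrices the choice operator is applied to one and the same empty
  predicate, so they all share the unspecified value \<open>matrix_inv 0\<close>. With this first
  branch the formula holds on the whole space and yields measurability as well as
  continuity.\<close>

lemma matrix_inv_eq_cramer:
  fixes A :: "real^'n::finite^'n"
  shows "matrix_inv A = (if det A = 0 then matrix_inv 0 else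
    (\<chi> k l. det (\<chi> i j. if j = k then (if i = l then 1 else 0) else A$i$j) / det A))"
proof (cases "det A = 0")
  case True
  then have "\<not> invertible A" "\<not> invertible (0 :: real^'n^'n)"
    by (simp_all add: invertible_det_nz flip: mat_0)
  then have "(\<lambda>B. A ** B = mat 1 \<and> B ** A = mat 1) = (\<lambda>B. (0::real^'n^'n) ** B = mat 1 \<and> B ** 0 = mat 1)"
    unfolding invertible_def by auto
  then show ?thesis
    using True unfolding matrix_inv_def by metis
next
  case False
  then have inv: "invertible A"
    by (simp add: invertible_det_nz)
  have "matrix_inv A $ k $ l = det (\<chi> i j. if j = k then (if i = l then 1 else 0) else A$i$j) / det A" for k l
  proof -
    have "A *v column l (matrix_inv A) = column l (A ** matrix_inv A)"
      by (simp add: vec_eq_iff column_def matrix_vector_mult_def matrix_matrix_mult_def)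
    also have "\<dots> = (\<chi> i. if i = l then 1 else 0)"
      by (simp add: matrix_inv_props[OF inv] column_def mat_def)
    finally have "column l (matrix_inv A) =
        (\<chi> k. det (\<chi> i j. if j = k then (\<chi> i. if i = l then 1 else 0) $ i else A$i$j) / det A)"
      using cramer[OF False] by blast
    then show ?thesis
      by (simp add: vec_eq_iff column_def cong: if_cong)
  qed
  then show ?thesis
    using False by (simp add: vec_eq_iff)
qed

section \<open>Continuity, measurability and derivatives of determinant and inverse\<close>

lemma continuous_on_det: "continuous_on S (det :: real^'n::finite^'n \<Rightarrow> real)"
  unfolding det_def by (intro continuous_intros)

lemma tendsto_det:
  fixes f :: "'a \<Rightarrow> real^'n::finite^'n"
  assumes "(f \<longlongrightarrow> l) F"
  shows "((\<lambda>x. det (f x)) \<longlongrightarrow> det l) F"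
  unfolding det_def by (intro tendsto_intros assms)

lemma borel_measurable_det [measurable]: "det \<in> borel_measurable (borel :: (real^'n::finite^'n) measure)"
  by (intro borel_measurable_continuous_onI continuous_on_det)

lemma eventually_invertible:
  fixes f :: "'a \<Rightarrow> real^'n::finite^'n"
  assumes "(f \<longlongrightarrow> A) F" "invertible A"
  shows "eventually (\<lambda>x. invertible (f x)) F"
  using tendsto_imp_eventually_ne[OF tendsto_det[OF assms(1)], of 0] assms(2)
  by (simp add: invertible_det_nz)

lemma tendsto_matrix_inv:
  fixes f :: "'a \<Rightarrow> real^'n::finite^'n"
  assumes f: "(f \<longlongrightarrow> A) F" and A: "invertible A"
  shows "((\<lambda>x. matrix_inv (f x)) \<longlongrightarrow> matrix_inv A) F"
proof -
  have d: "det A \<noteq> 0" using A by (simp add: invertible_det_nz)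
  have "((\<lambda>x. \<chi> k l. det (\<chi> i j. if j = k then (if i = l then 1 else 0) else f x$i$j) / det (f x))
      \<longlongrightarrow> (\<chi> k l. det (\<chi> i j. if j = k then (if i = l then 1 else 0) else A$i$j) / det A)) F"
  proof (intro vec_tendstoI)
    fix k l
    have "((\<lambda>x. (\<chi> i j. if j = k then (if i = l then 1 else 0) else f x$i$j) :: real^'n^'n)
        \<longlongrightarrow> (\<chi> i j. if j = k then (if i = l then 1 else 0) else A$i$j)) F"
      by (intro vec_tendstoI) (auto intro!: tendsto_intros f)
    then show "((\<lambda>x. (\<chi> k l. det (\<chi> i j. if j = k then (if i = l then 1 else 0) else f x$i$j) / det (f x)) $ k $ l)
      \<longlongrightarrow> (\<chi> k l. det (\<chi> i j. if j = k then (if i = l then 1 else 0) else A$i$j) / det A) $ k $ l) F"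
      using d by (simp, intro tendsto_divide tendsto_det f)
  qed
  moreover have "eventually (\<lambda>x. (\<chi> k l. det (\<chi> i j. if j = k then (if i = l then 1 else 0) else f x$i$j) / det (f x))
     = matrix_inv (f x)) F"
    using eventually_invertible[OF f A]
    by eventually_elim (subst matrix_inv_eq_cramer, simp add: invertible_det_nz)
  moreover have "(\<chi> k l. det (\<chi> i j. if j = k then (if i = l then 1 else 0) else A$i$j) / det A) = matrix_inv A"
    using d by (subst matrix_inv_eq_cramer) simp
  ultimately show ?thesis
    using Lim_transform_eventually by fastforce
qed

lemma borel_measurable_vecI:
  fixes f :: "'a \<Rightarrow> 'b::euclidean_space^'n::finite"
  assumes "\<And>i. (\<lambda>x. f x $ i) \<in> borel_measurable M"
  shows "f \<in> borel_measurable M"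
proof (subst borel_measurable_euclidean_space, intro ballI)
  fix b :: "'b^'n" assume "b \<in> Basis"
  then obtain i u where b: "b = axis i u" by (auto simp: Basis_vec_def)
  have "(\<lambda>x. f x \<bullet> b) = (\<lambda>x. f x $ i \<bullet> u)"
    by (simp add: b inner_axis)
  then show "(\<lambda>x. f x \<bullet> b) \<in> borel_measurable M"
    using assms[of i] by simp
qed

lemma borel_measurable_matrix_inv [measurable]:
  "matrix_inv \<in> borel_measurable (borel :: (real^'n::finite^'n) measure)"
proof -
  have "(\<lambda>A::real^'n^'n. \<chi> k l. det (\<chi> i j. if j = k then (if i = l then 1 else 0) else A$i$j) / det A)
      \<in> borel_measurable borel"
  proof (intro borel_measurable_vecI, unfold vec_lambda_beta)
    fix k l
    have "(\<lambda>A::real^'n^'n. (\<chi> i j. if j = k then (if i = l then 1 else 0) else A$i$j) :: real^'n^'n)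
        \<in> borel_measurable borel"
    proof (intro borel_measurable_continuous_onI continuous_on_vec_lambda)
      show "continuous_on UNIV (\<lambda>A::real^'n^'n. if j = k then if i = l then 1 else 0 else A $ i $ j)" for i j
        by (cases "j = k") (auto intro!: continuous_intros)
    qed
    then show "(\<lambda>A::real^'n^'n. det (\<chi> i j. if j = k then (if i = l then 1 else 0) else A$i$j) / det A) \<in> borel_measurable borel"
      by measurable
  qed
  then have "(\<lambda>A::real^'n^'n. if det A = 0 then matrix_inv 0 else
      (\<chi> k l. det (\<chi> i j. if j = k then (if i = l then 1 else 0) else A$i$j) / det A)) \<in> borel_measurable borel"
    by measurable
  then show ?thesis
    by (subst matrix_inv_eq_cramer[abs_def])
qed

text \<open>By the resolvent identity \<open>matrix_inv_diff\<close> the error of the linear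
  approximation at B is (A^-1 - B^-1) (B - A) A^-1. Continuity of the inverse makes it small
  compared with B - A.\<close>

lemma has_derivative_matrix_inv:
  fixes A :: "real^'n::finite^'n"
  assumes A: "invertible A"
  shows "(matrix_inv has_derivative (\<lambda>h. - (matrix_inv A ** h ** matrix_inv A))) (at A within S)"
proof -
  let ?I = "matrix_inv A"
  have bl: "bounded_linear (\<lambda>h. - (?I ** h ** ?I))"
    by (intro bounded_linear_minus matrix_mult.bounded_linear_left[THEN bounded_linear_compose]
         matrix_mult.bounded_linear_right)
  obtain K where K: "\<And>(a :: real^'n^'n) (b :: real^'n^'n). norm (a ** b) \<le> norm a * norm b * K" "K > 0"
    using matrix_mult.pos_bounded by blast
  have ev: "eventually (\<lambda>B. invertible B) (at A within S)"
    by (rule eventually_invertible[OF tendsto_ident_at A])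
  have "((\<lambda>B. norm (?I - matrix_inv B) * K * norm ?I * K) \<longlongrightarrow> norm (?I - ?I) * K * norm ?I * K) (at A within S)"
    by (intro tendsto_intros tendsto_matrix_inv A)
  then have z: "((\<lambda>B. norm (?I - matrix_inv B) * K * norm ?I * K) \<longlongrightarrow> 0) (at A within S)"
    by simp
  have ev2: "eventually (\<lambda>B. norm ((matrix_inv B - ?I - - (?I ** (B - A) ** ?I)) /\<^sub>R norm (B - A))
     \<le> norm (?I - matrix_inv B) * K * norm ?I * K) (at A within S)"
    using ev
  proof eventually_elim
    case (elim B)
    have "matrix_inv B - ?I - - (?I ** (B - A) ** ?I) = (?I - matrix_inv B) ** (B - A) ** ?I"
      using matrix_inv_diff[OF A elim] by (simp add: matrix_algebra)
    moreover have "norm ((?I - matrix_inv B) ** (B - A) ** ?I) \<le> norm ((?I - matrix_inv B) ** (B - A)) * norm ?I * K"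
      by (rule K)
    moreover have "\<dots> \<le> (norm (?I - matrix_inv B) * norm (B - A) * K) * norm ?I * K"
      using K by (intro mult_right_mono) auto
    ultimately show ?case
      by (cases "B = A") (auto simp: field_simps)
  qed
  show ?thesis
    unfolding has_derivative_at_within
    using bl tendsto_norm_zero_cancel[OF tendsto_0_le[OF z, of _ 1]] 
      Lim_null_comparison[OF ev2 z] by auto
qed

lemma has_vector_derivative_matrix_inv:
  fixes f :: "real \<Rightarrow> real^'n::finite^'n"
  assumes "(f has_vector_derivative f') (at t within S)" "invertible (f t)"
  shows "((\<lambda>t. matrix_inv (f t)) has_vector_derivative - (matrix_inv (f t) ** f' ** matrix_inv (f t))) (at t within S)"
  using has_derivative_compose[OF assms(1)[unfolded has_vector_derivative_def]
      has_derivative_matrix_inv[OF assms(2), of UNIV]]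
  by (simp add: has_vector_derivative_def matrix_algebra)

lemma has_derivative_det_mat_1:
  "(det has_derivative trace) (at (mat 1 :: real^'n::finite^'n))"
proof -
  have d: "(det has_derivative (\<lambda>h. \<Sum>p | p permutes UNIV. of_int (sign p) *
      (\<Sum>i\<in>UNIV. h $ i $ p i * (\<Prod>j\<in>UNIV - {i}. (mat 1 :: real^'n^'n) $ j $ p j)))) (at (mat 1))"
    unfolding det_def[abs_def]
    by (auto intro!: derivative_eq_intros has_derivative_prod bounded_linear_imp_has_derivative
        bounded_linear_compose[OF bounded_linear_vec_nth bounded_linear_vec_nth])
  have "(\<Sum>p | p permutes UNIV. of_int (sign p) *
      (\<Sum>i\<in>UNIV. h $ i $ p i * (\<Prod>j\<in>UNIV - {i}. (mat 1 :: real^'n^'n) $ j $ p j))) = trace h" for h :: "real^'n^'n"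
  proof -
    \<comment> \<open>A permutation other than the identity moves at least two points, so after
      deletion of the factor \<open>i\<close> an off-diagonal entry of the identity matrix is still
      present.\<close>
    have z: "(\<Prod>j\<in>UNIV - {i}. (mat 1 :: real^'n^'n) $ j $ p j) = 0"
      if p: "p permutes UNIV" "p \<noteq> id" for p i
    proof -
      obtain k where k: "p k \<noteq> k" using p by (auto simp: fun_eq_iff)
      have "\<exists>j. j \<noteq> i \<and> p j \<noteq> j"
      proof (cases "k = i")
        case True
        then have "p (p i) \<noteq> p i" using k p(1) by (metis permutes_inj injD)
        then show ?thesis using k True by blast
      qed (use k in auto)
      then obtain j where "j \<noteq> i" "p j \<noteq> j" by blast
      then show ?thesis
        by (intro prod_zero bexI[of _ j]) (auto simp: mat_def)
    qed
    have "(\<Sum>p | p permutes UNIV. of_int (sign p) *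
      (\<Sum>i\<in>UNIV. h $ i $ p i * (\<Prod>j\<in>UNIV - {i}. (mat 1 :: real^'n^'n) $ j $ p j)))
      = (\<Sum>p\<in>{id}. of_int (sign p) *
      (\<Sum>i\<in>UNIV. h $ i $ p i * (\<Prod>j\<in>UNIV - {i}. (mat 1 :: real^'n^'n) $ j $ p j)))"
      by (rule sum.mono_neutral_right) (auto simp: z permutes_id finite_permutations)
    also have "\<dots> = trace h"
      by (simp add: trace_def mat_def)
    finally show ?thesis .
  qed
  then show ?thesis using d by presburger
qed

text \<open>Reduced to the derivative at the identity by det B = det A det (A^-1 B).\<close>

lemma has_derivative_det:
  fixes A :: "real^'n::finite^'n"
  assumes A: "invertible A"
  shows "(det has_derivative (\<lambda>h. det A * trace (matrix_inv A ** h))) (at A within S)"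
proof -
  have "((\<lambda>B. det A * det (matrix_inv A ** B)) has_derivative (\<lambda>h. det A * trace (matrix_inv A ** h))) (at A)"
  proof (rule has_derivative_mult_right)
    have "((**) (matrix_inv A) has_derivative (**) (matrix_inv A)) (at A)"
      by (intro bounded_linear_imp_has_derivative matrix_mult.bounded_linear_right)
    moreover have "(det has_derivative trace) (at (matrix_inv A ** A))"
      by (simp add: matrix_inv_props[OF A] has_derivative_det_mat_1)
    ultimately show "((\<lambda>B. det (matrix_inv A ** B)) has_derivative (\<lambda>h. trace (matrix_inv A ** h))) (at A)"
      by (rule has_derivative_compose)
  qed
  moreover have "det A * det (matrix_inv A ** B) = det B" for B
    using A by (simp add: det_mul det_matrix_inv invertible_det_nz)
  ultimately show ?thesis
    by (simp add: has_derivative_at_withinI)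
qed

lemma has_derivative_ln_det:
  fixes A :: "real^'n::finite^'n"
  assumes "det A > 0"
  shows "((\<lambda>B. ln (det B)) has_derivative (\<lambda>h. trace (matrix_inv A ** h))) (at A within S)"
proof -
  have "invertible A" using assms by (simp add: invertible_det_nz)
  from has_derivative_ln[OF assms has_derivative_det[OF this]] show ?thesis
    by (rule has_derivative_eq_rhs) (use assms in auto)
qed


section \<open>The cone of positive definite matrices\<close>

lemma inner_matrix_vector_transpose:
  "v \<bullet> (A *v w) = (transpose A *v v) \<bullet> (w :: real^'n::finite)"
  by (simp add: dot_lmul_matrix)

lemma posdef_sym: "x \<in> posdef_mats \<Longrightarrow> transpose x = x"
  by (simp add: posdef_mats_def)

lemma posdef_pos: "x \<in> posdef_mats \<Longrightarrow> v \<noteq> 0 \<Longrightarrow> v \<bullet> (x *v v) > 0"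
  by (simp add: posdef_mats_def)

lemma posdef_invertible:
  assumes "x \<in> posdef_mats"
  shows "invertible x"
proof -
  have "v = 0" if "x *v v = 0" for v
    using posdef_pos[OF assms, of v] that by auto
  then show ?thesis
    by (simp add: invertible_left_inverse matrix_left_invertible_ker)
qed

lemma posdef_matrix_inv:
  fixes x :: "real^'n::finite^'n"
  assumes "x \<in> posdef_mats"
  shows "matrix_inv x \<in> posdef_mats"
proof -
  have inv: "invertible x" by (rule posdef_invertible[OF assms])
  have "v \<bullet> (matrix_inv x *v v) > 0" if "v \<noteq> 0" for v
  proof -
    let ?w = "matrix_inv x *v v"
    have v: "x *v ?w = v"
      by (simp add: matrix_vector_mul_assoc matrix_inv_props[OF inv])
    with that have "?w \<noteq> 0" by auto
    from posdef_pos[OF assms this] show ?thesis by (simp add: v inner_commute)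
  qed
  then show ?thesis
    using posdef_sym[OF assms] by (simp add: posdef_mats_def transpose_matrix_inv[OF inv])
qed

lemma posdef_mat_1: "mat 1 \<in> posdef_mats"
  by (simp add: posdef_mats_def)

lemma posdef_add: "x \<in> posdef_mats \<Longrightarrow> y \<in> posdef_mats \<Longrightarrow> x + y \<in> posdef_mats"
  by (simp add: posdef_mats_def transpose_algebra algebra_simps add_pos_pos)

lemma posdef_scaleR: "x \<in> posdef_mats \<Longrightarrow> c > 0 \<Longrightarrow> c *\<^sub>R x \<in> posdef_mats"
  by (simp add: posdef_mats_def transpose_algebra scaleR_matrix_vector_assoc[symmetric])

lemma posdef_scaleR_add:
  assumes "x \<in> posdef_mats" "y \<in> posdef_mats" "c \<ge> 0"
  shows "c *\<^sub>R x + y \<in> posdef_mats"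
  using assms by (cases "c = 0") (auto intro!: posdef_add posdef_scaleR)

lemma convex_posdef: "convex (posdef_mats :: (real^'n::finite^'n) set)"
proof (rule convexI)
  fix x y :: "real^'n^'n" and u v :: real
  assume "x \<in> posdef_mats" "y \<in> posdef_mats" "0 \<le> u" "0 \<le> v" "u + v = 1"
  then show "u *\<^sub>R x + v *\<^sub>R y \<in> posdef_mats"
    by (cases "v = 0") (auto intro!: posdef_scaleR_add posdef_scaleR)
qed

lemma posdef_congruence:
  fixes x g :: "real^'n::finite^'n"
  assumes "x \<in> posdef_mats" "invertible g"
  shows "g ** x ** transpose g \<in> posdef_mats"
proof -
  have "v \<bullet> ((g ** x ** transpose g) *v v) > 0" if "v \<noteq> 0" for v
  proof -
    have "transpose g *v v \<noteq> 0"
    proof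
      assume "transpose g *v v = 0"
      then have "transpose (matrix_inv g) *v (transpose g *v v) = 0" by simp
      moreover have "transpose (matrix_inv g) ** transpose g = mat 1"
        by (simp add: matrix_transpose_mul[symmetric] matrix_inv_props assms)
      ultimately show False
        using that by (simp only: matrix_vector_mul_assoc matrix_vector_mul_lid)
    qed
    from posdef_pos[OF assms(1) this] show ?thesis
      by (simp only: matrix_vector_mul_assoc[symmetric] inner_matrix_vector_transpose[of v])
  qed
  then show ?thesis
    using posdef_sym[OF assms(1)]
    by (simp add: posdef_mats_def matrix_transpose_mul matrix_mul_assoc)
qed

lemma posdef_lower_bound:
  fixes x :: "real^'n::finite^'n"
  assumes "\<And>v. norm v = 1 \<Longrightarrow> v \<bullet> (x *v v) > 0"
  obtains c where "c > 0" "\<And>v. norm v = 1 \<Longrightarrow> v \<bullet> (x *v v) \<ge> c"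
proof -
  have "continuous_on (sphere 0 1) (\<lambda>v. v \<bullet> (x *v v))"
    by (intro continuous_intros linear_continuous_on matrix_vector_mul_bounded_linear)
  moreover have "sphere (0::real^'n) 1 \<noteq> {}"
    using norm_axis_1 by (metis empty_iff mem_sphere_0)
  ultimately obtain w where w: "w \<in> sphere 0 1" "\<forall>v\<in>sphere 0 1. w \<bullet> (x *v w) \<le> v \<bullet> (x *v v)"
    using continuous_attains_inf[OF compact_sphere] by blast
  show ?thesis
    by (rule that[of "w \<bullet> (x *v w)"]) (use w assms in auto)
qed

text \<open>The cone lies in the subspace of symmetric matrices, so it is treated as the trace on
  that closed subspace of a set that is open among all matrices. Restricting the quadratic form to
  unit vectors brings in the compact sphere, on which openness rests.\<close>

lemma posdef_eq_sym_Int: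
  "posdef_mats = sym_mats \<inter> {x :: real^'n::finite^'n. \<forall>v. norm v = 1 \<longrightarrow> v \<bullet> (x *v v) > 0}"
proof -
  have "v \<bullet> (x *v v) > 0" if *: "\<forall>v. norm v = 1 \<longrightarrow> v \<bullet> (x *v v) > 0" and v: "v \<noteq> 0"
    for x :: "real^'n^'n" and v
  proof -
    let ?w = "(1 / norm v) *\<^sub>R v"
    have "?w \<bullet> (x *v ?w) > 0" by (rule *[rule_format]) (use v in simp)
    then have "(1 / norm v)^2 * (v \<bullet> (x *v v)) > 0"
      by (simp add: matrix_vector_mult.scaleR_right power2_eq_square)
    then show ?thesis using v by (simp add: zero_less_mult_iff)
  qed
  then show ?thesis
    unfolding posdef_mats_def sym_mats_def by auto (metis norm_zero zero_neq_one)
qed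

lemma open_posdef_part: "open {x :: real^'n::finite^'n. \<forall>v. norm v = 1 \<longrightarrow> v \<bullet> (x *v v) > 0}"
  unfolding open_dist
proof (clarify, goal_cases)
  case (1 x)
  obtain c where c: "c > 0" "\<And>v. norm v = 1 \<Longrightarrow> v \<bullet> (x *v v) \<ge> c"
    using posdef_lower_bound 1 by blast
  obtain K where K: "K > 0" "\<And>(a::real^'n^'n) b. norm (a *v b) \<le> norm a * norm b * K"
    using bounded_bilinear.pos_bounded[OF bounded_bilinear_matrix_vector_mult] by blast
  have "v \<bullet> (y *v v) > 0" if y: "dist y x < c / K" and v: "norm v = 1" for y v
  proof -
    have "\<bar>v \<bullet> ((y - x) *v v)\<bar> \<le> norm v * norm ((y - x) *v v)"
      by (rule Cauchy_Schwarz_ineq2)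
    also have "\<dots> \<le> norm (y - x) * K" using K(2)[of "y - x" v] v by simp
    also have "\<dots> < c" using y K(1) by (simp add: dist_norm field_simps)
    finally show ?thesis using c(2)[OF v] by (simp add: algebra_simps)
  qed
  then show ?case
    using c K by (intro exI[of _ "c / K"]) auto
qed

lemma closed_sym_mats: "closed (sym_mats :: (real^'n::finite^'n) set)"
  unfolding sym_mats_def
  by (intro closed_Collect_eq continuous_intros linear_continuous_on bounded_linear_transpose)

lemma posdef_measurable [measurable]: "posdef_mats \<in> sets (borel :: (real^'n::finite^'n) measure)"
  unfolding posdef_eq_sym_Int
  by (intro sets.Int borel_closed borel_open closed_sym_mats open_posdef_part)

lemma eventually_posdef:
  fixes f :: "'a \<Rightarrow> real^'n::finite^'n"
  assumes "(f \<longlongrightarrow> x) F" "x \<in> posdef_mats" "eventually (\<lambda>t. transpose (f t) = f t) F"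
  shows "eventually (\<lambda>t. f t \<in> posdef_mats) F"
proof -
  have "eventually (\<lambda>t. f t \<in> {x. \<forall>v. norm v = 1 \<longrightarrow> v \<bullet> (x *v v) > 0}) F"
    using assms(2) unfolding posdef_eq_sym_Int
    by (intro topological_tendstoD[OF assms(1)] open_posdef_part) auto
  with assms(3) show ?thesis
    by eventually_elim (auto simp: posdef_eq_sym_Int sym_mats_def)
qed

text \<open>The segment to the identity stays in the cone, where no matrix is singular, so the
  determinant keeps the sign that it has at the identity.\<close>

lemma det_posdef:
  fixes x :: "real^'n::finite^'n"
  assumes x: "x \<in> posdef_mats"
  shows "det x > 0"
proof (rule ccontr)
  assume "\<not> det x > 0"
  define g where "g = (\<lambda>t. t *\<^sub>R x + (1 - t) *\<^sub>R (mat 1 :: real^'n^'n))"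
  have "continuous_on {0..1} (\<lambda>t. det (g t))"
    unfolding g_def by (intro continuous_on_compose2[OF continuous_on_det[of UNIV]] continuous_intros) auto
  moreover have "det (g 0) = 1" "det (g 1) = det x"
    by (simp_all add: g_def)
  ultimately obtain t where t: "0 \<le> t" "t \<le> 1" "det (g t) = 0"
    using IVT2'[of "\<lambda>t. det (g t)" 1 0 0] \<open>\<not> det x > 0\<close> by force
  have "g t \<in> posdef_mats"
    unfolding g_def using convex_posdef x posdef_mat_1 t by (intro convexD) auto
  then show False
    using posdef_invertible invertible_det_nz t(3) by blast
qed

lemma det_matrix_inv_posdef:
  fixes x :: "real^'n::finite^'n"
  assumes x: "x \<in> posdef_mats"
  shows "ln (det (matrix_inv x)) = - ln (det x)"
  using det_matrix_inv[OF posdef_invertible[OF x]] det_posdef[OF x] by (simp add: ln_div)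

subsection \<open>The map from (X, Y) to (U, V)\<close>

text \<open>\<open>V\<close> and \<open>U\<close> as functions of \<open>(x, y)\<close>, in the form that exhibits the map as a composition of
  inversions and shears; see \<open>mgig_V_eq\<close> and \<open>mgig_U_eq\<close> for the original formulas.\<close>

definition mgig_V :: "real \<Rightarrow> real \<Rightarrow> real^'n::finite^'n \<Rightarrow> real^'n^'n \<Rightarrow> real^'n^'n" where
  "mgig_V \<alpha> \<beta> x y = matrix_inv x + (\<beta> - \<alpha>) *\<^sub>R matrix_inv (\<alpha> *\<^sub>R x + y)"

definition mgig_U :: "real \<Rightarrow> real \<Rightarrow> real^'n::finite^'n \<Rightarrow> real^'n^'n \<Rightarrow> real^'n^'n" where
  "mgig_U \<alpha> \<beta> x y = matrix_inv (\<alpha> *\<^sub>R x + y - \<beta> *\<^sub>R matrix_inv (mgig_V \<alpha> \<beta> x y))"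

lemma sum_inv_posdef:
  assumes "\<beta> \<ge> 0" "x \<in> posdef_mats" "y \<in> posdef_mats"
  shows "matrix_inv x + \<beta> *\<^sub>R matrix_inv y \<in> posdef_mats"
  by (subst add.commute) (intro posdef_scaleR_add posdef_matrix_inv assms)

context
  fixes \<alpha> \<beta> :: real and x y :: "real^'n::finite^'n"
  assumes \<alpha>: "\<alpha> \<ge> 0" and \<beta>: "\<beta> \<ge> 0" and x: "x \<in> posdef_mats" and y: "y \<in> posdef_mats"
begin

private definition s where "s = \<alpha> *\<^sub>R x + y"
private definition T where "T = \<beta> *\<^sub>R x + y"

private lemma s: "s \<in> posdef_mats" and T: "T \<in> posdef_mats"
  unfolding s_def T_def using \<alpha> \<beta> x y by (auto intro: posdef_scaleR_add)

private lemmas inv [simp] = posdef_invertible[OF x] posdef_invertible[OF y] posdef_invertible[OF s] posdef_invertible[OF T]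

private lemma T_eq: "T = s + (\<beta> - \<alpha>) *\<^sub>R x"
  by (simp add: s_def T_def algebra_simps)

private lemma s_eq: "s = T - (\<beta> - \<alpha>) *\<^sub>R x"
  by (simp add: T_eq)

lemma mgig_V_eq: "mgig_V \<alpha> \<beta> x y = matrix_inv (\<alpha> *\<^sub>R x + y) ** (\<beta> *\<^sub>R x + y) ** matrix_inv x"
  unfolding mgig_V_def s_def[symmetric] T_def[symmetric] T_eq
  by (simp add: matrix_algebra matrix_inv_props)

private lemma V_right_inv: "mgig_V \<alpha> \<beta> x y ** (x ** matrix_inv T ** s) = mat 1"
  unfolding mgig_V_eq s_def[symmetric] T_def[symmetric]
  by (simp add: matrix_mul_assoc matrix_inv_props)

lemma invertible_mgig_V: "invertible (mgig_V \<alpha> \<beta> x y)"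
  by (rule matrix_inv_unique[OF V_right_inv])

private lemma inv_V: "matrix_inv (mgig_V \<alpha> \<beta> x y) = x ** matrix_inv T ** s"
  by (rule matrix_inv_unique[OF V_right_inv])

lemma matrix_inv_mgig_V:
  "matrix_inv (mgig_V \<alpha> \<beta> x y) = x ** matrix_inv (\<beta> *\<^sub>R x + y) ** (\<alpha> *\<^sub>R x + y)"
  using inv_V by (simp add: s_def T_def)

lemma matrix_inv_mgig_V_diff:
  "matrix_inv (mgig_V \<alpha> \<beta> x y) = x - (\<beta> - \<alpha>) *\<^sub>R (x ** matrix_inv (\<beta> *\<^sub>R x + y) ** x)"
  unfolding inv_V T_def[symmetric] by (subst s_eq) (simp add: matrix_algebra matrix_inv_props)

text \<open>One of v and its inverse is visibly a positive definite matrix plus a nonnegative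
  multiple of another: v = x^-1 + (\<beta> - \<alpha>) s^-1 when \<beta> \<ge> \<alpha>, and v^-1 =
  x + (\<alpha> - \<beta>) x T^-1 x otherwise.\<close>

lemma mgig_V_posdef: "mgig_V \<alpha> \<beta> x y \<in> posdef_mats"
proof (cases "\<beta> \<ge> \<alpha>")
  case True
  then show ?thesis
    unfolding mgig_V_def s_def[symmetric]
    by (subst add.commute) (intro posdef_scaleR_add posdef_matrix_inv x s, simp)
next
  case False
  have "x ** matrix_inv T ** transpose x \<in> posdef_mats"
    by (intro posdef_congruence posdef_matrix_inv T) simp
  then have "(\<alpha> - \<beta>) *\<^sub>R (x ** matrix_inv T ** x) + x \<in> posdef_mats"
    using False x posdef_sym[OF x] by (intro posdef_scaleR_add) auto
  then have "matrix_inv (mgig_V \<alpha> \<beta> x y) \<in> posdef_mats"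
    unfolding matrix_inv_mgig_V_diff T_def[symmetric] by (simp add: algebra_simps)
  then show ?thesis
    using posdef_matrix_inv invertible_matrix_inv(2)[OF invertible_mgig_V] by metis
qed

private lemma inv_U_aux: "s - \<beta> *\<^sub>R matrix_inv (mgig_V \<alpha> \<beta> x y) = y ** matrix_inv T ** s"
proof -
  have "s = T ** matrix_inv T ** s" by (simp add: matrix_inv_props)
  then have "s = \<beta> *\<^sub>R (x ** matrix_inv T ** s) + y ** matrix_inv T ** s"
    by (simp add: T_def matrix_algebra)
  then show ?thesis by (simp add: inv_V algebra_simps)
qed

lemma mgig_U_eq: "mgig_U \<alpha> \<beta> x y = matrix_inv (\<alpha> *\<^sub>R x + y) ** (\<beta> *\<^sub>R x + y) ** matrix_inv y"
  unfolding mgig_U_def s_def[symmetric] T_def[symmetric] inv_U_aux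
  by (rule matrix_inv_unique) (simp add: matrix_mul_assoc matrix_inv_props)

private lemma U_right_inv: "mgig_U \<alpha> \<beta> x y ** (y ** matrix_inv T ** s) = mat 1"
  unfolding mgig_U_eq s_def[symmetric] T_def[symmetric]
  by (simp add: matrix_mul_assoc matrix_inv_props)

lemma invertible_mgig_U: "invertible (mgig_U \<alpha> \<beta> x y)"
  by (rule matrix_inv_unique[OF U_right_inv])

private lemma inv_U: "matrix_inv (mgig_U \<alpha> \<beta> x y) = y ** matrix_inv T ** s"
  by (rule matrix_inv_unique[OF U_right_inv])

lemma matrix_inv_mgig_U:
  "matrix_inv (mgig_U \<alpha> \<beta> x y) = \<alpha> *\<^sub>R x + y - \<beta> *\<^sub>R matrix_inv (mgig_V \<alpha> \<beta> x y)"
  using inv_U inv_U_aux by (simp add: s_def)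

private lemma sum_inv_eq: "matrix_inv x + \<beta> *\<^sub>R matrix_inv y = matrix_inv x ** T ** matrix_inv y"
  by (simp add: T_def matrix_algebra matrix_inv_props)

lemma matrix_inv_sum_inv:
  "matrix_inv (matrix_inv x + \<beta> *\<^sub>R matrix_inv y) = y ** matrix_inv (\<beta> *\<^sub>R x + y) ** x"
  unfolding sum_inv_eq T_def[symmetric]
  by (rule matrix_inv_unique) (simp add: matrix_mul_assoc matrix_inv_props)

private lemma inv_U_diff:
  "matrix_inv (mgig_U \<alpha> \<beta> x y) = y - (\<beta> - \<alpha>) *\<^sub>R matrix_inv (matrix_inv x + \<beta> *\<^sub>R matrix_inv y)"
  unfolding inv_U matrix_inv_sum_inv T_def[symmetric]
  by (subst s_eq) (simp add: matrix_algebra matrix_inv_props)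

text \<open>As for V, by the sign of \<beta> - \<alpha>. The product s^-1 x y^-1 is not visibly
  symmetric; it is recognised as the inverse of \<alpha> y + y x^-1 y.\<close>

lemma mgig_U_posdef: "mgig_U \<alpha> \<beta> x y \<in> posdef_mats"
proof (cases "\<beta> \<ge> \<alpha>")
  case True
  have "y ** matrix_inv x ** transpose y \<in> posdef_mats"
    by (intro posdef_congruence posdef_matrix_inv x) simp
  then have "\<alpha> *\<^sub>R y + y ** matrix_inv x ** y \<in> posdef_mats"
    using posdef_sym[OF y] by (intro posdef_scaleR_add y \<alpha>) simp
  moreover have "\<alpha> *\<^sub>R y + y ** matrix_inv x ** y = y ** matrix_inv x ** s"
    by (simp add: s_def matrix_algebra matrix_inv_props)
  moreover have "matrix_inv (y ** matrix_inv x ** s) = matrix_inv s ** x ** matrix_inv y"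
    by (rule matrix_inv_unique) (simp add: matrix_mul_assoc matrix_inv_props)
  ultimately have "matrix_inv s ** x ** matrix_inv y \<in> posdef_mats"
    using posdef_matrix_inv by metis
  then have "(\<beta> - \<alpha>) *\<^sub>R (matrix_inv s ** x ** matrix_inv y) + matrix_inv y \<in> posdef_mats"
    using True by (intro posdef_scaleR_add posdef_matrix_inv y) auto
  moreover have "mgig_U \<alpha> \<beta> x y = (\<beta> - \<alpha>) *\<^sub>R (matrix_inv s ** x ** matrix_inv y) + matrix_inv y"
    unfolding mgig_U_eq s_def[symmetric] T_def[symmetric] T_eq
    by (simp add: matrix_algebra matrix_inv_props)
  ultimately show ?thesis by simp
next
  case False
  have "(\<alpha> - \<beta>) *\<^sub>R matrix_inv (matrix_inv x + \<beta> *\<^sub>R matrix_inv y) + y \<in> posdef_mats"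
    using False by (intro posdef_scaleR_add y posdef_matrix_inv sum_inv_posdef \<beta> x) auto
  then have "matrix_inv (mgig_U \<alpha> \<beta> x y) \<in> posdef_mats"
    unfolding inv_U_diff by (simp add: algebra_simps)
  then show ?thesis
    using posdef_matrix_inv invertible_matrix_inv(2)[OF invertible_mgig_U] by metis
qed

text \<open>This identity makes the map an involution: with it \<open>inv_U_diff\<close> reads y =
  u^-1 + (\<beta> - \<alpha>) (\<alpha> u + v)^-1, which is the definition of V at (u, v).\<close>

lemma mgig_sum_eq: "\<alpha> *\<^sub>R mgig_U \<alpha> \<beta> x y + mgig_V \<alpha> \<beta> x y = matrix_inv x + \<beta> *\<^sub>R matrix_inv y"
proof -
  have U: "mgig_U \<alpha> \<beta> x y = matrix_inv y + (\<beta> - \<alpha>) *\<^sub>R (matrix_inv s ** x ** matrix_inv y)"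
    unfolding mgig_U_eq s_def[symmetric] T_def[symmetric] T_eq
    by (simp add: matrix_algebra matrix_inv_props)
  have "matrix_inv s = matrix_inv s ** y ** matrix_inv y"
    by (simp add: matrix_inv_props)
  then have "\<alpha> *\<^sub>R (matrix_inv s ** x ** matrix_inv y) + matrix_inv s = matrix_inv s ** s ** matrix_inv y"
    by (simp only: s_def matrix_algebra)
  also have "\<dots> = matrix_inv y" by (simp add: matrix_inv_props)
  finally have "(\<beta> - \<alpha>) *\<^sub>R (\<alpha> *\<^sub>R (matrix_inv s ** x ** matrix_inv y) + matrix_inv s) = (\<beta> - \<alpha>) *\<^sub>R matrix_inv y"
    by simp
  then show ?thesis
    unfolding U mgig_V_def s_def[symmetric] by (simp add: algebra_simps)
qed

lemma mgig_V_involution: "mgig_V \<alpha> \<beta> (mgig_U \<alpha> \<beta> x y) (mgig_V \<alpha> \<beta> x y) = y"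
  by (subst (1) mgig_V_def) (simp add: mgig_sum_eq inv_U_diff)

lemma mgig_U_involution: "mgig_U \<alpha> \<beta> (mgig_U \<alpha> \<beta> x y) (mgig_V \<alpha> \<beta> x y) = x"
  by (subst (1) mgig_U_def) (simp add: mgig_V_involution mgig_sum_eq invertible_matrix_inv)

text \<open>Both u y and v x equal s^-1 T. The relation serves to distribute the Jacobian evenly
  over x, y, u and v.\<close>

lemma mgig_det_eq: "det (mgig_U \<alpha> \<beta> x y) * det y = det (mgig_V \<alpha> \<beta> x y) * det x"
proof -
  have "mgig_U \<alpha> \<beta> x y ** y = mgig_V \<alpha> \<beta> x y ** x"
    by (simp add: mgig_U_eq mgig_V_eq matrix_inv_props)
  then show ?thesis by (metis det_mul)
qed

end

subsection \<open>Derivatives along curves of positive definite matrices\<close>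

text \<open>Functions on the cone are differentiable only within the cone, so the chain rule is used
  along curves that remain there for times near \<open>t\<close>.\<close>

lemma has_vector_derivative_compose_within:
  fixes \<gamma> :: "real \<Rightarrow> 'a::real_normed_vector" and g :: "'a \<Rightarrow> 'b::real_normed_vector"
  assumes g: "(g has_derivative g') (at (\<gamma> t) within S)"
    and \<gamma>: "(\<gamma> has_vector_derivative d) (at t)"
    and ev: "eventually (\<lambda>u. \<gamma> u \<in> S) (nhds t)"
  shows "((\<lambda>u. g (\<gamma> u)) has_vector_derivative g' d) (at t)"
proof -
  obtain O' where O': "open O'" "t \<in> O'" "\<And>u. u \<in> O' \<Longrightarrow> \<gamma> u \<in> S"
    using ev by (auto simp: eventually_nhds)
  have "(\<gamma> has_derivative (\<lambda>h. h *\<^sub>R d)) (at t within O')"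
    using \<gamma> by (simp add: has_vector_derivative_def has_derivative_at_withinI)
  moreover have "(g has_derivative g') (at (\<gamma> t) within (\<gamma> ` O'))"
    by (rule has_derivative_subset[OF g]) (use O' in auto)
  ultimately have "((\<lambda>u. g (\<gamma> u)) has_derivative (\<lambda>h. g' (h *\<^sub>R d))) (at t within O')"
    by (rule has_derivative_in_compose)
  moreover have "g' (h *\<^sub>R d) = h *\<^sub>R g' d" for h
    using linear_scale[OF has_derivative_linear[OF g]] by simp
  ultimately show ?thesis
    using at_within_open[OF O'(2,1)] by (simp add: has_vector_derivative_def)
qed

lemma has_vector_derivative_transform_eventually:
  assumes "(f has_vector_derivative d) (at t)" "eventually (\<lambda>u. f u = g u) (nhds t)"
  shows "(g has_vector_derivative d) (at t)"
  using assms(1) unfolding has_vector_derivative_def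
  by (rule has_derivative_transform_eventually)
    (use assms(2) eventually_nhds_x_imp_x[OF assms(2)] in \<open>auto simp: eventually_at_filter elim: eventually_mono\<close>)

lemma has_vector_derivative_eventually_const:
  assumes "(f has_vector_derivative d) (at t)" "eventually (\<lambda>u. f u = c) (nhds t)"
  shows "d = 0"
  by (rule vector_derivative_unique_at[OF has_vector_derivative_transform_eventually[OF assms] has_vector_derivative_const])

lemma line_posdef:
  fixes x n :: "real^'n::finite^'n"
  assumes "x \<in> posdef_mats" "transpose n = n"
  shows "eventually (\<lambda>t. x + t *\<^sub>R n \<in> posdef_mats) (nhds 0)"
proof (rule eventually_posdef)
  show "((\<lambda>t. x + t *\<^sub>R n) \<longlongrightarrow> x) (nhds 0)"
    by (auto intro!: tendsto_eq_intros filterlim_ident)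
qed (use assms in \<open>auto simp: transpose_algebra posdef_sym\<close>)

lemma line_derivative: "((\<lambda>t. x + t *\<^sub>R n) has_vector_derivative n) (at t)"
  by (auto intro!: derivative_eq_intros)

lemma has_vector_derivative_matrix_mult:
  fixes f :: "real \<Rightarrow> real^'n::finite^'m::finite" and g :: "real \<Rightarrow> real^'p::finite^'n"
  assumes "(f has_vector_derivative f') (at t)" "(g has_vector_derivative g') (at t)"
  shows "((\<lambda>t. f t ** g t) has_vector_derivative (f t ** g' + f' ** g t)) (at t)"
  by (rule bounded_bilinear.has_vector_derivative[OF bounded_bilinear_matrix_mult assms])

lemma has_vector_derivative_transpose:
  fixes f :: "real \<Rightarrow> real^'n::finite^'m::finite"
  assumes "(f has_vector_derivative f') (at t)"
  shows "((\<lambda>t. transpose (f t)) has_vector_derivative transpose f') (at t)"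
  by (rule bounded_linear.has_vector_derivative[OF bounded_linear_transpose assms])

text \<open>The segment from the identity to x stays in the cone. A derivative at time t along it is
  a derivative at time 0 along the line restarted at the point reached, and this is all that the
  hypothesis provides.\<close>

lemma posdef_constI:
  fixes F :: "real^'n::finite^'n \<Rightarrow> 'b::euclidean_space"
  assumes "\<And>y n. y \<in> posdef_mats \<Longrightarrow> transpose n = n \<Longrightarrow>
      ((\<lambda>t. F (y + t *\<^sub>R n)) has_vector_derivative 0) (at 0)"
    and x: "x \<in> posdef_mats"
  shows "F x = F (mat 1)"
proof -
  define n where "n = x - mat 1"
  have n: "transpose n = n" by (simp add: n_def transpose_algebra posdef_sym[OF x])
  have pd: "mat 1 + t *\<^sub>R n \<in> posdef_mats" if "t \<in> {0..1}" for t
  proof -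
    have "mat 1 + t *\<^sub>R n = (1 - t) *\<^sub>R mat 1 + t *\<^sub>R x" by (simp add: n_def algebra_simps)
    then show ?thesis using convexD[OF convex_posdef posdef_mat_1 x, of "1 - t" t] that by simp
  qed
  have d: "((\<lambda>t. F (mat 1 + t *\<^sub>R n)) has_vector_derivative 0) (at t within {0..1})" if "t \<in> {0..1}" for t
  proof -
    have "((\<lambda>u. F ((mat 1 + t *\<^sub>R n) + u *\<^sub>R n)) has_vector_derivative 0) (at (t - t))"
      using assms(1)[OF pd[OF that] n] by simp
    moreover have "((\<lambda>u. u - t) has_vector_derivative 1) (at t)"
      by (auto intro!: derivative_eq_intros)
    ultimately have "((\<lambda>u. F ((mat 1 + t *\<^sub>R n) + (u - t) *\<^sub>R n)) has_vector_derivative 0) (at t)"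
      using vector_diff_chain_at[of "\<lambda>u. u - t" 1 t "\<lambda>u. F ((mat 1 + t *\<^sub>R n) + u *\<^sub>R n)" 0]
      by (simp add: o_def)
    moreover have "(mat 1 + t *\<^sub>R n) + (u - t) *\<^sub>R n = mat 1 + u *\<^sub>R n" for u
      by (simp add: algebra_simps)
    ultimately show ?thesis by (simp add: has_vector_derivative_at_within)
  qed
  have "F (mat 1 + 1 *\<^sub>R n) = F (mat 1 + 0 *\<^sub>R n)"
    by (rule has_derivative_zero_unique[of "{0..1}" "\<lambda>t. F (mat 1 + t *\<^sub>R n)" 1 0])
      (use d in \<open>auto simp: has_vector_derivative_def\<close>)
  then show ?thesis by (simp add: n_def)
qed

section \<open>Symmetric matrices tested by traces and commutators\<close>

lemma matrix_eq_if_trace_eq: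
  fixes A B :: "real^'n::finite^'n"
  assumes "transpose A = A" "transpose B = B" "\<And>k. transpose k = k \<Longrightarrow> trace (A ** k) = trace (B ** k)"
  shows "A = B"
proof -
  have "transpose (A - B) = A - B" using assms by (simp add: transpose_algebra)
  then have "trace ((A - B) ** transpose (A - B)) = 0"
    using assms(3)[of "A - B"] by (simp add: matrix_algebra trace_algebra)
  from trace_mult_transpose_eq_0[OF this] show ?thesis by simp
qed

text \<open>Taking v as a coordinate vector makes the off-diagonal entries vanish; taking v as a sum
  of two coordinate vectors equates two diagonal entries.\<close>

lemma commutes_with_rank_one_imp_scalar:
  fixes A :: "real^'n::finite^'n"
  assumes "\<And>v::real^'n. A ** (\<chi> i j. v$i * v$j) = (\<chi> i j. v$i * v$j) ** A"
  obtains c where "A = c *\<^sub>R mat 1"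
proof -
  have e: "(\<Sum>k\<in>UNIV. A$i$k * v$k) * v$j = v$i * (\<Sum>k\<in>UNIV. v$k * A$k$j)" for i j v
  proof -
    have "(A ** (\<chi> i j. v$i * v$j)) $ i $ j = ((\<chi> i j. v$i * v$j) ** A) $ i $ j"
      by (simp only: assms)
    then show ?thesis
      by (simp add: matrix_matrix_mult_def sum_distrib_left sum_distrib_right mult_ac)
  qed
  have off: "A$i$k = 0" if "i \<noteq> k" for i k
    using e[of i "axis k 1" k] that by (simp add: axis_def if_distrib[of "\<lambda>x. y * x" for y] cong: if_cong)
  have on: "A$k$k = A$l$l" if kl: "k \<noteq> l" for k l
  proof -
    have "(\<Sum>j\<in>UNIV. A$k$j * (axis k 1 + axis l 1 :: real^'n)$j) = A$k$k"
      using that off by (simp add: axis_def distrib_left sum.distrib if_distrib[of "\<lambda>x. y * x" for y] cong: if_cong)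
    moreover have "(\<Sum>j\<in>UNIV. (axis k 1 + axis l 1 :: real^'n)$j * A$j$l) = A$l$l"
      using that off by (simp add: axis_def distrib_right sum.distrib if_distrib[of "\<lambda>x. x * y" for y] cong: if_cong)
    ultimately show ?thesis
      using e[of k "axis k 1 + axis l 1" l] that by (simp add: axis_def)
  qed
  obtain k :: 'n where True by simp
  have "A = (A$k$k) *\<^sub>R mat 1"
    using off on[of _ k] by (auto simp: vec_eq_iff mat_def) metis
  then show ?thesis by (rule that)
qed

subsection \<open>The gradient equation\<close>

text \<open>For \<open>q x = x ** G1 x ** x\<close> and \<open>p y = y ** G2 y ** y\<close>, with \<open>G1\<close> and \<open>G2\<close> the gradients of \<open>g1\<close> and \<open>g2\<close>,
  this is minus the gradient in \<open>v\<close>, at fixed \<open>u\<close>, of \<open>g1 x + g2 y\<close>.\<close>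

definition grad_V :: "real \<Rightarrow> real \<Rightarrow> (real^'n::finite^'n \<Rightarrow> real^'n^'n) \<Rightarrow> (real^'n^'n \<Rightarrow> real^'n^'n) \<Rightarrow>
    real^'n^'n \<Rightarrow> real^'n^'n \<Rightarrow> real^'n^'n" where
  "grad_V \<alpha> \<beta> q p x y = (let R = matrix_inv (\<beta> *\<^sub>R mat 1 + y ** matrix_inv x) in
     q x - (\<beta> - \<alpha>) *\<^sub>R (R ** (\<beta> *\<^sub>R q x - p y) ** transpose R))"

text \<open>Two readings of the matrix R in \<open>grad_V\<close>: the chain rule in v produces the
  form with \<open>matrix_inv x + \<beta> y^-1\<close>, while the algebra of the degree-one
  component works with x T^-1.\<close>

lemma grad_V_factor:
  fixes x y :: "real^'n::finite^'n"
  assumes \<beta>: "\<beta> \<ge> 0" and x: "x \<in> posdef_mats" and y: "y \<in> posdef_mats"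
  shows "matrix_inv (\<beta> *\<^sub>R mat 1 + y ** matrix_inv x) = x ** matrix_inv (\<beta> *\<^sub>R x + y)"
    "invertible (\<beta> *\<^sub>R mat 1 + y ** matrix_inv x)"
    "matrix_inv (\<beta> *\<^sub>R mat 1 + y ** matrix_inv x) = matrix_inv (matrix_inv x + \<beta> *\<^sub>R matrix_inv y) ** matrix_inv y"
proof -
  let ?T = "\<beta> *\<^sub>R x + y"
  have T: "?T \<in> posdef_mats" using assms by (intro posdef_scaleR_add)
  note i = posdef_invertible[OF x] posdef_invertible[OF y] posdef_invertible[OF T]
  have "\<beta> *\<^sub>R mat 1 + y ** matrix_inv x = ?T ** matrix_inv x"
    using i by (simp add: matrix_algebra matrix_inv_props)
  moreover have "?T ** matrix_inv x ** (x ** matrix_inv ?T) = mat 1"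
    using i by (simp add: matrix_mul_assoc matrix_inv_props)
  ultimately show 1: "matrix_inv (\<beta> *\<^sub>R mat 1 + y ** matrix_inv x) = x ** matrix_inv ?T"
      and 2: "invertible (\<beta> *\<^sub>R mat 1 + y ** matrix_inv x)"
    using matrix_inv_unique by metis+
  have "\<beta> *\<^sub>R mat 1 + y ** matrix_inv x = y ** (matrix_inv x + \<beta> *\<^sub>R matrix_inv y)"
    using i by (simp add: matrix_algebra matrix_inv_props)
  also have "matrix_inv \<dots> = matrix_inv (matrix_inv x + \<beta> *\<^sub>R matrix_inv y) ** matrix_inv y"
    by (intro matrix_inv_mult i posdef_invertible[OF sum_inv_posdef] assms)
  finally show "matrix_inv (\<beta> *\<^sub>R mat 1 + y ** matrix_inv x) = matrix_inv (matrix_inv x + \<beta> *\<^sub>R matrix_inv y) ** matrix_inv y" .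
qed

text \<open>Write F(u, v) for g1 x + g2 y at the point with image (u, v). By \<open>sep\<close>,
  F(u, v) - F(u', v) does not depend on v. Two points with equal V have images (u, v) and (u', v),
  so their v-gradients agree.\<close>

lemma grad_V_eq_of_V_eq:
  fixes g1 g2 :: "real^'n::finite^'n \<Rightarrow> real" and G1 G2 :: "real^'n^'n \<Rightarrow> real^'n^'n"
  assumes \<alpha>: "\<alpha> \<ge> 0" and \<beta>: "\<beta> \<ge> 0"
    and g1: "\<And>x. x \<in> posdef_mats \<Longrightarrow> (g1 has_derivative (\<lambda>h. trace (G1 x ** h))) (at x within posdef_mats)"
    and g2: "\<And>x. x \<in> posdef_mats \<Longrightarrow> (g2 has_derivative (\<lambda>h. trace (G2 x ** h))) (at x within posdef_mats)"
    and G1: "\<And>x. x \<in> posdef_mats \<Longrightarrow> transpose (G1 x) = G1 x"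
    and G2: "\<And>x. x \<in> posdef_mats \<Longrightarrow> transpose (G2 x) = G2 x"
    and sep: "\<And>u u' v v'. u \<in> posdef_mats \<Longrightarrow> u' \<in> posdef_mats \<Longrightarrow> v \<in> posdef_mats \<Longrightarrow> v' \<in> posdef_mats \<Longrightarrow>
       g1 (mgig_U \<alpha> \<beta> u v) + g2 (mgig_V \<alpha> \<beta> u v) + (g1 (mgig_U \<alpha> \<beta> u' v') + g2 (mgig_V \<alpha> \<beta> u' v'))
     = g1 (mgig_U \<alpha> \<beta> u v') + g2 (mgig_V \<alpha> \<beta> u v') + (g1 (mgig_U \<alpha> \<beta> u' v) + g2 (mgig_V \<alpha> \<beta> u' v))"
    and x: "x \<in> posdef_mats" and y: "y \<in> posdef_mats" and x': "x' \<in> posdef_mats" and y': "y' \<in> posdef_mats"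
    and V: "mgig_V \<alpha> \<beta> x y = mgig_V \<alpha> \<beta> x' y'"
  shows "grad_V \<alpha> \<beta> (\<lambda>x. x ** G1 x ** x) (\<lambda>y. y ** G2 y ** y) x y = grad_V \<alpha> \<beta> (\<lambda>x. x ** G1 x ** x) (\<lambda>y. y ** G2 y ** y) x' y'"
proof -
  let ?M = "grad_V \<alpha> \<beta> (\<lambda>x. x ** G1 x ** x) (\<lambda>y. y ** G2 y ** y)"
  have sym: "transpose (?M x y) = ?M x y" if "x \<in> posdef_mats" "y \<in> posdef_mats" for x y
    using G1 G2 that
    by (simp add: grad_V_def Let_def transpose_algebra posdef_sym matrix_mul_assoc)
  have deriv: "((\<lambda>t. g1 (mgig_U \<alpha> \<beta> (mgig_U \<alpha> \<beta> x y) (mgig_V \<alpha> \<beta> x y + t *\<^sub>R k))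
        + g2 (mgig_V \<alpha> \<beta> (mgig_U \<alpha> \<beta> x y) (mgig_V \<alpha> \<beta> x y + t *\<^sub>R k))) has_vector_derivative
       - trace (?M x y ** k)) (at 0)"
    if x: "x \<in> posdef_mats" and y: "y \<in> posdef_mats" and k: "transpose k = k" for x y k
  proof -
    define u where "u = mgig_U \<alpha> \<beta> x y"
    define v where "v = mgig_V \<alpha> \<beta> x y"
    have u: "u \<in> posdef_mats" and v: "v \<in> posdef_mats"
      unfolding u_def v_def by (intro mgig_U_posdef mgig_V_posdef \<alpha> \<beta> x y)+
    \<comment> \<open>With u held fixed, y depends on v only through \<alpha> u + v, which is this
      \<sigma>; its inverse P therefore appears in all the derivatives below.\<close>
    define \<sigma> where "\<sigma> = matrix_inv x + \<beta> *\<^sub>R matrix_inv y"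
    define P where "P = matrix_inv \<sigma>"
    define q where "q = x ** G1 x ** x"
    define p where "p = y ** G2 y ** y"
    have \<sigma>: "\<sigma> \<in> posdef_mats" unfolding \<sigma>_def by (intro sum_inv_posdef \<beta> x y)
    have \<sigma>eq: "\<alpha> *\<^sub>R u + v = \<sigma>" unfolding u_def v_def \<sigma>_def by (intro mgig_sum_eq \<alpha> \<beta> x y)
    have Ux: "mgig_U \<alpha> \<beta> u v = x" and Vy: "mgig_V \<alpha> \<beta> u v = y"
      unfolding u_def v_def by (intro mgig_U_involution mgig_V_involution \<alpha> \<beta> x y)+
    have invs: "invertible \<sigma>" "invertible y" "invertible x" "invertible (matrix_inv x)"
      using x y \<sigma> posdef_invertible posdef_matrix_inv by auto
    have ev: "eventually (\<lambda>t. v + t *\<^sub>R k \<in> posdef_mats) (nhds 0)"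
      by (rule line_posdef[OF v k])
    have "((\<lambda>t. \<alpha> *\<^sub>R u + (v + t *\<^sub>R k)) has_vector_derivative k) (at 0)"
      by (auto intro!: derivative_eq_intros)
    from has_vector_derivative_matrix_inv[OF this]
    have "((\<lambda>t. matrix_inv (\<alpha> *\<^sub>R u + (v + t *\<^sub>R k))) has_vector_derivative - (P ** k ** P)) (at 0)"
      using invs by (simp add: \<sigma>eq P_def)
    then have dV: "((\<lambda>t. mgig_V \<alpha> \<beta> u (v + t *\<^sub>R k)) has_vector_derivative - (\<beta> - \<alpha>) *\<^sub>R (P ** k ** P)) (at 0)"
      unfolding mgig_V_def by (auto intro!: derivative_eq_intros simp: algebra_simps)
    from has_vector_derivative_matrix_inv[OF this]
    have "((\<lambda>t. matrix_inv (mgig_V \<alpha> \<beta> u (v + t *\<^sub>R k))) has_vector_derivative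
        (\<beta> - \<alpha>) *\<^sub>R (matrix_inv y ** P ** k ** P ** matrix_inv y)) (at 0)"
      using invs by (simp add: Vy matrix_algebra scaleR_minus_left[symmetric] del: scaleR_minus_left)
    then have "((\<lambda>t. \<alpha> *\<^sub>R u + (v + t *\<^sub>R k) - \<beta> *\<^sub>R matrix_inv (mgig_V \<alpha> \<beta> u (v + t *\<^sub>R k))) has_vector_derivative
        k - \<beta> *\<^sub>R ((\<beta> - \<alpha>) *\<^sub>R (matrix_inv y ** P ** k ** P ** matrix_inv y))) (at 0)"
      by (auto intro!: derivative_eq_intros)
    moreover have "\<alpha> *\<^sub>R u + (v + 0 *\<^sub>R k) - \<beta> *\<^sub>R matrix_inv (mgig_V \<alpha> \<beta> u (v + 0 *\<^sub>R k)) = matrix_inv x"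
      by (simp add: Vy \<sigma>eq \<sigma>_def)
    ultimately have dU: "((\<lambda>t. mgig_U \<alpha> \<beta> u (v + t *\<^sub>R k)) has_vector_derivative
        - (x ** (k - \<beta> *\<^sub>R ((\<beta> - \<alpha>) *\<^sub>R (matrix_inv y ** P ** k ** P ** matrix_inv y))) ** x)) (at 0)"
      using has_vector_derivative_matrix_inv[of "\<lambda>t. \<alpha> *\<^sub>R u + (v + t *\<^sub>R k) - \<beta> *\<^sub>R matrix_inv (mgig_V \<alpha> \<beta> u (v + t *\<^sub>R k))" _ 0 UNIV]
        invs by (simp only: invertible_matrix_inv(2)[OF invs(3)] mgig_U_def)
    have "((\<lambda>t. g1 (mgig_U \<alpha> \<beta> u (v + t *\<^sub>R k))) has_vector_derivative
         trace (G1 x ** - (x ** (k - \<beta> *\<^sub>R ((\<beta> - \<alpha>) *\<^sub>R (matrix_inv y ** P ** k ** P ** matrix_inv y))) ** x))) (at 0)"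
      by (rule has_vector_derivative_compose_within[where S = posdef_mats and g' = "\<lambda>h. trace (G1 x ** h)", OF _ dU])
        (use g1[OF x] Ux ev in \<open>auto elim!: eventually_mono intro: mgig_U_posdef \<alpha> \<beta> u\<close>)
    moreover have "((\<lambda>t. g2 (mgig_V \<alpha> \<beta> u (v + t *\<^sub>R k))) has_vector_derivative
         trace (G2 y ** (- (\<beta> - \<alpha>) *\<^sub>R (P ** k ** P)))) (at 0)"
      by (rule has_vector_derivative_compose_within[where S = posdef_mats and g' = "\<lambda>h. trace (G2 y ** h)", OF _ dV])
        (use g2[OF y] Vy ev in \<open>auto elim!: eventually_mono intro: mgig_V_posdef \<alpha> \<beta> u\<close>)
    moreover have "trace (G1 x ** - (x ** (k - \<beta> *\<^sub>R ((\<beta> - \<alpha>) *\<^sub>R (matrix_inv y ** P ** k ** P ** matrix_inv y))) ** x))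
      + trace (G2 y ** (- (\<beta> - \<alpha>) *\<^sub>R (P ** k ** P))) = - trace (?M x y ** k)"
    proof -
      have Pt: "transpose P = P" "transpose (matrix_inv y) = matrix_inv y"
        using \<sigma> y unfolding P_def by (auto intro!: posdef_sym posdef_matrix_inv)
      have R: "matrix_inv (\<beta> *\<^sub>R mat 1 + y ** matrix_inv x) = P ** matrix_inv y"
        using grad_V_factor(3)[OF \<beta> x y] by (simp add: P_def \<sigma>_def)
      have M: "?M x y = q - (\<beta> - \<alpha>) *\<^sub>R (P ** matrix_inv y ** (\<beta> *\<^sub>R q - p) ** (matrix_inv y ** P))"
        unfolding grad_V_def Let_def R q_def p_def by (simp add: matrix_transpose_mul Pt)
      have p': "matrix_inv y ** p ** matrix_inv y = G2 y"
        using invs by (simp add: p_def matrix_mul_assoc matrix_inv_props)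
      have "trace (G1 x ** (x ** k ** x)) = trace (q ** k)"
        unfolding q_def by (metis trace_matrix_mult_commute matrix_mul_assoc)
      moreover have "trace (G1 x ** (x ** (matrix_inv y ** P ** k ** P ** matrix_inv y) ** x))
          = trace (P ** matrix_inv y ** q ** (matrix_inv y ** P) ** k)"
      proof -
        have "trace (G1 x ** (x ** (matrix_inv y ** P ** k ** P ** matrix_inv y) ** x))
           = trace ((G1 x ** x ** matrix_inv y ** P ** k) ** (P ** matrix_inv y ** x))"
          by (simp add: matrix_mul_assoc)
        also have "\<dots> = trace ((P ** matrix_inv y ** x) ** (G1 x ** x ** matrix_inv y ** P ** k))"
          by (rule trace_matrix_mult_commute)
        finally show ?thesis by (simp add: q_def matrix_mul_assoc)
      qed
      moreover have "trace (G2 y ** (P ** k ** P)) = trace (P ** matrix_inv y ** p ** (matrix_inv y ** P) ** k)"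
      proof -
        have "trace (G2 y ** (P ** k ** P)) = trace ((G2 y ** P ** k) ** P)"
          by (simp add: matrix_mul_assoc)
        also have "\<dots> = trace (P ** (G2 y ** P ** k))"
          by (rule trace_matrix_mult_commute)
        finally show ?thesis unfolding p'[symmetric] by (simp add: matrix_mul_assoc)
      qed
      ultimately show ?thesis
        unfolding M by (simp add: matrix_mult.diff_right matrix_mult.diff_left matrix_mult.minus_right
            matrix_mult.scaleR_left matrix_mult.scaleR_right trace_algebra)
          (simp add: algebra_simps)
    qed
    ultimately have "((\<lambda>t. g1 (mgig_U \<alpha> \<beta> u (v + t *\<^sub>R k)) + g2 (mgig_V \<alpha> \<beta> u (v + t *\<^sub>R k))) has_vector_derivative
       - trace (?M x y ** k)) (at 0)"
      using has_vector_derivative_add by fastforce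
    then show ?thesis unfolding u_def v_def .
  qed
  show ?thesis
  proof (rule matrix_eq_if_trace_eq)
    show "transpose (?M x y) = ?M x y" "transpose (?M x' y') = ?M x' y'"
      by (intro sym x y x' y')+
    fix k :: "real^'n^'n" assume k: "transpose k = k"
    let ?u = "mgig_U \<alpha> \<beta> x y" and ?u' = "mgig_U \<alpha> \<beta> x' y'" and ?v = "mgig_V \<alpha> \<beta> x y"
    let ?F = "\<lambda>u v. g1 (mgig_U \<alpha> \<beta> u v) + g2 (mgig_V \<alpha> \<beta> u v)"
    have pd: "?u \<in> posdef_mats" "?u' \<in> posdef_mats" "?v \<in> posdef_mats"
      by (intro mgig_U_posdef mgig_V_posdef \<alpha> \<beta> x y x' y')+
    have "((\<lambda>t. ?F ?u (?v + t *\<^sub>R k) - ?F ?u' (?v + t *\<^sub>R k)) has_vector_derivative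
       - trace (?M x y ** k) - - trace (?M x' y' ** k)) (at 0)"
      using deriv[OF x y k] deriv[OF x' y' k] unfolding V[symmetric]
      by (rule has_vector_derivative_diff)
    moreover have "eventually (\<lambda>t. ?F ?u (?v + t *\<^sub>R k) - ?F ?u' (?v + t *\<^sub>R k) = ?F ?u ?v - ?F ?u' ?v) (nhds 0)"
      using line_posdef[OF pd(3) k]
    proof eventually_elim
      case (elim t)
      show ?case using sep[OF pd(1,2) elim pd(3)] by simp
    qed
    ultimately have "- trace (?M x y ** k) - - trace (?M x' y' ** k) = 0"
      by (rule has_vector_derivative_eventually_const)
    then show "trace (?M x y ** k) = trace (?M x' y' ** k)" by simp
  qed
qed

subsection \<open>Solving the gradient equation along rays\<close>

text \<open>A polynomial of degree at most four is determined by its values at 1, 2, 3, 4,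
  5.\<close>

lemma real_poly4_eq_0:
  fixes c0 c1 c2 c3 c4 :: real
  assumes "\<And>t. t > 0 \<Longrightarrow> c0 + t * c1 + t^2 * c2 + t^3 * c3 + t^4 * c4 = 0"
  shows "c0 = 0" "c1 = 0" "c2 = 0" "c3 = 0" "c4 = 0"
  using assms[of 1] assms[of 2] assms[of 3] assms[of 4] assms[of 5] by simp_all

lemma matrix_poly4_eq_0:
  fixes c0 c1 c2 c3 c4 :: "real^'n::finite^'n"
  assumes "\<And>t. t > 0 \<Longrightarrow> c0 + t *\<^sub>R c1 + t^2 *\<^sub>R c2 + t^3 *\<^sub>R c3 + t^4 *\<^sub>R c4 = 0"
  shows "c0 = 0" "c1 = 0" "c2 = 0" "c3 = 0" "c4 = 0"
proof -
  have *: "c0$i$j + t * c1$i$j + t^2 * c2$i$j + t^3 * c3$i$j + t^4 * c4$i$j = 0" if "t > 0" for t i j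
    using arg_cong[OF assms[OF that], of "\<lambda>x. x$i$j"] by simp
  show "c0 = 0" "c1 = 0" "c2 = 0" "c3 = 0" "c4 = 0"
    using real_poly4_eq_0[OF *] by (simp_all add: vec_eq_iff)
qed

lemma scaleR_sum3: "k *\<^sub>R (a *\<^sub>R u + b *\<^sub>R v + c *\<^sub>R w) = (k*a) *\<^sub>R u + (k*b) *\<^sub>R v + (k*c) *\<^sub>R (w :: 'a::real_vector)"
  by (simp add: scaleR_add_right)

text \<open>With \<open>Q\<close> the value of q at t y, this says that the quadratic b + t l -
  \<alpha> t^2 a is a particular solution of the ray equation in the direction y. The factor in
  front of the difference is the derivative of the weight \<alpha>\<beta>t^2 + 2\<beta>t +
  1.\<close>

lemma ray_equation_quadratic:
  fixes l a b Q :: "real^'n::finite^'n"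
  shows "(\<alpha>*\<beta>*t^2 + 2*\<alpha>*t + 1) *\<^sub>R (- l - 2 *\<^sub>R a) + (2 * (\<alpha>*t+1)) *\<^sub>R (\<beta> *\<^sub>R Q - (\<beta> *\<^sub>R b - l - a))
     - (\<alpha>*\<beta>*t^2 + 2*\<beta>*t + 1) *\<^sub>R (l - (2*\<alpha>*t) *\<^sub>R a)
    = (2*\<alpha>*\<beta>*t + 2*\<beta>) *\<^sub>R (Q - (b + t *\<^sub>R l - (\<alpha> * t^2) *\<^sub>R a))"
proof -
  have "(\<alpha>*\<beta>*t^2 + 2*\<alpha>*t + 1) * (- l$i$j - 2 * a$i$j) + (2 * (\<alpha>*t+1)) * (\<beta> * Q$i$j - (\<beta> * b$i$j - l$i$j - a$i$j))
     - (\<alpha>*\<beta>*t^2 + 2*\<beta>*t + 1) * (l$i$j - (2*\<alpha>*t) * a$i$j)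
    = (2*\<alpha>*\<beta>*t + 2*\<beta>) * (Q$i$j - (b$i$j + t * l$i$j - (\<alpha> * t^2) * a$i$j))" for i j
    by algebra
  then show ?thesis by (simp add: vec_eq_iff)
qed

text \<open>One matrix entry of the ray equation, multiplied by \<rho> and sorted by powers of
  \<rho>.\<close>

lemma ray_equation_coefficients:
  fixes \<alpha> \<beta> \<rho> :: real
  assumes "(\<alpha>*\<beta>*\<rho>^2 + 2*\<beta>*\<rho> + 1) * (Db + \<rho> * Dl - (\<alpha> * \<rho>^2) * Da) =
      \<rho> * ((\<alpha>*\<beta>*\<rho>^2 + 2*\<alpha>*\<rho> + 1) * Dp + (\<alpha>*\<rho> + 1) * ((\<beta>*\<rho>+1) * K1 + (1 - \<alpha>*\<beta>*\<rho>^2) * K2))"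
  shows "Db + \<rho> * ((2*\<beta>) * Db + Dl - Dp - K1 - K2) +
      \<rho>^2 * ((\<alpha>*\<beta>) * Db + (2*\<beta>) * Dl - \<alpha> * Da - (2*\<alpha>) * Dp - (\<alpha>+\<beta>) * K1 - \<alpha> * K2) +
      \<rho>^3 * ((\<alpha>*\<beta>) * Dl - (2*\<alpha>*\<beta>) * Da - (\<alpha>*\<beta>) * Dp - (\<alpha>*\<beta>) * K1 + (\<alpha>*\<beta>) * K2) +
      \<rho>^4 * ((\<alpha>*\<alpha>*\<beta>) * K2 - (\<alpha>*\<alpha>*\<beta>) * Da) = 0"
  using assms by (simp add: algebra_simps power2_eq_square power3_eq_cube power4_eq_xxxx)

context
  fixes \<alpha> \<beta> :: real and q p :: "real^'n::finite^'n \<Rightarrow> real^'n^'n"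
    and Dq Dp :: "real^'n^'n \<Rightarrow> real^'n^'n \<Rightarrow> real^'n^'n"
  assumes \<alpha>: "\<alpha> \<ge> 0" and \<beta>: "\<beta> \<ge> 0" and ne: "\<alpha> \<noteq> \<beta>"
    and Dq: "\<And>x. x \<in> posdef_mats \<Longrightarrow> (q has_derivative Dq x) (at x within posdef_mats)"
    and Dp: "\<And>x. x \<in> posdef_mats \<Longrightarrow> (p has_derivative Dp x) (at x within posdef_mats)"
    and qsym: "\<And>x. x \<in> posdef_mats \<Longrightarrow> transpose (q x) = q x"
    and psym: "\<And>x. x \<in> posdef_mats \<Longrightarrow> transpose (p x) = p x"
    and M: "\<And>x y x' y'. x \<in> posdef_mats \<Longrightarrow> y \<in> posdef_mats \<Longrightarrow> x' \<in> posdef_mats \<Longrightarrow> y' \<in> posdef_mats \<Longrightarrow>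
       mgig_V \<alpha> \<beta> x y = mgig_V \<alpha> \<beta> x' y' \<Longrightarrow> grad_V \<alpha> \<beta> q p x y = grad_V \<alpha> \<beta> q p x' y'"
begin

private lemma Dq_scale: "x \<in> posdef_mats \<Longrightarrow> Dq x (c *\<^sub>R h) = c *\<^sub>R Dq x h"
  using linear_scale[OF has_derivative_linear[OF Dq]] by blast

private lemma Dp_scale: "x \<in> posdef_mats \<Longrightarrow> Dp x (c *\<^sub>R h) = c *\<^sub>R Dp x h"
  using linear_scale[OF has_derivative_linear[OF Dp]] by blast

private lemma q_line:
  assumes "x \<in> posdef_mats" "transpose n = n"
  shows "((\<lambda>t. q (x + t *\<^sub>R n)) has_vector_derivative Dq x n) (at 0)"
  by (rule has_vector_derivative_compose_within[where S = posdef_mats])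
    (use assms Dq[OF assms(1)] in \<open>auto intro!: line_derivative line_posdef\<close>)

private lemma p_line:
  assumes "x \<in> posdef_mats" "transpose n = n"
  shows "((\<lambda>t. p (x + t *\<^sub>R n)) has_vector_derivative Dp x n) (at 0)"
  by (rule has_vector_derivative_compose_within[where S = posdef_mats])
    (use assms Dp[OF assms(1)] in \<open>auto intro!: line_derivative line_posdef\<close>)

text \<open>The derivative of \<open>grad_V\<close> along a curve on which \<open>mgig_V\<close> is constant, at a point \<open>x = \<rho> y\<close>: there
  all linear maps in the chain rule are multiples of the identity.\<close>

private lemma ray_eq:
  assumes y: "y \<in> posdef_mats" and n: "transpose n = n" and \<rho>: "\<rho> > 0"
  shows "(\<alpha>*\<beta>*\<rho>^2 + 2*\<beta>*\<rho> + 1) *\<^sub>R Dq (\<rho> *\<^sub>R y) n =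
     (\<alpha>*\<beta>*\<rho>^2 + 2*\<alpha>*\<rho> + 1) *\<^sub>R Dp y n + (\<alpha>*\<rho> + 1) *\<^sub>R
      (n ** matrix_inv y ** (\<beta> *\<^sub>R q (\<rho> *\<^sub>R y) - p y) + (\<beta> *\<^sub>R q (\<rho> *\<^sub>R y) - p y) ** matrix_inv y ** n)"
proof -
  define \<delta> where "\<delta> = \<beta> - \<alpha>"
  define x where "x = \<rho> *\<^sub>R y"
  define e where "e = \<alpha>*\<beta>*\<rho>^2 + 2*\<alpha>*\<rho> + 1"
  define c where "c = \<beta> *\<^sub>R q x - p y"
  have x: "x \<in> posdef_mats" unfolding x_def using y \<rho> by (rule posdef_scaleR)
  have iy: "invertible y" by (rule posdef_invertible[OF y])
  have invx: "matrix_inv x = (1/\<rho>) *\<^sub>R matrix_inv y"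
    unfolding x_def using \<rho> by (intro matrix_inv_scaleR iy) auto
  have \<alpha>\<rho>: "\<alpha>*\<rho> + 1 > 0" using \<alpha> \<rho> by (simp add: add_nonneg_pos)
  have \<beta>\<rho>: "\<beta>*\<rho> + 1 > 0" using \<beta> \<rho> by (simp add: add_nonneg_pos)
  have s0: "\<alpha> *\<^sub>R x + y = (\<alpha>*\<rho>+1) *\<^sub>R y" by (simp add: x_def algebra_simps)
  have s0inv: "invertible (\<alpha> *\<^sub>R x + y)" "matrix_inv (\<alpha> *\<^sub>R x + y) = (1/(\<alpha>*\<rho>+1)) *\<^sub>R matrix_inv y"
    unfolding s0 using \<alpha>\<rho> matrix_inv_scaleR[OF iy, of "\<alpha>*\<rho>+1"] by auto
  define v where "v = mgig_V \<alpha> \<beta> x y"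
  \<comment> \<open>The speed is chosen so that the inverse of \<open>s\<close> has derivative -
    y^-1 n y^-1 at 0, where \<open>s\<close> equals (\<alpha>\<rho> + 1) y.\<close>
  define s where "s = (\<lambda>t. \<alpha> *\<^sub>R x + y + t *\<^sub>R ((\<alpha>*\<rho>+1)^2 *\<^sub>R n))"
  \<comment> \<open>With v held fixed, X and Y are recovered from \<open>s\<close> by undoing the
    shears, so V is constant along the curve; \<open>a\<close> is the inverse of X.\<close>
  define a where "a = (\<lambda>t. v - \<delta> *\<^sub>R matrix_inv (s t))"
  define X where "X = (\<lambda>t. matrix_inv (a t))"
  define Y where "Y = (\<lambda>t. s t - \<alpha> *\<^sub>R X t)"
  define R where "R = (\<lambda>t. matrix_inv (\<beta> *\<^sub>R mat 1 + Y t ** a t))"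
  have at0: "s 0 = \<alpha> *\<^sub>R x + y" "a 0 = matrix_inv x" "X 0 = x" "Y 0 = y"
    by (simp_all add: s_def a_def X_def Y_def v_def mgig_V_def \<delta>_def invertible_matrix_inv posdef_invertible[OF x])
  have ds: "(s has_vector_derivative (\<alpha>*\<rho>+1)^2 *\<^sub>R n) (at 0)"
    unfolding s_def by (rule line_derivative)
  have dsi: "((\<lambda>t. matrix_inv (s t)) has_vector_derivative - (matrix_inv y ** n ** matrix_inv y)) (at 0)"
    using has_vector_derivative_matrix_inv[OF ds] s0inv \<alpha>\<rho>
    by (simp add: at0 matrix_algebra power2_eq_square)
  have da: "(a has_vector_derivative \<delta> *\<^sub>R (matrix_inv y ** n ** matrix_inv y)) (at 0)"
    unfolding a_def using dsi by (auto intro!: derivative_eq_intros)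
  have iv: "invertible (a 0)" unfolding at0 by (intro posdef_invertible posdef_matrix_inv x)
  have dX: "(X has_vector_derivative - (\<delta> * \<rho>^2) *\<^sub>R n) (at 0)"
  proof -
    have "(X has_vector_derivative - (x ** (\<delta> *\<^sub>R (matrix_inv y ** n ** matrix_inv y)) ** x)) (at 0)"
      using has_vector_derivative_matrix_inv[OF da iv] unfolding X_def[symmetric]
      by (simp add: at0 X_def[symmetric] invertible_matrix_inv(2)[OF posdef_invertible[OF x]])
    moreover have "- (x ** (\<delta> *\<^sub>R (matrix_inv y ** n ** matrix_inv y)) ** x) = - (\<delta> * \<rho>^2) *\<^sub>R n"
      using iy by (simp add: x_def matrix_algebra matrix_inv_props power2_eq_square)
    ultimately show ?thesis by simp
  qed
  have dY: "(Y has_vector_derivative e *\<^sub>R n) (at 0)"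
    unfolding Y_def
    by (rule derivative_eq_intros ds dX refl)+ (simp add: e_def \<delta>_def algebra_simps power2_eq_square)
  have dYa: "((\<lambda>t. \<beta> *\<^sub>R mat 1 + Y t ** a t) has_vector_derivative (e/\<rho> + \<delta>) *\<^sub>R (n ** matrix_inv y)) (at 0)"
  proof -
    have "((\<lambda>t. \<beta> *\<^sub>R mat 1 + Y t ** a t) has_vector_derivative
        0 + (Y 0 ** \<delta> *\<^sub>R (matrix_inv y ** n ** matrix_inv y) + e *\<^sub>R n ** a 0)) (at 0)"
      by (intro has_vector_derivative_add has_vector_derivative_const has_vector_derivative_matrix_mult dY da)
    then show ?thesis
      using iy by (simp add: at0 invx matrix_algebra matrix_inv_props algebra_simps)
  qed
  \<comment> \<open>At time 0 the product Y a is y x^-1, the scalar 1/\<rho>, so R is there the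
    scalar \<tau>.\<close>
  define \<tau> where "\<tau> = \<rho> / (\<beta>*\<rho>+1)"
  have R0: "\<beta> *\<^sub>R mat 1 + Y 0 ** a 0 = (1/\<tau>) *\<^sub>R mat 1"
    using \<rho> \<beta>\<rho> iy by (simp add: at0 invx matrix_algebra matrix_inv_props \<tau>_def field_simps flip: scaleR_add_left)
  have \<tau>: "\<tau> > 0" using \<rho> \<beta>\<rho> by (simp add: \<tau>_def)
  have iR: "invertible (\<beta> *\<^sub>R mat 1 + Y 0 ** a 0)" and R0': "R 0 = \<tau> *\<^sub>R mat 1"
    unfolding R_def R0 using matrix_inv_scaleR[of "mat 1" "1/\<tau>"] \<tau> by (auto simp: invertible_det_nz)
  define \<kappa> where "\<kappa> = \<tau>^2 * (e/\<rho> + \<delta>)"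
  have dR: "(R has_vector_derivative - \<kappa> *\<^sub>R (n ** matrix_inv y)) (at 0)"
  proof -
    have "matrix_inv (\<beta> *\<^sub>R mat 1 + Y 0 ** a 0) = \<tau> *\<^sub>R mat 1"
      using R0' by (simp add: R_def)
    then show ?thesis
      using has_vector_derivative_matrix_inv[OF dYa iR] unfolding R_def[symmetric]
      by (simp add: matrix_algebra \<kappa>_def power2_eq_square mult_ac)
  qed
  have iysym: "transpose (matrix_inv y) = matrix_inv y"
    by (intro posdef_sym posdef_matrix_inv y)
  have dRt: "((\<lambda>t. transpose (R t)) has_vector_derivative - \<kappa> *\<^sub>R (matrix_inv y ** n)) (at 0)"
    using has_vector_derivative_transpose[OF dR] by (simp add: transpose_algebra iysym n)
  have ssym: "transpose (s t) = s t" for t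
    by (simp add: s_def transpose_algebra posdef_sym[OF x] posdef_sym[OF y] n)
  have cont: "(s \<longlongrightarrow> s 0) (nhds 0)" "(a \<longlongrightarrow> a 0) (nhds 0)" "(X \<longlongrightarrow> X 0) (nhds 0)" "(Y \<longlongrightarrow> Y 0) (nhds 0)"
    using has_vector_derivative_continuous[OF ds] has_vector_derivative_continuous[OF da]
      has_vector_derivative_continuous[OF dX] has_vector_derivative_continuous[OF dY]
    by (auto simp: continuous_within tendsto_at_iff_tendsto_nhds)
  have evs: "eventually (\<lambda>t. s t \<in> posdef_mats) (nhds 0)"
    by (rule eventually_posdef[OF cont(1)]) (auto simp: at0 ssym intro!: posdef_scaleR_add \<alpha> x y)
  have vsym: "transpose v = v" unfolding v_def by (intro posdef_sym mgig_V_posdef \<alpha> \<beta> x y)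
  have eva: "eventually (\<lambda>t. a t \<in> posdef_mats) (nhds 0)"
  proof (rule eventually_posdef[OF cont(2)])
    show "a 0 \<in> posdef_mats" unfolding at0 by (intro posdef_matrix_inv x)
    show "eventually (\<lambda>t. transpose (a t) = a t) (nhds 0)"
      using evs by eventually_elim (simp add: a_def transpose_algebra vsym posdef_sym[OF posdef_matrix_inv])
  qed
  have evX: "eventually (\<lambda>t. X t \<in> posdef_mats) (nhds 0)"
    using eva by eventually_elim (simp add: X_def posdef_matrix_inv)
  have evY: "eventually (\<lambda>t. Y t \<in> posdef_mats) (nhds 0)"
    by (rule eventually_posdef[OF cont(4)])
      (use evX in \<open>auto simp: at0 y Y_def transpose_algebra ssym posdef_sym elim!: eventually_mono\<close>)
  have dqX: "((\<lambda>t. q (X t)) has_vector_derivative - (\<delta> * \<rho>^2) *\<^sub>R Dq x n) (at 0)"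
    using has_vector_derivative_compose_within[OF _ dX evX, of q "Dq x"] Dq[OF x] Dq_scale[OF x, of "- (\<delta> * \<rho>^2)"]
    by (simp add: at0)
  have dpY: "((\<lambda>t. p (Y t)) has_vector_derivative e *\<^sub>R Dp y n) (at 0)"
    using has_vector_derivative_compose_within[OF _ dY evY, of p "Dp y"] Dp[OF y] Dp_scale[OF y] by (simp add: at0)
  have dc: "((\<lambda>t. \<beta> *\<^sub>R q (X t) - p (Y t)) has_vector_derivative
      (\<beta> *\<^sub>R (- (\<delta> * \<rho>^2) *\<^sub>R Dq x n) - e *\<^sub>R Dp y n)) (at 0)"
    by (intro has_vector_derivative_diff bounded_linear.has_vector_derivative[OF bounded_linear_scaleR_right] dqX dpY)
  have "((\<lambda>t. q (X t) - \<delta> *\<^sub>R (R t ** (\<beta> *\<^sub>R q (X t) - p (Y t)) ** transpose (R t))) has_vector_derivative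
      - (\<delta> * \<rho>^2) *\<^sub>R Dq x n - \<delta> *\<^sub>R
      (R 0 ** (\<beta> *\<^sub>R q (X 0) - p (Y 0)) ** (- \<kappa> *\<^sub>R (matrix_inv y ** n)) +
       (R 0 ** (\<beta> *\<^sub>R (- (\<delta> * \<rho>^2) *\<^sub>R Dq x n) - e *\<^sub>R Dp y n) +
        - \<kappa> *\<^sub>R (n ** matrix_inv y) ** (\<beta> *\<^sub>R q (X 0) - p (Y 0))) ** transpose (R 0))) (at 0)"
    by (intro has_vector_derivative_diff bounded_linear.has_vector_derivative[OF bounded_linear_scaleR_right]
        has_vector_derivative_matrix_mult dqX dc dR dRt)
  moreover have "eventually (\<lambda>t. q (X t) - \<delta> *\<^sub>R (R t ** (\<beta> *\<^sub>R q (X t) - p (Y t)) ** transpose (R t)) = grad_V \<alpha> \<beta> q p x y) (nhds 0)"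
    using evX evY eva
  proof eventually_elim
    case (elim t)
    have aX: "matrix_inv (X t) = a t"
      by (simp add: X_def invertible_matrix_inv posdef_invertible[OF elim(3)])
    have "mgig_V \<alpha> \<beta> (X t) (Y t) = v"
      by (simp add: mgig_V_def aX Y_def) (simp add: a_def \<delta>_def)
    then have "grad_V \<alpha> \<beta> q p (X t) (Y t) = grad_V \<alpha> \<beta> q p x y"
      by (intro M elim x y) (simp add: v_def)
    then show ?case
      by (simp add: grad_V_def Let_def aX R_def \<delta>_def)
  qed
  ultimately have "- (\<delta> * \<rho>^2) *\<^sub>R Dq x n - \<delta> *\<^sub>R
      (R 0 ** (\<beta> *\<^sub>R q (X 0) - p (Y 0)) ** (- \<kappa> *\<^sub>R (matrix_inv y ** n)) +
       (R 0 ** (\<beta> *\<^sub>R (- (\<delta> * \<rho>^2) *\<^sub>R Dq x n) - e *\<^sub>R Dp y n) +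
        - \<kappa> *\<^sub>R (n ** matrix_inv y) ** (\<beta> *\<^sub>R q (X 0) - p (Y 0))) ** transpose (R 0)) = 0"
    by (rule has_vector_derivative_eventually_const)
  then have "(- (\<delta>*\<rho>^2) + \<delta>*\<tau>^2*\<beta>*\<delta>*\<rho>^2) *\<^sub>R Dq x n + (\<delta>*\<tau>^2*e) *\<^sub>R Dp y n
      + (\<delta>*\<kappa>*\<tau>) *\<^sub>R (n ** matrix_inv y ** c + c ** matrix_inv y ** n) = 0"
    unfolding at0 c_def[symmetric] R0'
    by (simp add: transpose_algebra matrix_algebra) (simp add: algebra_simps power2_eq_square)
  \<comment> \<open>This factor cancels the denominators in \<tau> and \<kappa> and the common
    \<delta>, leaving coefficients that are polynomials in \<rho>.\<close>
  then have "((\<beta>*\<rho>+1)^2/(\<delta>*\<rho>^2)) *\<^sub>R ((- (\<delta>*\<rho>^2) + \<delta>*\<tau>^2*\<beta>*\<delta>*\<rho>^2) *\<^sub>R Dq x n + (\<delta>*\<tau>^2*e) *\<^sub>R Dp y n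
      + (\<delta>*\<kappa>*\<tau>) *\<^sub>R (n ** matrix_inv y ** c + c ** matrix_inv y ** n)) = 0"
    by simp
  moreover have \<delta>: "\<delta> \<noteq> 0" using ne by (simp add: \<delta>_def)
  have "((\<beta>*\<rho>+1)^2/(\<delta>*\<rho>^2)) * (- (\<delta>*\<rho>^2) + \<delta>*\<tau>^2*\<beta>*\<delta>*\<rho>^2) = - (\<alpha>*\<beta>*\<rho>^2 + 2*\<beta>*\<rho> + 1)"
  proof -
    have "((\<beta>*\<rho>+1)^2/(\<delta>*\<rho>^2)) * (- (\<delta>*\<rho>^2) + \<delta>*\<tau>^2*\<beta>*\<delta>*\<rho>^2) = \<beta> * \<delta> * \<rho>^2 - (\<beta>*\<rho>+1)^2"
      using \<rho> \<beta>\<rho> \<delta> by (simp add: \<tau>_def power_divide) (simp add: field_simps)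
    also have "\<dots> = - (\<alpha>*\<beta>*\<rho>^2 + 2*\<beta>*\<rho> + 1)"
      by (simp add: \<delta>_def power2_eq_square algebra_simps)
    finally show ?thesis .
  qed
  moreover have "((\<beta>*\<rho>+1)^2/(\<delta>*\<rho>^2)) * (\<delta>*\<tau>^2*e) = e"
    using \<rho> \<beta>\<rho> \<delta> by (simp add: \<tau>_def power_divide)
  moreover have "((\<beta>*\<rho>+1)^2/(\<delta>*\<rho>^2)) * (\<delta>*\<kappa>*\<tau>) = \<alpha>*\<rho> + 1"
  proof -
    have "((\<beta>*\<rho>+1)^2/(\<delta>*\<rho>^2)) * (\<delta>*\<kappa>*\<tau>) = (e + \<delta>*\<rho>) / (\<beta>*\<rho>+1)"
      using \<rho> \<beta>\<rho> \<delta> by (simp add: \<tau>_def \<kappa>_def power_divide) (simp add: field_simps)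
    also have "e + \<delta>*\<rho> = (\<alpha>*\<rho> + 1) * (\<beta>*\<rho>+1)"
      by (simp add: e_def \<delta>_def power2_eq_square algebra_simps)
    finally show ?thesis using \<beta>\<rho> by simp
  qed
  ultimately have "(- (\<alpha>*\<beta>*\<rho>^2 + 2*\<beta>*\<rho> + 1)) *\<^sub>R Dq x n + e *\<^sub>R Dp y n
      + (\<alpha>*\<rho> + 1) *\<^sub>R (n ** matrix_inv y ** c + c ** matrix_inv y ** n) = 0"
    by (simp only: scaleR_sum3)
  then show ?thesis
    unfolding x_def[symmetric] e_def[symmetric] c_def[symmetric]
    by (simp only: scaleR_minus_left) (simp add: algebra_simps)
qed


text \<open>The unique solution of \<open>p = \<beta> bb - ll - aa\<close>, \<open>p1 = - ll - 2 aa\<close>, \<open>q = bb + ll - \<alpha> aa\<close>.\<close>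

private definition p1 where "p1 y = Dp y y"
private definition aa where "aa y = (1/(1+2*\<beta>+\<alpha>*\<beta>)) *\<^sub>R (p y - p1 y - \<beta> *\<^sub>R q y - \<beta> *\<^sub>R p1 y)"
private definition ll where "ll y = - p1 y - 2 *\<^sub>R aa y"
private definition bb where "bb y = q y + p1 y + (2 + \<alpha>) *\<^sub>R aa y"

private lemma p_decomp: "p y = \<beta> *\<^sub>R bb y - ll y - aa y"
proof -
  \<comment> \<open>The determinant, up to sign, of the linear system for the three coefficients. It
    is also the value at t = 1 of the weight \<open>w\<close> used in \<open>q_ray\<close>.\<close>
  have "1+2*\<beta>+\<alpha>*\<beta> > 0" using \<alpha> \<beta> by (simp add: add_pos_nonneg)
  then have "(1+2*\<beta>+\<alpha>*\<beta>) *\<^sub>R aa y = p y - p1 y - \<beta> *\<^sub>R q y - \<beta> *\<^sub>R p1 y"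
    by (simp add: aa_def)
  from arg_cong[OF this, of "\<lambda>x. x$i$j" for i j] show ?thesis
    unfolding bb_def ll_def by (simp add: vec_eq_iff algebra_simps)
qed

text \<open>In the direction n = y the operator c \<mapsto> n y^-1 c + c y^-1 n is multiplication by
  2, so the ray equation is a linear differential equation w f' = w' f + inhomogeneity in t. The
  homogeneous solutions are multiples of w. The quadratic is the particular solution that agrees
  with q at t = 1, so the difference divided by w is constant and zero.\<close>

private lemma q_ray:
  assumes y: "y \<in> posdef_mats" and \<rho>: "\<rho> > 0"
  shows "q (\<rho> *\<^sub>R y) = bb y + \<rho> *\<^sub>R ll y - (\<alpha> * \<rho>^2) *\<^sub>R aa y"
proof -
  define w where "w = (\<lambda>t. \<alpha>*\<beta>*t^2 + 2*\<beta>*t + 1)"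
  define f where "f = (\<lambda>t. bb y + t *\<^sub>R ll y - (\<alpha> * t^2) *\<^sub>R aa y)"
  define \<psi> where "\<psi> = (\<lambda>t. (1 / w t) *\<^sub>R (q (t *\<^sub>R y) - f t))"
  have w: "w t > 0" if "t > 0" for t
    unfolding w_def using \<alpha> \<beta> that by (simp add: add_nonneg_pos)
  have d: "(\<psi> has_vector_derivative 0) (at t)" if t: "t > 0" for t
  proof -
    have ty: "t *\<^sub>R y \<in> posdef_mats" using y t by (rule posdef_scaleR)
    have "eventually (\<lambda>u. u \<in> {0<..}) (nhds t)"
      using t by (intro eventually_nhds_in_open) auto
    then have evt: "eventually (\<lambda>u. u *\<^sub>R y \<in> posdef_mats) (nhds t)"
      by eventually_elim (use y in \<open>auto intro: posdef_scaleR\<close>)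
    have "((\<lambda>u. u *\<^sub>R y) has_vector_derivative y) (at t)"
      by (auto intro!: derivative_eq_intros)
    from has_vector_derivative_compose_within[OF _ this evt, OF Dq[OF ty]]
    have dq: "((\<lambda>t. q (t *\<^sub>R y)) has_vector_derivative Dq (t *\<^sub>R y) y) (at t)" .
    have df: "(f has_vector_derivative ll y - (2*\<alpha>*t) *\<^sub>R aa y) (at t)"
      unfolding f_def by (auto intro!: derivative_eq_intros)
    have dw: "((\<lambda>t. 1 / w t) has_field_derivative - ((2*\<alpha>*\<beta>*t + 2*\<beta>) / (w t)^2)) (at t)"
      using w[OF t] unfolding w_def by (auto intro!: derivative_eq_intros simp: power2_eq_square minus_divide_left)
    have "(\<psi> has_vector_derivative (1 / w t) *\<^sub>R (Dq (t *\<^sub>R y) y - (ll y - (2*\<alpha>*t) *\<^sub>R aa y)) +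
        (- ((2*\<alpha>*\<beta>*t + 2*\<beta>) / (w t)^2)) *\<^sub>R (q (t *\<^sub>R y) - f t)) (at t)"
      unfolding \<psi>_def
      by (intro has_vector_derivative_scaleR dw has_vector_derivative_diff dq df)
    moreover have "w t *\<^sub>R (Dq (t *\<^sub>R y) y - (ll y - (2*\<alpha>*t) *\<^sub>R aa y)) = (2*\<alpha>*\<beta>*t + 2*\<beta>) *\<^sub>R (q (t *\<^sub>R y) - f t)"
    proof -
      have ysym: "transpose y = y" by (rule posdef_sym[OF y])
      have iy: "invertible y" by (rule posdef_invertible[OF y])
      have 1: "w t *\<^sub>R Dq (t *\<^sub>R y) y = (\<alpha>*\<beta>*t^2 + 2*\<alpha>*t + 1) *\<^sub>R p1 y + (2 * (\<alpha>*t+1)) *\<^sub>R (\<beta> *\<^sub>R q (t *\<^sub>R y) - p y)"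
      proof -
        have "y ** matrix_inv y ** c + c ** matrix_inv y ** y = 2 *\<^sub>R c" for c
          using iy by (simp only: matrix_inv_props matrix_mul_lid scaleR_2)
        then show ?thesis
          using ray_eq[OF y ysym t] by (simp only: w_def p1_def scaleR_scaleR mult.commute)
      qed
      have 2: "p1 y = - ll y - 2 *\<^sub>R aa y" by (simp add: ll_def)
      have "w t *\<^sub>R (Dq (t *\<^sub>R y) y - (ll y - (2*\<alpha>*t) *\<^sub>R aa y)) = w t *\<^sub>R Dq (t *\<^sub>R y) y - w t *\<^sub>R (ll y - (2*\<alpha>*t) *\<^sub>R aa y)"
        by (rule scaleR_diff_right)
      also have "\<dots> = (\<alpha>*\<beta>*t^2 + 2*\<alpha>*t + 1) *\<^sub>R (- ll y - 2 *\<^sub>R aa y)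
          + (2 * (\<alpha>*t+1)) *\<^sub>R (\<beta> *\<^sub>R q (t *\<^sub>R y) - (\<beta> *\<^sub>R bb y - ll y - aa y)) - w t *\<^sub>R (ll y - (2*\<alpha>*t) *\<^sub>R aa y)"
        by (simp only: 1 2 p_decomp[of y, symmetric])
      also have "\<dots> = (2*\<alpha>*\<beta>*t + 2*\<beta>) *\<^sub>R (q (t *\<^sub>R y) - f t)"
        unfolding f_def w_def by (rule ray_equation_quadratic)
      finally show ?thesis .
    qed
    then have "(1 / (w t)^2) *\<^sub>R (w t *\<^sub>R (Dq (t *\<^sub>R y) y - (ll y - (2*\<alpha>*t) *\<^sub>R aa y))) = (1 / (w t)^2) *\<^sub>R ((2*\<alpha>*\<beta>*t + 2*\<beta>) *\<^sub>R (q (t *\<^sub>R y) - f t))"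
      by simp
    then have "(1 / w t) *\<^sub>R (Dq (t *\<^sub>R y) y - (ll y - (2*\<alpha>*t) *\<^sub>R aa y)) + (- ((2*\<alpha>*\<beta>*t + 2*\<beta>) / (w t)^2)) *\<^sub>R (q (t *\<^sub>R y) - f t) = 0"
      using w[OF t] by (simp only: scaleR_scaleR) (simp add: power2_eq_square)
    ultimately show ?thesis by simp
  qed
  have "\<psi> \<rho> = \<psi> 1"
    by (rule has_derivative_zero_unique[of "{0<..}" \<psi> \<rho> 1])
      (use d \<rho> in \<open>auto simp: has_vector_derivative_def intro: has_derivative_at_withinI\<close>)
  moreover have "\<psi> 1 = 0"
    unfolding \<psi>_def f_def by (simp add: bb_def ll_def algebra_simps)
  ultimately have "(1 / w \<rho>) *\<^sub>R (q (\<rho> *\<^sub>R y) - f \<rho>) = 0"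
    by (simp add: \<psi>_def)
  then show ?thesis using w[OF \<rho>] by (simp add: f_def)
qed

text \<open>Expanding q at r t y from the base point y and from the base point t y gives two
  polynomials in r. They control a only through \<alpha> a.\<close>

private lemma homogeneous:
  assumes y: "y \<in> posdef_mats" and t: "t > 0"
  shows "ll (t *\<^sub>R y) = t *\<^sub>R ll y" "\<alpha> *\<^sub>R aa (t *\<^sub>R y) = (\<alpha> * t^2) *\<^sub>R aa y"
proof -
  have ty: "t *\<^sub>R y \<in> posdef_mats" using y t by (rule posdef_scaleR)
  have *: "(bb (t *\<^sub>R y) - bb y) + r *\<^sub>R (ll (t *\<^sub>R y) - t *\<^sub>R ll y) + r^2 *\<^sub>R ((\<alpha> * t^2) *\<^sub>R aa y - \<alpha> *\<^sub>R aa (t *\<^sub>R y))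
     + r^3 *\<^sub>R 0 + r^4 *\<^sub>R 0 = 0" if r: "r > 0" for r
    using q_ray[OF ty r] q_ray[OF y, of "r * t"] r t by (simp add: algebra_simps power_mult_distrib)
  show "ll (t *\<^sub>R y) = t *\<^sub>R ll y" "\<alpha> *\<^sub>R aa (t *\<^sub>R y) = (\<alpha> * t^2) *\<^sub>R aa y"
    using matrix_poly4_eq_0(2,3)[OF *] by simp_all
qed

text \<open>Interpolation of the quadratic \<rho> \<mapsto> q(\<rho> y) at \<rho> = 1, 2, 3. The
  definitions involve the derivative \<open>p1\<close>, about whose differentiability nothing is
  known; these expressions in q and p alone are differentiable. Since \<alpha> may be 0, a itself is
  taken from the decomposition of p.\<close>

private lemma coeffs_eq:
  assumes y: "y \<in> posdef_mats"
  shows "\<alpha> *\<^sub>R aa y = (-1/2) *\<^sub>R (q y - 2 *\<^sub>R q (2 *\<^sub>R y) + q (3 *\<^sub>R y))"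
    "ll y = q (2 *\<^sub>R y) - q y + 3 *\<^sub>R ((-1/2) *\<^sub>R (q y - 2 *\<^sub>R q (2 *\<^sub>R y) + q (3 *\<^sub>R y)))"
    "bb y = q y - ll y + (-1/2) *\<^sub>R (q y - 2 *\<^sub>R q (2 *\<^sub>R y) + q (3 *\<^sub>R y))"
    "aa y = \<beta> *\<^sub>R bb y - ll y - p y"
proof -
  have "q y = bb y + ll y - \<alpha> *\<^sub>R aa y" "q (2 *\<^sub>R y) = bb y + 2 *\<^sub>R ll y - (\<alpha> * 4) *\<^sub>R aa y"
    "q (3 *\<^sub>R y) = bb y + 3 *\<^sub>R ll y - (\<alpha> * 9) *\<^sub>R aa y"
    using q_ray[OF y, of 1] q_ray[OF y, of 2] q_ray[OF y, of 3] by simp_all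
  then show "\<alpha> *\<^sub>R aa y = (-1/2) *\<^sub>R (q y - 2 *\<^sub>R q (2 *\<^sub>R y) + q (3 *\<^sub>R y))"
    "ll y = q (2 *\<^sub>R y) - q y + 3 *\<^sub>R ((-1/2) *\<^sub>R (q y - 2 *\<^sub>R q (2 *\<^sub>R y) + q (3 *\<^sub>R y)))"
    "bb y = q y - ll y + (-1/2) *\<^sub>R (q y - 2 *\<^sub>R q (2 *\<^sub>R y) + q (3 *\<^sub>R y))"
    by (simp_all add: vec_eq_iff)
  show "aa y = \<beta> *\<^sub>R bb y - ll y - p y"
    by (simp add: p_decomp)
qed

private lemma coeffs_sym:
  assumes y: "y \<in> posdef_mats"
  shows "transpose (ll y) = ll y" "transpose (bb y) = bb y" "transpose (aa y) = aa y"
proof -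
  have s: "transpose (q y) = q y" "transpose (q (2 *\<^sub>R y)) = q (2 *\<^sub>R y)" "transpose (q (3 *\<^sub>R y)) = q (3 *\<^sub>R y)"
    "transpose (p y) = p y"
    using y posdef_scaleR[OF y] by (auto intro!: qsym psym)
  show l: "transpose (ll y) = ll y" using s by (simp add: coeffs_eq(2)[OF y] transpose_algebra)
  show b: "transpose (bb y) = bb y" using s l by (simp add: coeffs_eq(3)[OF y] transpose_algebra)
  show "transpose (aa y) = aa y" using s l b by (simp add: coeffs_eq(4)[OF y] transpose_algebra)
qed

private lemma q_scaled_line:
  assumes y: "y \<in> posdef_mats" and n: "transpose n = n" and \<rho>: "\<rho> > 0"
  shows "((\<lambda>t. q (\<rho> *\<^sub>R (y + t *\<^sub>R n))) has_vector_derivative \<rho> *\<^sub>R Dq (\<rho> *\<^sub>R y) n) (at 0)"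
proof -
  have "\<rho> *\<^sub>R y \<in> posdef_mats" using y \<rho> by (rule posdef_scaleR)
  moreover have "transpose (\<rho> *\<^sub>R n) = \<rho> *\<^sub>R n" using n by (simp add: transpose_algebra)
  ultimately show ?thesis
    using q_line[of "\<rho> *\<^sub>R y" "\<rho> *\<^sub>R n"] Dq_scale[of "\<rho> *\<^sub>R y" \<rho> n] by (simp add: algebra_simps)
qed

text \<open>The last two conclusions replace \<open>Dp\<close> and \<open>Dq\<close> in the ray
  equation by derivatives of the coefficients, with an explicit dependence on \<rho>.\<close>

private lemma line_derivs:
  assumes y: "y \<in> posdef_mats" and n: "transpose n = n"
  obtains Db Dl Da where
    "((\<lambda>t. bb (y + t *\<^sub>R n)) has_vector_derivative Db) (at 0)"
    "((\<lambda>t. ll (y + t *\<^sub>R n)) has_vector_derivative Dl) (at 0)"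
    "((\<lambda>t. aa (y + t *\<^sub>R n)) has_vector_derivative Da) (at 0)"
    "Dp y n = \<beta> *\<^sub>R Db - Dl - Da"
    "\<forall>\<rho>>0. \<rho> *\<^sub>R Dq (\<rho> *\<^sub>R y) n = Db + \<rho> *\<^sub>R Dl - (\<alpha> * \<rho>^2) *\<^sub>R Da"
proof -
  note ev = line_posdef[OF y n]
  define Q2 where "Q2 = 2 *\<^sub>R Dq (2 *\<^sub>R y) n"
  define Q3 where "Q3 = 3 *\<^sub>R Dq (3 *\<^sub>R y) n"
  define A where "A = (-1/2) *\<^sub>R (Dq y n - 2 *\<^sub>R Q2 + Q3)"
  define Dl where "Dl = Q2 - Dq y n + 3 *\<^sub>R A"
  define Db where "Db = Dq y n - Dl + A"
  define Da where "Da = \<beta> *\<^sub>R Db - Dl - Dp y n"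
  note sc = bounded_linear.has_vector_derivative[OF bounded_linear_scaleR_right]
  have dA: "((\<lambda>t. (-1/2) *\<^sub>R (q (y + t *\<^sub>R n) - 2 *\<^sub>R q (2 *\<^sub>R (y + t *\<^sub>R n)) + q (3 *\<^sub>R (y + t *\<^sub>R n)))) has_vector_derivative A) (at 0)"
    unfolding A_def Q2_def Q3_def
    by (intro has_vector_derivative_diff has_vector_derivative_add sc q_line y n q_scaled_line) auto
  have dl: "((\<lambda>t. ll (y + t *\<^sub>R n)) has_vector_derivative Dl) (at 0)"
  proof (rule has_vector_derivative_transform_eventually)
    show "((\<lambda>t. q (2 *\<^sub>R (y + t *\<^sub>R n)) - q (y + t *\<^sub>R n) + 3 *\<^sub>R ((-1/2) *\<^sub>R (q (y + t *\<^sub>R n) - 2 *\<^sub>R q (2 *\<^sub>R (y + t *\<^sub>R n)) + q (3 *\<^sub>R (y + t *\<^sub>R n))))) has_vector_derivative Dl) (at 0)"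
      unfolding Dl_def Q2_def
      by (intro has_vector_derivative_diff has_vector_derivative_add sc q_line y n q_scaled_line dA) auto
  qed (use ev in eventually_elim, simp only: coeffs_eq(2))
  have db: "((\<lambda>t. bb (y + t *\<^sub>R n)) has_vector_derivative Db) (at 0)"
  proof (rule has_vector_derivative_transform_eventually)
    show "((\<lambda>t. q (y + t *\<^sub>R n) - ll (y + t *\<^sub>R n) + (-1/2) *\<^sub>R (q (y + t *\<^sub>R n) - 2 *\<^sub>R q (2 *\<^sub>R (y + t *\<^sub>R n)) + q (3 *\<^sub>R (y + t *\<^sub>R n)))) has_vector_derivative Db) (at 0)"
      unfolding Db_def
      by (intro has_vector_derivative_diff has_vector_derivative_add sc q_line y n dl dA)
  qed (use ev in eventually_elim, simp only: coeffs_eq(3))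
  have da: "((\<lambda>t. aa (y + t *\<^sub>R n)) has_vector_derivative Da) (at 0)"
  proof (rule has_vector_derivative_transform_eventually)
    show "((\<lambda>t. \<beta> *\<^sub>R bb (y + t *\<^sub>R n) - ll (y + t *\<^sub>R n) - p (y + t *\<^sub>R n)) has_vector_derivative Da) (at 0)"
      unfolding Da_def
      by (intro has_vector_derivative_diff has_vector_derivative_add sc p_line y n dl db)
  qed (use ev in eventually_elim, simp only: coeffs_eq(4))
  have "\<rho> *\<^sub>R Dq (\<rho> *\<^sub>R y) n = Db + \<rho> *\<^sub>R Dl - (\<alpha> * \<rho>^2) *\<^sub>R Da" if \<rho>: "\<rho> > 0" for \<rho>
  proof (rule vector_derivative_unique_at)
    show "((\<lambda>t. q (\<rho> *\<^sub>R (y + t *\<^sub>R n))) has_vector_derivative \<rho> *\<^sub>R Dq (\<rho> *\<^sub>R y) n) (at 0)"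
      by (rule q_scaled_line[OF y n \<rho>])
    show "((\<lambda>t. q (\<rho> *\<^sub>R (y + t *\<^sub>R n))) has_vector_derivative Db + \<rho> *\<^sub>R Dl - (\<alpha> * \<rho>^2) *\<^sub>R Da) (at 0)"
    proof (rule has_vector_derivative_transform_eventually)
      show "((\<lambda>t. bb (y + t *\<^sub>R n) + \<rho> *\<^sub>R ll (y + t *\<^sub>R n) - (\<alpha> * \<rho>^2) *\<^sub>R aa (y + t *\<^sub>R n)) has_vector_derivative
          Db + \<rho> *\<^sub>R Dl - (\<alpha> * \<rho>^2) *\<^sub>R Da) (at 0)"
        by (intro has_vector_derivative_diff has_vector_derivative_add sc db dl da)
    qed (use ev in eventually_elim, simp only: q_ray[OF _ \<rho>])
  qed
  then show ?thesis
    using that[OF db dl da] by (simp add: Da_def)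
qed

text \<open>After substitution the ray equation is a quartic in \<rho> that vanishes for all \<rho>
  > 0. The constant term gives the derivative of b, the linear term the first relation, and the
  quadratic term combined with the linear one the relation carrying the factor \<beta>.\<close>

private lemma pde_coeffs:
  assumes y: "y \<in> posdef_mats" and n: "transpose n = n"
  defines "L \<equiv> \<lambda>c. n ** matrix_inv y ** c + c ** matrix_inv y ** n"
  obtains Dl Da where
    "((\<lambda>t. bb (y + t *\<^sub>R n)) has_vector_derivative 0) (at 0)"
    "((\<lambda>t. ll (y + t *\<^sub>R n)) has_vector_derivative Dl) (at 0)"
    "((\<lambda>t. aa (y + t *\<^sub>R n)) has_vector_derivative Da) (at 0)"
    "2 *\<^sub>R Dl + Da = L (ll y) + L (aa y)" "\<beta> *\<^sub>R (2 *\<^sub>R Dl - L (ll y)) = 0"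
proof (rule line_derivs[OF y n], goal_cases)
  case (1 Db Dl Da)
  note d = 1(2-4) and Dpn = 1(5) and Dqn = 1(6)
  define K1 where "K1 = L (ll y)"
  define K2 where "K2 = L (aa y)"
  have *: "Db + \<rho> *\<^sub>R ((2*\<beta>) *\<^sub>R Db + Dl - Dp y n - K1 - K2) +
      \<rho>^2 *\<^sub>R ((\<alpha>*\<beta>) *\<^sub>R Db + (2*\<beta>) *\<^sub>R Dl - \<alpha> *\<^sub>R Da - (2*\<alpha>) *\<^sub>R Dp y n - (\<alpha>+\<beta>) *\<^sub>R K1 - \<alpha> *\<^sub>R K2) +
      \<rho>^3 *\<^sub>R ((\<alpha>*\<beta>) *\<^sub>R Dl - (2*\<alpha>*\<beta>) *\<^sub>R Da - (\<alpha>*\<beta>) *\<^sub>R Dp y n - (\<alpha>*\<beta>) *\<^sub>R K1 + (\<alpha>*\<beta>) *\<^sub>R K2) +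
      \<rho>^4 *\<^sub>R ((\<alpha>*\<alpha>*\<beta>) *\<^sub>R K2 - (\<alpha>*\<alpha>*\<beta>) *\<^sub>R Da) = 0" if \<rho>: "\<rho> > 0" for \<rho>
  proof -
    have c: "\<beta> *\<^sub>R q (\<rho> *\<^sub>R y) - p y = (\<beta>*\<rho>+1) *\<^sub>R ll y + (1 - \<alpha>*\<beta>*\<rho>^2) *\<^sub>R aa y"
      unfolding q_ray[OF y \<rho>] p_decomp[of y] by (simp add: algebra_simps)
    have Lc: "n ** matrix_inv y ** (\<beta> *\<^sub>R q (\<rho> *\<^sub>R y) - p y) + (\<beta> *\<^sub>R q (\<rho> *\<^sub>R y) - p y) ** matrix_inv y ** n
       = (\<beta>*\<rho>+1) *\<^sub>R K1 + (1 - \<alpha>*\<beta>*\<rho>^2) *\<^sub>R K2"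
      unfolding c K1_def K2_def L_def by (simp add: matrix_algebra scaleR_add_right)
    have "\<rho> *\<^sub>R ((\<alpha>*\<beta>*\<rho>^2 + 2*\<beta>*\<rho> + 1) *\<^sub>R Dq (\<rho> *\<^sub>R y) n) = (\<alpha>*\<beta>*\<rho>^2 + 2*\<beta>*\<rho> + 1) *\<^sub>R (\<rho> *\<^sub>R Dq (\<rho> *\<^sub>R y) n)"
      by (simp add: mult.commute)
    then have "(\<alpha>*\<beta>*\<rho>^2 + 2*\<beta>*\<rho> + 1) *\<^sub>R (Db + \<rho> *\<^sub>R Dl - (\<alpha> * \<rho>^2) *\<^sub>R Da) =
      \<rho> *\<^sub>R ((\<alpha>*\<beta>*\<rho>^2 + 2*\<alpha>*\<rho> + 1) *\<^sub>R Dp y n + (\<alpha>*\<rho> + 1) *\<^sub>R ((\<beta>*\<rho>+1) *\<^sub>R K1 + (1 - \<alpha>*\<beta>*\<rho>^2) *\<^sub>R K2))"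
      unfolding Dqn[rule_format, OF \<rho>] ray_eq[OF y n \<rho>] Lc by simp
    note this[THEN arg_cong, of "\<lambda>x. x$i$j" for i j]
    then have "(\<alpha>*\<beta>*\<rho>^2 + 2*\<beta>*\<rho> + 1) * (Db$i$j + \<rho> * Dl$i$j - (\<alpha> * \<rho>^2) * Da$i$j) =
      \<rho> * ((\<alpha>*\<beta>*\<rho>^2 + 2*\<alpha>*\<rho> + 1) * Dp y n$i$j + (\<alpha>*\<rho> + 1) * ((\<beta>*\<rho>+1) * K1$i$j + (1 - \<alpha>*\<beta>*\<rho>^2) * K2$i$j))" for i j
      by simp
    then have "Db$i$j + \<rho> * ((2*\<beta>) * Db$i$j + Dl$i$j - Dp y n$i$j - K1$i$j - K2$i$j) +
      \<rho>^2 * ((\<alpha>*\<beta>) * Db$i$j + (2*\<beta>) * Dl$i$j - \<alpha> * Da$i$j - (2*\<alpha>) * Dp y n$i$j - (\<alpha>+\<beta>) * K1$i$j - \<alpha> * K2$i$j) +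
      \<rho>^3 * ((\<alpha>*\<beta>) * Dl$i$j - (2*\<alpha>*\<beta>) * Da$i$j - (\<alpha>*\<beta>) * Dp y n$i$j - (\<alpha>*\<beta>) * K1$i$j + (\<alpha>*\<beta>) * K2$i$j) +
      \<rho>^4 * ((\<alpha>*\<alpha>*\<beta>) * K2$i$j - (\<alpha>*\<alpha>*\<beta>) * Da$i$j) = 0" for i j
      by (rule ray_equation_coefficients)
    then show ?thesis
      by (simp add: vec_eq_iff)
  qed
  note z = matrix_poly4_eq_0[OF *]
  have Db: "Db = 0" by (rule z(1))
  have e1: "2 *\<^sub>R Dl + Da = K1 + K2"
    using z(2) unfolding Dpn Db by (simp add: algebra_simps scaleR_2)
  have e2: "(2*\<beta>) *\<^sub>R Dl - \<alpha> *\<^sub>R Da - (2*\<alpha>) *\<^sub>R (- Dl - Da) - (\<alpha>+\<beta>) *\<^sub>R K1 - \<alpha> *\<^sub>R K2 = 0"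
    using z(3) unfolding Dpn Db by simp
  have K2': "K2 = 2 *\<^sub>R Dl + Da - K1" using e1 by (simp add: algebra_simps)
  have "\<beta> *\<^sub>R (2 *\<^sub>R Dl - K1) =
      (2*\<beta>) *\<^sub>R Dl - \<alpha> *\<^sub>R Da - (2*\<alpha>) *\<^sub>R (- Dl - Da) - (\<alpha>+\<beta>) *\<^sub>R K1 - \<alpha> *\<^sub>R K2"
    unfolding K2' by (simp add: vec_eq_iff algebra_simps)
  then have "\<beta> *\<^sub>R (2 *\<^sub>R Dl - K1) = 0"
    using e2 by simp
  with d e1 show ?case
    unfolding Db K1_def K2_def by (intro 1(1))
qed

private lemma pde:
  assumes y: "y \<in> posdef_mats" and n: "transpose n = n"
  shows "((\<lambda>t. bb (y + t *\<^sub>R n)) has_vector_derivative 0) (at 0)"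
    "((\<lambda>t. ll (y + t *\<^sub>R n)) has_vector_derivative (1/2) *\<^sub>R (n ** matrix_inv y ** ll y + ll y ** matrix_inv y ** n)) (at 0)"
    "((\<lambda>t. aa (y + t *\<^sub>R n)) has_vector_derivative (n ** matrix_inv y ** aa y + aa y ** matrix_inv y ** n)) (at 0)"
proof -
  define L where "L = (\<lambda>c. n ** matrix_inv y ** c + c ** matrix_inv y ** n)"
  obtain Dl Da where d:
    "((\<lambda>t. bb (y + t *\<^sub>R n)) has_vector_derivative 0) (at 0)"
    "((\<lambda>t. ll (y + t *\<^sub>R n)) has_vector_derivative Dl) (at 0)"
    "((\<lambda>t. aa (y + t *\<^sub>R n)) has_vector_derivative Da) (at 0)"
    and e: "2 *\<^sub>R Dl + Da = L (ll y) + L (aa y)" "\<beta> *\<^sub>R (2 *\<^sub>R Dl - L (ll y)) = 0"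
    by (rule pde_coeffs[OF y n]) (rule that; unfold L_def; assumption)
  have "2 *\<^sub>R Dl = L (ll y) \<and> Da = L (aa y)"
  proof (cases "\<beta> = 0")
    case False
    then show ?thesis using e by auto
  next
    case True
    \<comment> \<open>For \<beta> = 0 the second relation is empty. Now \<alpha> \<noteq> 0 makes a
      homogeneous of degree two, whereas l has degree one; as n y^-1 is unchanged when n and y are
      doubled, the first relation at 2y and 2n is a further independent equation.\<close>
    then have \<alpha>0: "\<alpha> \<noteq> 0" using ne by simp
    have y2: "2 *\<^sub>R y \<in> posdef_mats" using y by (intro posdef_scaleR) auto
    have n2: "transpose (2 *\<^sub>R n) = 2 *\<^sub>R n" using n by (simp add: transpose_algebra)
    have aa2: "aa (2 *\<^sub>R z) = 4 *\<^sub>R aa z" if "z \<in> posdef_mats" for z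
    proof -
      have "\<alpha> *\<^sub>R aa (2 *\<^sub>R z) = \<alpha> *\<^sub>R (4 *\<^sub>R aa z)"
        using homogeneous(2)[OF that, of 2] by simp
      then show ?thesis using \<alpha>0 scaleR_cancel_left by blast
    qed
    obtain Dl' Da' where d':
      "((\<lambda>t. bb (2 *\<^sub>R y + t *\<^sub>R (2 *\<^sub>R n))) has_vector_derivative 0) (at 0)"
      "((\<lambda>t. ll (2 *\<^sub>R y + t *\<^sub>R (2 *\<^sub>R n))) has_vector_derivative Dl') (at 0)"
      "((\<lambda>t. aa (2 *\<^sub>R y + t *\<^sub>R (2 *\<^sub>R n))) has_vector_derivative Da') (at 0)"
      and e': "2 *\<^sub>R Dl' + Da' = (2 *\<^sub>R n ** matrix_inv (2 *\<^sub>R y) ** ll (2 *\<^sub>R y) + ll (2 *\<^sub>R y) ** matrix_inv (2 *\<^sub>R y) ** 2 *\<^sub>R n)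
        + (2 *\<^sub>R n ** matrix_inv (2 *\<^sub>R y) ** aa (2 *\<^sub>R y) + aa (2 *\<^sub>R y) ** matrix_inv (2 *\<^sub>R y) ** 2 *\<^sub>R n)"
        "\<beta> *\<^sub>R (2 *\<^sub>R Dl' - (2 *\<^sub>R n ** matrix_inv (2 *\<^sub>R y) ** ll (2 *\<^sub>R y) + ll (2 *\<^sub>R y) ** matrix_inv (2 *\<^sub>R y) ** 2 *\<^sub>R n)) = 0"
      by (rule pde_coeffs[OF y2 n2]) (rule that; assumption)
    have i2: "matrix_inv (2 *\<^sub>R y) = (1/2) *\<^sub>R matrix_inv y"
      by (intro matrix_inv_scaleR posdef_invertible y) auto
    have "2 *\<^sub>R Dl' + Da' = L (2 *\<^sub>R ll y) + L (4 *\<^sub>R aa y)"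
      unfolding e'(1) aa2[OF y] homogeneous(1)[OF y, of 2, simplified] i2 L_def
      by (simp add: matrix_algebra)
    moreover have "Dl' = 2 *\<^sub>R Dl"
    proof (rule vector_derivative_unique_at[OF d'(2)])
      show "((\<lambda>t. ll (2 *\<^sub>R y + t *\<^sub>R (2 *\<^sub>R n))) has_vector_derivative 2 *\<^sub>R Dl) (at 0)"
      proof (rule has_vector_derivative_transform_eventually)
        show "((\<lambda>t. 2 *\<^sub>R ll (y + t *\<^sub>R n)) has_vector_derivative 2 *\<^sub>R Dl) (at 0)"
          by (intro bounded_linear.has_vector_derivative[OF bounded_linear_scaleR_right] d)
        show "eventually (\<lambda>t. 2 *\<^sub>R ll (y + t *\<^sub>R n) = ll (2 *\<^sub>R y + t *\<^sub>R (2 *\<^sub>R n))) (nhds 0)"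
          using line_posdef[OF y n]
        proof eventually_elim
          case (elim t)
          from homogeneous(1)[OF elim, of 2] show ?case by (simp add: algebra_simps)
        qed
      qed
    qed
    moreover have "Da' = 4 *\<^sub>R Da"
    proof (rule vector_derivative_unique_at[OF d'(3)])
      show "((\<lambda>t. aa (2 *\<^sub>R y + t *\<^sub>R (2 *\<^sub>R n))) has_vector_derivative 4 *\<^sub>R Da) (at 0)"
      proof (rule has_vector_derivative_transform_eventually)
        show "((\<lambda>t. 4 *\<^sub>R aa (y + t *\<^sub>R n)) has_vector_derivative 4 *\<^sub>R Da) (at 0)"
          by (intro bounded_linear.has_vector_derivative[OF bounded_linear_scaleR_right] d)
        show "eventually (\<lambda>t. 4 *\<^sub>R aa (y + t *\<^sub>R n) = aa (2 *\<^sub>R y + t *\<^sub>R (2 *\<^sub>R n))) (nhds 0)"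
          using line_posdef[OF y n]
        proof eventually_elim
          case (elim t)
          from aa2[OF elim] show ?case by (simp add: algebra_simps)
        qed
      qed
    qed
    moreover have "L (2 *\<^sub>R ll y) = 2 *\<^sub>R L (ll y)" "L (4 *\<^sub>R aa y) = 4 *\<^sub>R L (aa y)"
      unfolding L_def by (simp_all add: matrix_algebra scaleR_add_right)
    ultimately have e2: "4 *\<^sub>R Dl + 4 *\<^sub>R Da = 2 *\<^sub>R L (ll y) + 4 *\<^sub>R L (aa y)"
      by simp
    have "(4 *\<^sub>R Dl + 4 *\<^sub>R Da) - 2 *\<^sub>R (2 *\<^sub>R Dl + Da) = (2 *\<^sub>R L (ll y) + 4 *\<^sub>R L (aa y)) - 2 *\<^sub>R (L (ll y) + L (aa y))"
      using e(1) e2 by simp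
    then have "2 *\<^sub>R Da = 2 *\<^sub>R L (aa y)"
      by (simp add: vec_eq_iff)
    then show ?thesis using e(1) by simp
  qed
  moreover have "Dl = (1/2) *\<^sub>R (2 *\<^sub>R Dl)" by simp
  ultimately have "Dl = (1/2) *\<^sub>R L (ll y)" "Da = L (aa y)"
    by auto
  with d show "((\<lambda>t. bb (y + t *\<^sub>R n)) has_vector_derivative 0) (at 0)"
    "((\<lambda>t. ll (y + t *\<^sub>R n)) has_vector_derivative (1/2) *\<^sub>R (n ** matrix_inv y ** ll y + ll y ** matrix_inv y ** n)) (at 0)"
    "((\<lambda>t. aa (y + t *\<^sub>R n)) has_vector_derivative (n ** matrix_inv y ** aa y + aa y ** matrix_inv y ** n)) (at 0)"
    by (simp_all add: L_def)
qed

lemma ray_decomposition: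
  obtains b l a :: "real^'n^'n \<Rightarrow> real^'n^'n" where
    "\<And>y. y \<in> posdef_mats \<Longrightarrow> transpose (b y) = b y"
    "\<And>y. y \<in> posdef_mats \<Longrightarrow> transpose (l y) = l y"
    "\<And>y. y \<in> posdef_mats \<Longrightarrow> transpose (a y) = a y"
    "\<And>y. y \<in> posdef_mats \<Longrightarrow> q y = b y + l y - \<alpha> *\<^sub>R a y"
    "\<And>y. y \<in> posdef_mats \<Longrightarrow> p y = \<beta> *\<^sub>R b y - l y - a y"
    "\<And>y t. y \<in> posdef_mats \<Longrightarrow> t > 0 \<Longrightarrow> l (t *\<^sub>R y) = t *\<^sub>R l y"
    "\<And>y n. y \<in> posdef_mats \<Longrightarrow> transpose n = n \<Longrightarrow>
      ((\<lambda>t. b (y + t *\<^sub>R n)) has_vector_derivative 0) (at 0)"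
    "\<And>y n. y \<in> posdef_mats \<Longrightarrow> transpose n = n \<Longrightarrow>
      ((\<lambda>t. l (y + t *\<^sub>R n)) has_vector_derivative (1/2) *\<^sub>R (n ** matrix_inv y ** l y + l y ** matrix_inv y ** n)) (at 0)"
    "\<And>y n. y \<in> posdef_mats \<Longrightarrow> transpose n = n \<Longrightarrow>
      ((\<lambda>t. a (y + t *\<^sub>R n)) has_vector_derivative (n ** matrix_inv y ** a y + a y ** matrix_inv y ** n)) (at 0)"
  using that[of bb ll aa, OF coeffs_sym(2,1,3) _ p_decomp homogeneous(1) pde] q_ray[of _ 1] by simp

end

subsection \<open>The component of degree one\<close>

lemma has_vector_derivative_imp_tendsto_0:
  fixes f :: "real \<Rightarrow> 'a::real_normed_vector"
  assumes "(f has_vector_derivative d) (at 0)"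
  shows "((\<lambda>t. (1/t) *\<^sub>R (f t - f 0)) \<longlongrightarrow> d) (at 0)"
proof -
  have "((\<lambda>t. norm (f t - f 0 - t *\<^sub>R d) / norm t) \<longlongrightarrow> 0) (at 0)"
    using assms unfolding has_vector_derivative_def has_derivative_at by simp
  moreover have "eventually (\<lambda>t. norm (f t - f 0 - t *\<^sub>R d) / norm t = norm ((1/t) *\<^sub>R (f t - f 0) - d)) (at 0)"
    unfolding eventually_at_filter
  proof (intro always_eventually allI impI)
    fix t :: real assume t: "t \<noteq> 0"
    then have "(1/t) *\<^sub>R (f t - f 0) - d = (1/t) *\<^sub>R (f t - f 0 - t *\<^sub>R d)"
      by (simp add: scaleR_diff_right)
    then show "norm (f t - f 0 - t *\<^sub>R d) / norm t = norm ((1/t) *\<^sub>R (f t - f 0) - d)"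
      by simp
  qed
  ultimately have "((\<lambda>t. norm ((1/t) *\<^sub>R (f t - f 0) - d)) \<longlongrightarrow> 0) (at 0)"
    by (rule Lim_transform_eventually)
  then show ?thesis
    by (rule LIM_zero_cancel[OF tendsto_norm_zero_cancel])
qed

section \<open>Rank-one matrices and the commutant of the cone\<close>

lemma rank_one_sym: "transpose (\<chi> i j. v$i * v$j) = (\<chi> i j. (v::real^'n::finite)$i * v$j)"
  by (simp add: transpose_def vec_eq_iff mult.commute)

lemma rank_one_mult_vec: "(\<chi> i j. v$i * v$j) *v w = (v \<bullet> w) *\<^sub>R (v::real^'n::finite)"
  by (simp add: matrix_vector_mult_def vec_eq_iff inner_vec_def sum_distrib_left mult_ac)

lemma posdef_id_plus_rank_one: "mat 1 + (\<chi> i j. v$i * v$j) \<in> (posdef_mats :: (real^'n::finite^'n) set)"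
proof -
  have "w \<bullet> ((mat 1 + (\<chi> i j. v$i * v$j)) *v w) > 0" if "w \<noteq> 0" for w :: "real^'n"
  proof -
    have "w \<bullet> ((mat 1 + (\<chi> i j. v$i * v$j)) *v w) = w \<bullet> w + (v \<bullet> w)^2"
      by (simp add: matrix_vector_mult.add_left rank_one_mult_vec inner_add_right power2_eq_square inner_commute)
    then show ?thesis using that by (simp add: add_pos_nonneg)
  qed
  then show ?thesis
    by (simp add: posdef_mats_def transpose_algebra rank_one_sym)
qed

text \<open>The cone contains 1 + v v^T for every v, and commuting with this amounts to commuting
  with v v^T.\<close>

lemma commutes_with_posdef_imp_scalar:
  fixes A :: "real^'n::finite^'n"
  assumes "\<And>y. y \<in> posdef_mats \<Longrightarrow> A ** y = y ** A"
  obtains c where "A = c *\<^sub>R mat 1"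
proof (rule commutes_with_rank_one_imp_scalar[of A])
  show "A ** (\<chi> i j. v$i * v$j) = (\<chi> i j. v$i * v$j) ** A" for v :: "real^'n"
    using assms[OF posdef_id_plus_rank_one[of v]] by (simp add: matrix_algebra)
qed (rule that)

context
  fixes \<alpha> \<beta> :: real and q p b l a :: "real^'n::finite^'n \<Rightarrow> real^'n^'n"
  assumes \<alpha>: "\<alpha> \<ge> 0" and \<beta>: "\<beta> \<ge> 0" and ne: "\<alpha> \<noteq> \<beta>"
    and M: "\<And>x y x' y'. x \<in> posdef_mats \<Longrightarrow> y \<in> posdef_mats \<Longrightarrow> x' \<in> posdef_mats \<Longrightarrow> y' \<in> posdef_mats \<Longrightarrow>
       mgig_V \<alpha> \<beta> x y = mgig_V \<alpha> \<beta> x' y' \<Longrightarrow> grad_V \<alpha> \<beta> q p x y = grad_V \<alpha> \<beta> q p x' y'"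
    and lsym: "\<And>y. y \<in> posdef_mats \<Longrightarrow> transpose (l y) = l y"
    and q: "\<And>y. y \<in> posdef_mats \<Longrightarrow> q y = b y + l y - \<alpha> *\<^sub>R a y"
    and p: "\<And>y. y \<in> posdef_mats \<Longrightarrow> p y = \<beta> *\<^sub>R b y - l y - a y"
    and lhom: "\<And>y t. y \<in> posdef_mats \<Longrightarrow> t > 0 \<Longrightarrow> l (t *\<^sub>R y) = t *\<^sub>R l y"
    and Db: "\<And>y n. y \<in> posdef_mats \<Longrightarrow> transpose n = n \<Longrightarrow>
      ((\<lambda>t. b (y + t *\<^sub>R n)) has_vector_derivative 0) (at 0)"
    and Dl: "\<And>y n. y \<in> posdef_mats \<Longrightarrow> transpose n = n \<Longrightarrow>
      ((\<lambda>t. l (y + t *\<^sub>R n)) has_vector_derivative (1/2) *\<^sub>R (n ** matrix_inv y ** l y + l y ** matrix_inv y ** n)) (at 0)"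
    and Da: "\<And>y n. y \<in> posdef_mats \<Longrightarrow> transpose n = n \<Longrightarrow>
      ((\<lambda>t. a (y + t *\<^sub>R n)) has_vector_derivative (n ** matrix_inv y ** a y + a y ** matrix_inv y ** n)) (at 0)"
begin

private lemma b_const: "y \<in> posdef_mats \<Longrightarrow> b y = b (mat 1)"
  by (rule posdef_constI[OF Db])

text \<open>The equation for a says precisely that y^-1 a(y) y^-1 has zero derivative.\<close>

private lemma a_quad:
  assumes y: "y \<in> posdef_mats"
  shows "a y = y ** a (mat 1) ** y"
proof -
  have "matrix_inv y ** a y ** matrix_inv y = matrix_inv (mat 1) ** a (mat 1) ** matrix_inv (mat 1)"
  proof (rule posdef_constI[where F = "\<lambda>y. matrix_inv y ** a y ** matrix_inv y", OF _ y])
    fix y n :: "real^'n^'n" assume y: "y \<in> posdef_mats" and n: "transpose n = n"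
    have iy: "invertible y" by (rule posdef_invertible[OF y])
    have "((\<lambda>t. matrix_inv (y + t *\<^sub>R n)) has_vector_derivative
        - (matrix_inv (y + 0 *\<^sub>R n) ** n ** matrix_inv (y + 0 *\<^sub>R n))) (at 0)"
      by (rule has_vector_derivative_matrix_inv[OF line_derivative]) (simp add: iy)
    then have di: "((\<lambda>t. matrix_inv (y + t *\<^sub>R n)) has_vector_derivative - (matrix_inv y ** n ** matrix_inv y)) (at 0)"
      by simp
    from has_vector_derivative_matrix_mult[OF has_vector_derivative_matrix_mult[OF di Da[OF y n]] di]
    show "((\<lambda>t. matrix_inv (y + t *\<^sub>R n) ** a (y + t *\<^sub>R n) ** matrix_inv (y + t *\<^sub>R n)) has_vector_derivative 0) (at 0)"
      using iy by (simp add: matrix_algebra matrix_inv_props)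
  qed
  then have "y ** (matrix_inv y ** a y ** matrix_inv y) ** y = y ** a (mat 1) ** y" by simp
  then show ?thesis
    using posdef_invertible[OF y] by (simp add: matrix_mul_assoc matrix_inv_props)
qed

text \<open>The contributions of b and a to \<open>grad_V\<close> depend on V alone, so that of l is
  constant on the fibres of V as well. Its value is computed at the point of the fibre with equal
  components.\<close>

private lemma l_eq:
  assumes x: "x \<in> posdef_mats" and y: "y \<in> posdef_mats"
  shows "l x - (\<beta> - \<alpha>) *\<^sub>R (x ** matrix_inv (\<beta> *\<^sub>R x + y) ** (\<beta> *\<^sub>R l x + l y) ** (matrix_inv (\<beta> *\<^sub>R x + y) ** x))
    = l (matrix_inv (mgig_V \<alpha> \<beta> x y))"
proof -
  define N where "N = (\<lambda>x y. l x - (\<beta> - \<alpha>) *\<^sub>R (x ** matrix_inv (\<beta> *\<^sub>R x + y) ** (\<beta> *\<^sub>R l x + l y) ** (matrix_inv (\<beta> *\<^sub>R x + y) ** x)))"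
  have gM: "grad_V \<alpha> \<beta> q p x y = N x y + (b (mat 1) - \<beta> *\<^sub>R (matrix_inv (mgig_V \<alpha> \<beta> x y) ** a (mat 1) ** matrix_inv (mgig_V \<alpha> \<beta> x y)))"
    if x: "x \<in> posdef_mats" and y: "y \<in> posdef_mats" for x y
  proof -
    define T where "T = \<beta> *\<^sub>R x + y"
    define s where "s = \<alpha> *\<^sub>R x + y"
    define A where "A = a (mat 1)"
    define R where "R = x ** matrix_inv T"
    define R' where "R' = matrix_inv T ** x"
    have T: "T \<in> posdef_mats" unfolding T_def by (intro posdef_scaleR_add \<beta> x y)
    have s: "s \<in> posdef_mats" unfolding s_def by (intro posdef_scaleR_add \<alpha> x y)
    have tR: "transpose R = R'"
      unfolding R_def R'_def by (simp add: matrix_transpose_mul posdef_sym x posdef_matrix_inv T)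
    have vi: "matrix_inv (mgig_V \<alpha> \<beta> x y) = R ** s"
      using matrix_inv_mgig_V[OF \<alpha> \<beta> x y] by (simp add: R_def T_def s_def)
    have "transpose (matrix_inv (mgig_V \<alpha> \<beta> x y)) = matrix_inv (mgig_V \<alpha> \<beta> x y)"
      by (intro posdef_sym posdef_matrix_inv mgig_V_posdef \<alpha> \<beta> x y)
    then have vi': "matrix_inv (mgig_V \<alpha> \<beta> x y) = s ** R'"
      unfolding vi by (simp add: matrix_transpose_mul tR posdef_sym[OF s])
    have xR: "x = R ** T" and xR': "x = T ** R'"
      using posdef_invertible[OF T] by (simp_all add: R_def R'_def matrix_mul_assoc matrix_inv_props)
    have vAv: "matrix_inv (mgig_V \<alpha> \<beta> x y) ** A ** matrix_inv (mgig_V \<alpha> \<beta> x y) = R ** (s ** A ** s) ** R'"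
    proof -
      have "matrix_inv (mgig_V \<alpha> \<beta> x y) ** A ** matrix_inv (mgig_V \<alpha> \<beta> x y) = R ** s ** A ** (s ** R')"
        using vi vi' by metis
      then show ?thesis by (simp add: matrix_mul_assoc)
    qed
    have xAx: "x ** A ** x = R ** (T ** A ** T) ** R'"
    proof -
      have "x ** A ** x = R ** T ** A ** (T ** R')"
        using xR xR' by metis
      then show ?thesis by (simp add: matrix_mul_assoc)
    qed
    \<comment> \<open>Because x = R T = T R' and v^-1 = R s = s R', sandwiching this identity
      between R and R' turns the contribution of a into \<beta> v^-1 A v^-1, a function of
      v.\<close>
    have "\<alpha> *\<^sub>R (T ** A ** T) + (\<beta> - \<alpha>) *\<^sub>R (y ** A ** y - (\<alpha> * \<beta>) *\<^sub>R (x ** A ** x)) = \<beta> *\<^sub>R (s ** A ** s)"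
      unfolding T_def s_def by (simp add: matrix_algebra) (simp add: algebra_simps)
    then have "R ** (\<alpha> *\<^sub>R (T ** A ** T) + (\<beta> - \<alpha>) *\<^sub>R (y ** A ** y - (\<alpha> * \<beta>) *\<^sub>R (x ** A ** x))) ** R' = R ** (\<beta> *\<^sub>R (s ** A ** s)) ** R'"
      by simp
    then have key: "\<alpha> *\<^sub>R (x ** A ** x) + (\<beta> - \<alpha>) *\<^sub>R (R ** (y ** A ** y - (\<alpha> * \<beta>) *\<^sub>R (x ** A ** x)) ** R')
        = \<beta> *\<^sub>R (matrix_inv (mgig_V \<alpha> \<beta> x y) ** A ** matrix_inv (mgig_V \<alpha> \<beta> x y))"
      unfolding vAv by (simp only: xAx matrix_mult.add_right matrix_mult.add_left matrix_mult.scaleR_left matrix_mult.scaleR_right)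
    have c: "\<beta> *\<^sub>R q x - p y = (\<beta> *\<^sub>R l x + l y) + (y ** A ** y - (\<alpha> * \<beta>) *\<^sub>R (x ** A ** x))"
      unfolding q[OF x] p[OF y] b_const[OF x] b_const[OF y] a_quad[OF x] a_quad[OF y] A_def by (simp add: algebra_simps)
    have "grad_V \<alpha> \<beta> q p x y = q x - (\<beta> - \<alpha>) *\<^sub>R (R ** (\<beta> *\<^sub>R q x - p y) ** R')"
      unfolding grad_V_def Let_def grad_V_factor(1)[OF \<beta> x y] T_def[symmetric] R_def[symmetric] tR ..
    also have "\<dots> = (l x - (\<beta> - \<alpha>) *\<^sub>R (R ** (\<beta> *\<^sub>R l x + l y) ** R')) + b (mat 1)
       - (\<alpha> *\<^sub>R (x ** A ** x) + (\<beta> - \<alpha>) *\<^sub>R (R ** (y ** A ** y - (\<alpha> * \<beta>) *\<^sub>R (x ** A ** x)) ** R'))"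
      unfolding c unfolding q[OF x] b_const[OF x] a_quad[OF x] A_def[symmetric] matrix_mult.add_right[of R "\<beta> *\<^sub>R l x + l y"]
        matrix_mult.add_left[of "R ** (\<beta> *\<^sub>R l x + l y)"]
      by (simp add: algebra_simps)
    finally have "grad_V \<alpha> \<beta> q p x y = (l x - (\<beta> - \<alpha>) *\<^sub>R (R ** (\<beta> *\<^sub>R l x + l y) ** R')) + b (mat 1)
       - \<beta> *\<^sub>R (matrix_inv (mgig_V \<alpha> \<beta> x y) ** A ** matrix_inv (mgig_V \<alpha> \<beta> x y))"
      unfolding key .
    then show ?thesis
      unfolding N_def A_def R_def R'_def T_def by (simp only: add_diff_eq)
  qed
  define w where "w = matrix_inv (mgig_V \<alpha> \<beta> x y)"
  have w: "w \<in> posdef_mats" unfolding w_def by (intro posdef_matrix_inv mgig_V_posdef \<alpha> \<beta> x y)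
  \<comment> \<open>Since V at (z, z) equals \<kappa> z^-1, this constant puts the pair (z, z) with
    z = \<kappa> v^-1 into the same fibre.\<close>
  define \<kappa> where "\<kappa> = (\<beta> + 1) / (\<alpha> + 1)"
  have \<kappa>: "\<kappa> > 0" unfolding \<kappa>_def using \<alpha> \<beta> by (simp add: add_nonneg_pos)
  define z where "z = \<kappa> *\<^sub>R w"
  have z: "z \<in> posdef_mats" unfolding z_def by (intro posdef_scaleR w \<kappa>)
  have iz: "invertible z" and iw: "invertible w" using z w posdef_invertible by auto
  have wi: "matrix_inv w = mgig_V \<alpha> \<beta> x y"
    unfolding w_def by (intro invertible_matrix_inv invertible_mgig_V \<alpha> \<beta> x y)
  have zi: "matrix_inv z = (1/\<kappa>) *\<^sub>R mgig_V \<alpha> \<beta> x y"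
    unfolding z_def wi[symmetric] using \<kappa> by (intro matrix_inv_scaleR iw) auto
  have az: "matrix_inv (\<alpha> *\<^sub>R z + z) = (1/(\<alpha>+1)) *\<^sub>R matrix_inv z"
    using matrix_inv_scaleR(2)[OF iz, of "\<alpha> + 1"] \<alpha> by (simp add: algebra_simps)
  have bz: "matrix_inv (\<beta> *\<^sub>R z + z) = (1/(\<beta>+1)) *\<^sub>R matrix_inv z"
    using matrix_inv_scaleR(2)[OF iz, of "\<beta> + 1"] \<beta> by (simp add: algebra_simps)
  have Vz: "mgig_V \<alpha> \<beta> z z = mgig_V \<alpha> \<beta> x y"
  proof -
    have "mgig_V \<alpha> \<beta> z z = (1 + (\<beta> - \<alpha>) / (\<alpha> + 1)) *\<^sub>R matrix_inv z"
      unfolding mgig_V_def az by (simp add: scaleR_add_left)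
    also have "1 + (\<beta> - \<alpha>) / (\<alpha> + 1) = \<kappa>"
      using \<alpha> by (simp add: \<kappa>_def field_simps)
    finally show ?thesis unfolding zi using \<kappa> by simp
  qed
  have "N x y = N z z"
    using M[OF x y z z Vz[symmetric]] unfolding gM[OF x y] gM[OF z z] Vz by simp
  also have "N z z = (1 - (\<beta> - \<alpha>) * (1/(\<beta>+1))^2 * (\<beta> + 1)) *\<^sub>R l z"
  proof -
    have "z ** ((1/(\<beta>+1)) *\<^sub>R matrix_inv z) ** C ** ((1/(\<beta>+1)) *\<^sub>R matrix_inv z ** z) = (1/(\<beta>+1))^2 *\<^sub>R C" for C
      using iz by (simp add: matrix_algebra matrix_inv_props power2_eq_square)
    moreover have "\<beta> *\<^sub>R l z + l z = (\<beta> + 1) *\<^sub>R l z" by (simp add: scaleR_add_left)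
    ultimately show ?thesis
      unfolding N_def bz by (simp add: scaleR_diff_left)
  qed
  also have "1 - (\<beta> - \<alpha>) * (1/(\<beta>+1))^2 * (\<beta> + 1) = 1/\<kappa>"
  proof -
    have "\<beta> + 1 \<noteq> 0" using \<beta> by simp
    then have "(1/(\<beta>+1))^2 * (\<beta> + 1) = 1/(\<beta>+1)" by (simp add: power2_eq_square)
    then have "1 - (\<beta> - \<alpha>) * (1/(\<beta>+1))^2 * (\<beta> + 1) = 1 - (\<beta> - \<alpha>) * (1/(\<beta>+1))"
      by (simp only: mult.assoc)
    also have "\<dots> = 1/\<kappa>" using \<open>\<beta> + 1 \<noteq> 0\<close> by (simp add: \<kappa>_def field_simps)
    finally show ?thesis .
  qed
  also have "(1/\<kappa>) *\<^sub>R l z = l w"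
    unfolding z_def lhom[OF w \<kappa>] using \<kappa> by simp
  finally show ?thesis
    by (simp add: N_def w_def)
qed

text \<open>\<open>l_eq\<close> at x = 1 and y of size 1/t is expanded to first order in t.
  Homogeneity gives l(y) = l(t y)/t, so the left side produces T^-1 l(T) T^-1, while the right side
  produces the derivative of l at the identity, which its differential equation expresses through
  l(1).\<close>

private lemma l_formula:
  assumes T: "T \<in> posdef_mats"
  shows "l T = (1/2) *\<^sub>R (l (mat 1) ** T + T ** l (mat 1))"
proof -
  define \<delta> where "\<delta> = \<beta> - \<alpha>"
  define I where "I = matrix_inv T"
  define l0 where "l0 = l (mat 1)"
  have \<delta>: "\<delta> \<noteq> 0" using ne by (simp add: \<delta>_def)
  have iT: "invertible T" by (rule posdef_invertible[OF T])
  have Isym: "transpose I = I" unfolding I_def by (intro posdef_sym posdef_matrix_inv T)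
  have "((\<lambda>t. l (mat 1 + t *\<^sub>R (- \<delta> *\<^sub>R I))) has_vector_derivative
      (1/2) *\<^sub>R ((- \<delta> *\<^sub>R I) ** matrix_inv (mat 1) ** l (mat 1) + l (mat 1) ** matrix_inv (mat 1) ** (- \<delta> *\<^sub>R I))) (at 0)"
    by (intro Dl posdef_mat_1) (simp add: transpose_algebra Isym)
  then have d: "((\<lambda>t. l (mat 1 - (t * \<delta>) *\<^sub>R I)) has_vector_derivative - (\<delta>/2) *\<^sub>R (I ** l0 + l0 ** I)) (at 0)"
    by (simp add: l0_def matrix_algebra scaleR_add_right scaleR_diff_right mult.commute)
  have L1: "((\<lambda>t. (1/t) *\<^sub>R (l (mat 1 - (t * \<delta>) *\<^sub>R I) - l0)) \<longlongrightarrow> - (\<delta>/2) *\<^sub>R (I ** l0 + l0 ** I)) (at_right 0)"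
  proof -
    have "((\<lambda>t. (1/t) *\<^sub>R (l (mat 1 - (t * \<delta>) *\<^sub>R I) - l0)) \<longlongrightarrow> - (\<delta>/2) *\<^sub>R (I ** l0 + l0 ** I)) (at 0)"
      using has_vector_derivative_imp_tendsto_0[OF d] by (simp add: l0_def)
    then show ?thesis by (rule tendsto_mono[rotated]) (simp add: at_le)
  qed
  have Bsym: "transpose (- \<beta> *\<^sub>R mat 1 :: real^'n^'n) = - \<beta> *\<^sub>R mat 1" by (simp add: transpose_algebra)
  have contT: "((\<lambda>t. l (T + t *\<^sub>R (- \<beta> *\<^sub>R mat 1))) \<longlongrightarrow> l T) (at_right 0)"
    using has_vector_derivative_continuous[OF Dl[OF T Bsym]]
    by (auto simp: continuous_within intro: tendsto_mono[rotated] at_le)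
  have "((\<lambda>t. - \<delta> *\<^sub>R (I ** ((t * \<beta>) *\<^sub>R l0 + l (T + t *\<^sub>R (- \<beta> *\<^sub>R mat 1))) ** I)) \<longlongrightarrow> - \<delta> *\<^sub>R (I ** ((0 * \<beta>) *\<^sub>R l0 + l T) ** I)) (at_right 0)"
    by (intro tendsto_intros matrix_mult.tendsto contT)
  then have L2: "((\<lambda>t. - \<delta> *\<^sub>R (I ** ((t * \<beta>) *\<^sub>R l0 + l (T + t *\<^sub>R (- \<beta> *\<^sub>R mat 1))) ** I)) \<longlongrightarrow> - \<delta> *\<^sub>R (I ** l T ** I)) (at_right 0)"
    by simp
  have ev: "eventually (\<lambda>t. - \<delta> *\<^sub>R (I ** ((t * \<beta>) *\<^sub>R l0 + l (T + t *\<^sub>R (- \<beta> *\<^sub>R mat 1))) ** I) =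
      (1/t) *\<^sub>R (l (mat 1 - (t * \<delta>) *\<^sub>R I) - l0)) (at_right 0)"
  proof -
    have "eventually (\<lambda>t. T + t *\<^sub>R (- \<beta> *\<^sub>R mat 1) \<in> posdef_mats) (at_right 0)"
      using line_posdef[OF T Bsym] by (auto simp: eventually_at_filter elim: eventually_mono)
    moreover have "eventually (\<lambda>t::real. t > 0) (at_right 0)"
      by (simp add: eventually_at_right_less)
    ultimately show ?thesis
    proof eventually_elim
      case (elim t)
      \<comment> \<open>The choice for which \<beta> x + y is exactly T/t when x = 1.\<close>
      define y where "y = (1/t) *\<^sub>R (T + t *\<^sub>R (- \<beta> *\<^sub>R mat 1))"
      have y: "y \<in> posdef_mats" unfolding y_def using elim by (intro posdef_scaleR) auto
      have Ty: "\<beta> *\<^sub>R mat 1 + y = (1/t) *\<^sub>R T" using elim(2) by (simp add: y_def algebra_simps)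
      have Ti: "matrix_inv (\<beta> *\<^sub>R mat 1 + y) = t *\<^sub>R I"
        unfolding Ty I_def using matrix_inv_scaleR(2)[OF iT, of "1/t"] elim(2) by simp
      have vi: "matrix_inv (mgig_V \<alpha> \<beta> (mat 1) y) = mat 1 - (t * \<delta>) *\<^sub>R I"
        using matrix_inv_mgig_V_diff[OF \<alpha> \<beta> posdef_mat_1 y] by (simp add: Ti \<delta>_def mult.commute)
      have ly: "l y = (1/t) *\<^sub>R l (T + t *\<^sub>R (- \<beta> *\<^sub>R mat 1))"
        unfolding y_def using elim by (intro lhom) auto
      have "l0 - \<delta> *\<^sub>R (t *\<^sub>R I ** (\<beta> *\<^sub>R l0 + l y) ** (t *\<^sub>R I)) = l (mat 1 - (t * \<delta>) *\<^sub>R I)"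
        using l_eq[OF posdef_mat_1 y] unfolding vi Ti by (simp add: l0_def \<delta>_def)
      then have "l (mat 1 - (t * \<delta>) *\<^sub>R I) - l0 = - \<delta> *\<^sub>R (t *\<^sub>R I ** (\<beta> *\<^sub>R l0 + l y) ** (t *\<^sub>R I))"
        by (simp add: algebra_simps)
      then have "(1/t) *\<^sub>R (l (mat 1 - (t * \<delta>) *\<^sub>R I) - l0) = (1/t) *\<^sub>R (- \<delta> *\<^sub>R (t *\<^sub>R I ** (\<beta> *\<^sub>R l0 + l y) ** (t *\<^sub>R I)))"
        by simp
      also have "\<dots> = - \<delta> *\<^sub>R (I ** ((t * \<beta>) *\<^sub>R l0 + l (T + t *\<^sub>R (- \<beta> *\<^sub>R mat 1))) ** I)"
        using elim(2) unfolding ly by (simp add: matrix_algebra scaleR_add_right scaleR_diff_right mult_ac)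
      finally show ?case ..
    qed
  qed
  have "- \<delta> *\<^sub>R (I ** l T ** I) = - (\<delta>/2) *\<^sub>R (I ** l0 + l0 ** I)"
    by (rule tendsto_unique[OF _ Lim_transform_eventually[OF L2 ev] L1]) simp
  then have "(- \<delta>) *\<^sub>R (I ** l T ** I) = (- \<delta>) *\<^sub>R ((1/2) *\<^sub>R (I ** l0 + l0 ** I))"
    by simp
  then have "I ** l T ** I = (1/2) *\<^sub>R (I ** l0 + l0 ** I)"
    using \<delta> by (simp only: scaleR_cancel_left) simp
  then have "T ** (I ** l T ** I) ** T = T ** ((1/2) *\<^sub>R (I ** l0 + l0 ** I)) ** T"
    by simp
  then show ?thesis
    unfolding I_def l0_def[symmetric] using iT by (simp add: matrix_algebra matrix_inv_props)
qed

text \<open>The linear formula is put back into the differential equation of l. With Z = l(1) - y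
  l(1) y^-1 this gives Z n + n Z^T = 0 for all symmetric n. For n = 1 it makes Z antisymmetric, then
  Z commutes with every symmetric n and is scalar, hence zero. So l(1) commutes with the whole
  cone.\<close>

private lemma l_scalar:
  obtains c where "\<And>y. y \<in> posdef_mats \<Longrightarrow> l y = c *\<^sub>R y"
proof -
  define l0 where "l0 = l (mat 1)"
  have l0sym: "transpose l0 = l0" unfolding l0_def by (intro lsym posdef_mat_1)
  have comm: "l0 ** y = y ** l0" if y: "y \<in> posdef_mats" for y
  proof -
    have iy: "invertible y" by (rule posdef_invertible[OF y])
    define Z where "Z = l0 - y ** l0 ** matrix_inv y"
    have Zn: "Z ** n + n ** transpose Z = 0" if n: "transpose n = n" for n
    proof -
      have "((\<lambda>t. l (y + t *\<^sub>R n)) has_vector_derivative (1/2) *\<^sub>R (l0 ** n + n ** l0)) (at 0)"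
      proof (rule has_vector_derivative_transform_eventually)
        show "((\<lambda>t. (1/2) *\<^sub>R (l0 ** (y + t *\<^sub>R n) + (y + t *\<^sub>R n) ** l0)) has_vector_derivative (1/2) *\<^sub>R (l0 ** n + n ** l0)) (at 0)"
        proof -
          have "((\<lambda>t. (1/2) *\<^sub>R (l0 ** (y + t *\<^sub>R n) + (y + t *\<^sub>R n) ** l0)) has_vector_derivative
             (1/2) *\<^sub>R ((l0 ** n + 0 ** (y + 0 *\<^sub>R n)) + ((y + 0 *\<^sub>R n) ** 0 + n ** l0))) (at 0)"
            by (intro bounded_linear.has_vector_derivative[OF bounded_linear_scaleR_right] has_vector_derivative_add
                has_vector_derivative_matrix_mult has_vector_derivative_const line_derivative)
          then show ?thesis by simp
        qed
        show "eventually (\<lambda>t. (1/2) *\<^sub>R (l0 ** (y + t *\<^sub>R n) + (y + t *\<^sub>R n) ** l0) = l (y + t *\<^sub>R n)) (nhds 0)"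
          using line_posdef[OF y n] by eventually_elim (simp only: l_formula l0_def)
      qed
      from vector_derivative_unique_at[OF this Dl[OF y n]]
      have "l0 ** n + n ** l0 = n ** matrix_inv y ** l y + l y ** matrix_inv y ** n"
        by simp
      also have "\<dots> = (1/2) *\<^sub>R (n ** matrix_inv y ** l0 ** y + n ** l0 + l0 ** n + y ** l0 ** matrix_inv y ** n)"
        unfolding l_formula[OF y] l0_def[symmetric] using iy by (simp add: matrix_algebra matrix_inv_props scaleR_add_right)
      finally have "2 *\<^sub>R (l0 ** n + n ** l0) = n ** matrix_inv y ** l0 ** y + n ** l0 + l0 ** n + y ** l0 ** matrix_inv y ** n"
        by simp
      then have e: "l0 ** n + n ** l0 = n ** matrix_inv y ** l0 ** y + y ** l0 ** matrix_inv y ** n"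
        unfolding scaleR_2 by (simp add: algebra_simps)
      have tZ: "transpose Z = l0 - matrix_inv y ** l0 ** y"
        unfolding Z_def by (simp add: transpose_algebra l0sym posdef_sym y posdef_matrix_inv matrix_mul_assoc)
      show ?thesis
        unfolding tZ using e unfolding Z_def by (simp add: matrix_algebra algebra_simps)
    qed
    have tZ: "transpose Z = - Z" using Zn[of "mat 1"] by (simp add: add_eq_0_iff)
    have "Z ** n = n ** Z" if "transpose n = n" for n
      using Zn[OF that] by (simp add: tZ matrix_mult.minus_right)
    then obtain c where c: "Z = c *\<^sub>R mat 1"
      using commutes_with_posdef_imp_scalar[of Z] posdef_sym by metis
    have "c *\<^sub>R (mat 1 :: real^'n^'n) = - (c *\<^sub>R mat 1)" using tZ unfolding c by (simp add: transpose_algebra)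
    from arg_cong[OF this, of "\<lambda>x. x $ undefined $ undefined"] have "c = 0" by (simp add: mat_def)
    then have "l0 = y ** l0 ** matrix_inv y" using c by (simp add: Z_def)
    then have "l0 ** y = y ** l0 ** matrix_inv y ** y" by simp
    then show ?thesis using iy by (simp add: matrix_inv_props)
  qed
  obtain c where c: "l0 = c *\<^sub>R mat 1"
    using commutes_with_posdef_imp_scalar[of l0] comm by metis
  show ?thesis
  proof (rule that[of c])
    fix y :: "real^'n^'n" assume y: "y \<in> posdef_mats"
    show "l y = c *\<^sub>R y"
      unfolding l_formula[OF y] l0_def[symmetric] c by (simp add: matrix_algebra flip: scaleR_2)
  qed
qed

lemma solve_decomposition:
  obtains c where "\<And>x. x \<in> posdef_mats \<Longrightarrow> q x = b (mat 1) + c *\<^sub>R x - \<alpha> *\<^sub>R (x ** a (mat 1) ** x)"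
    "\<And>y. y \<in> posdef_mats \<Longrightarrow> p y = \<beta> *\<^sub>R b (mat 1) - c *\<^sub>R y - y ** a (mat 1) ** y"
proof (rule l_scalar)
  fix c assume c: "\<And>y. y \<in> posdef_mats \<Longrightarrow> l y = c *\<^sub>R y"
  show ?thesis
    by (rule that[of c]) (simp_all add: q p c b_const flip: a_quad)
qed

end

subsection \<open>The separation equation\<close>

text \<open>Increments inside the cone are symmetric, so the derivative there may be redefined on
  other directions. This allows it to be written as the trace against a symmetric gradient.\<close>

lemma has_derivative_within_posdef_cong:
  fixes f :: "real^'n::finite^'n \<Rightarrow> 'b::real_normed_vector"
  assumes f: "(f has_derivative D) (at x within posdef_mats)" and x: "x \<in> posdef_mats"
    and D': "bounded_linear D'" and eq: "\<And>h. transpose h = h \<Longrightarrow> D' h = D h"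
  shows "(f has_derivative D') (at x within posdef_mats)"
proof -
  have "((\<lambda>y. (1 / norm (y - x)) *\<^sub>R (f y - (f x + D (y - x)))) \<longlongrightarrow> 0) (at x within posdef_mats)"
    using f by (simp add: has_derivative_within)
  moreover have "eventually (\<lambda>y. (1 / norm (y - x)) *\<^sub>R (f y - (f x + D (y - x))) = (1 / norm (y - x)) *\<^sub>R (f y - (f x + D' (y - x)))) (at x within posdef_mats)"
    unfolding eventually_at_filter
    by (intro always_eventually) (auto simp: eq transpose_algebra posdef_sym x)
  ultimately have "((\<lambda>y. (1 / norm (y - x)) *\<^sub>R (f y - (f x + D' (y - x)))) \<longlongrightarrow> 0) (at x within posdef_mats)"
    by (rule Lim_transform_eventually)
  with D' show ?thesis by (simp add: has_derivative_within)
qed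

lemma sum_axis_axis:
  fixes A :: "'n::finite \<Rightarrow> 'n \<Rightarrow> real"
  shows "(\<Sum>i\<in>UNIV. \<Sum>j\<in>UNIV. A i j *\<^sub>R (axis i (axis j 1) :: real^'n^'n)) = (\<chi> i j. A i j)"
proof -
  have "(\<Sum>i\<in>UNIV. \<Sum>j\<in>UNIV. A i j *\<^sub>R (axis i (axis j 1) :: real^'n^'n)) $ k $ m = A k m" for k m
  proof -
    have "(\<Sum>j\<in>UNIV. A i j * (axis i (axis j 1) :: real^'n^'n) $ k $ m) = (if i = k then A k m else 0)" for i
      by (simp add: axis_def if_distrib[of "\<lambda>x. y * x" for y] cong: if_cong)
    then show ?thesis by simp
  qed
  then show ?thesis by (simp add: vec_eq_iff)
qed

text \<open>The symmetric matrix that represents \<open>L\<close> on symmetric matrices for the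
  trace pairing. Averaging over transposed positions makes it linear in \<open>L\<close>, so it
  inherits the differentiability of the derivative of the density.\<close>

definition sym_grad :: "((real^'n::finite^'n) \<Rightarrow>\<^sub>L real) \<Rightarrow> real^'n^'n" where
  "sym_grad L = (\<chi> i j. (blinfun_apply L (axis i (axis j 1)) + blinfun_apply L (axis j (axis i 1))) / 2)"

lemma bounded_linear_sym_grad:
  "bounded_linear (sym_grad :: ((real^'n::finite^'n) \<Rightarrow>\<^sub>L real) \<Rightarrow> real^'n^'n)"
proof -
  have "bounded_linear (\<lambda>L :: (real^'n^'n) \<Rightarrow>\<^sub>L real. \<Sum>i\<in>UNIV. \<Sum>j\<in>UNIV. ((blinfun_apply L (axis i (axis j 1)) + blinfun_apply L (axis j (axis i 1))) / 2) *\<^sub>R (axis i (axis j 1) :: real^'n^'n))"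
    by (intro bounded_linear_sum bounded_linear_compose[OF bounded_linear_scaleR_left]
        bounded_linear_compose[OF bounded_linear_divide] bounded_linear_add blinfun.bounded_linear_left)
  moreover have "sym_grad = (\<lambda>L :: (real^'n^'n) \<Rightarrow>\<^sub>L real. \<Sum>i\<in>UNIV. \<Sum>j\<in>UNIV. ((blinfun_apply L (axis i (axis j 1)) + blinfun_apply L (axis j (axis i 1))) / 2) *\<^sub>R (axis i (axis j 1) :: real^'n^'n))"
    unfolding sum_axis_axis by (simp add: sym_grad_def fun_eq_iff)
  ultimately show ?thesis by simp
qed

lemma sym_grad_sym: "transpose (sym_grad L) = sym_grad L"
  by (simp add: sym_grad_def transpose_def add.commute)

lemma trace_sym_grad:
  fixes h :: "real^'n::finite^'n"
  assumes h: "transpose h = h"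
  shows "trace (sym_grad L ** h) = blinfun_apply L h"
proof -
  have hs: "h$j$i = h$i$j" for i j
    using arg_cong[OF h, of "\<lambda>x. x$i$j"] by (simp add: transpose_def)
  have hE: "h = (\<Sum>i\<in>UNIV. \<Sum>j\<in>UNIV. h$i$j *\<^sub>R (axis i (axis j 1) :: real^'n^'n))"
    unfolding sum_axis_axis by (simp add: vec_eq_iff)
  have Lh: "blinfun_apply L h = (\<Sum>i\<in>UNIV. \<Sum>j\<in>UNIV. h$i$j * blinfun_apply L (axis i (axis j 1)))"
    by (subst (1) hE) (simp add: blinfun.sum_right blinfun.scaleR_right)
  have Lh': "blinfun_apply L h = (\<Sum>i\<in>UNIV. \<Sum>j\<in>UNIV. h$i$j * blinfun_apply L (axis j (axis i 1)))"
    unfolding Lh by (subst sum.swap) (simp add: hs)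
  have "trace (sym_grad L ** h) = (\<Sum>i\<in>UNIV. \<Sum>j\<in>UNIV. (blinfun_apply L (axis i (axis j 1)) + blinfun_apply L (axis j (axis i 1))) / 2 * h$j$i)"
    by (simp add: trace_def matrix_matrix_mult_def sym_grad_def)
  also have "\<dots> = ((\<Sum>i\<in>UNIV. \<Sum>j\<in>UNIV. h$i$j * blinfun_apply L (axis i (axis j 1))) + (\<Sum>i\<in>UNIV. \<Sum>j\<in>UNIV. h$i$j * blinfun_apply L (axis j (axis i 1)))) / 2"
    by (simp add: hs sum.distrib[symmetric] sum_divide_distrib algebra_simps)
  also have "\<dots> = blinfun_apply L h"
    unfolding Lh[symmetric] Lh'[symmetric] by simp
  finally show ?thesis .
qed

lemma log_density_gradient:
  fixes f :: "real^'n::finite^'n \<Rightarrow> real"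
  assumes "twice_diff_on_posdef f" and pos: "\<forall>x\<in>posdef_mats. f x > 0"
  obtains G DG where
    "\<And>x. x \<in> posdef_mats \<Longrightarrow> ((\<lambda>x. ln (f x) + k * ln (det x)) has_derivative (\<lambda>h. trace (G x ** h))) (at x within posdef_mats)"
    "\<And>x. x \<in> posdef_mats \<Longrightarrow> transpose (G x) = G x"
    "\<And>x. x \<in> posdef_mats \<Longrightarrow> (G has_derivative DG x) (at x within posdef_mats)"
proof -
  obtain D where D: "\<And>x. x \<in> posdef_mats \<Longrightarrow> (f has_derivative blinfun_apply (D x)) (at x within posdef_mats)"
      "\<And>x. x \<in> posdef_mats \<Longrightarrow> D differentiable (at x within posdef_mats)"
    using assms(1) unfolding twice_diff_on_posdef_def by blast
  define G where "G = (\<lambda>x. inverse (f x) *\<^sub>R sym_grad (D x) + k *\<^sub>R matrix_inv x)"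
  have 1: "((\<lambda>x. ln (f x) + k * ln (det x)) has_derivative (\<lambda>h. trace (G x ** h))) (at x within posdef_mats)"
    if x: "x \<in> posdef_mats" for x
  proof (rule has_derivative_within_posdef_cong[OF _ x])
    show "((\<lambda>x. ln (f x) + k * ln (det x)) has_derivative (\<lambda>h. blinfun_apply (D x) h * inverse (f x) + k * trace (matrix_inv x ** h))) (at x within posdef_mats)"
      by (intro has_derivative_add has_derivative_ln has_derivative_mult_right has_derivative_ln_det det_posdef x D(1))
        (use pos x in auto)
    show "bounded_linear (\<lambda>h. trace (G x ** h))"
      by (intro bounded_linear_compose[OF bounded_linear_trace] matrix_mult.bounded_linear_right)
    fix h :: "real^'n^'n" assume "transpose h = h"
    then show "trace (G x ** h) = blinfun_apply (D x) h * inverse (f x) + k * trace (matrix_inv x ** h)"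
      by (simp add: G_def matrix_mult.add_left matrix_mult.scaleR_left trace_algebra trace_sym_grad)
  qed
  have 2: "transpose (G x) = G x" if "x \<in> posdef_mats" for x
    using that by (simp add: G_def transpose_algebra sym_grad_sym posdef_sym posdef_matrix_inv)
  have 3: "\<exists>DG. (G has_derivative DG) (at x within posdef_mats)" if x: "x \<in> posdef_mats" for x
  proof -
    obtain D2 where D2: "(D has_derivative D2) (at x within posdef_mats)"
      using D(2)[OF x] unfolding differentiable_def by blast
    have "f x \<noteq> 0" using pos x by force
    from has_derivative_add[OF has_derivative_scaleR[OF Deriv.has_derivative_inverse[OF this D(1)[OF x]]
          bounded_linear.has_derivative[OF bounded_linear_sym_grad D2]]
        bounded_linear.has_derivative[OF bounded_linear_scaleR_right has_derivative_matrix_inv[OF posdef_invertible[OF x]]]]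
    show ?thesis unfolding G_def by blast
  qed
  then obtain DG where "\<And>x. x \<in> posdef_mats \<Longrightarrow> (G has_derivative DG x) (at x within posdef_mats)"
    by metis
  with 1 2 show ?thesis by (rule that)
qed

text \<open>Multiplying by x^-1 on both sides gives the gradient x^-1 b x^-1 + c x^-1 - a. The three
  terms belong to - trace (b x^-1), c ln det x and - trace (a x), and a potential is determined up
  to a constant.\<close>

lemma potential_eq:
  fixes g :: "real^'n::finite^'n \<Rightarrow> real" and G :: "real^'n^'n \<Rightarrow> real^'n^'n"
  assumes g: "\<And>x. x \<in> posdef_mats \<Longrightarrow> (g has_derivative (\<lambda>h. trace (G x ** h))) (at x within posdef_mats)"
    and q: "\<And>x. x \<in> posdef_mats \<Longrightarrow> x ** G x ** x = b + c *\<^sub>R x - x ** a ** x"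
  obtains k where "\<And>x. x \<in> posdef_mats \<Longrightarrow> g x = c * ln (det x) - trace (a ** x) - trace (b ** matrix_inv x) + k"
proof -
  define F where "F = (\<lambda>x. g x - (c * ln (det x) - trace (a ** x) - trace (b ** matrix_inv x)))"
  have F: "F x = F (mat 1)" if "x \<in> posdef_mats" for x
  proof (rule posdef_constI[OF _ that])
    fix y n :: "real^'n^'n" assume y: "y \<in> posdef_mats" and n: "transpose n = n"
    have iy: "invertible y" by (rule posdef_invertible[OF y])
    have "matrix_inv y ** (y ** G y ** y) ** matrix_inv y = matrix_inv y ** (b + c *\<^sub>R y - y ** a ** y) ** matrix_inv y"
      by (simp add: q[OF y])
    then have G: "G y = matrix_inv y ** b ** matrix_inv y + c *\<^sub>R matrix_inv y - a"
      using iy by (simp add: matrix_algebra matrix_inv_props)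
    have "(F has_derivative (\<lambda>h. trace (G y ** h) - (c * trace (matrix_inv y ** h) - trace (a ** h) - trace (b ** (- (matrix_inv y ** h ** matrix_inv y)))))) (at y within posdef_mats)"
      unfolding F_def
      by (intro has_derivative_diff g y has_derivative_mult_right has_derivative_ln_det det_posdef
          bounded_linear.has_derivative[OF bounded_linear_trace] bounded_linear.has_derivative[OF matrix_mult.bounded_linear_right]
          has_derivative_ident has_derivative_matrix_inv iy)
    from has_vector_derivative_compose_within[of F _ "\<lambda>t. y + t *\<^sub>R n" 0, OF _ line_derivative line_posdef[OF y n]] this
    have "((\<lambda>t. F (y + t *\<^sub>R n)) has_vector_derivative trace (G y ** n) - (c * trace (matrix_inv y ** n) - trace (a ** n) - trace (b ** (- (matrix_inv y ** n ** matrix_inv y))))) (at 0)"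
      by simp
    moreover have "trace (matrix_inv y ** b ** matrix_inv y ** n) = trace (b ** (matrix_inv y ** n ** matrix_inv y))"
      by (metis trace_matrix_mult_commute matrix_mul_assoc)
    ultimately show "((\<lambda>t. F (y + t *\<^sub>R n)) has_vector_derivative 0) (at 0)"
      by (simp add: G matrix_mult.add_left matrix_mult.diff_left matrix_mult.scaleR_left matrix_mult.minus_right trace_algebra)
  qed
  show ?thesis
    by (rule that[of "F (mat 1)"]) (subst F[symmetric], assumption, simp add: F_def)
qed

lemma separation_equation:
  fixes g1 g2 :: "real^'n::finite^'n \<Rightarrow> real" and G1 G2 :: "real^'n^'n \<Rightarrow> real^'n^'n"
  assumes \<alpha>: "\<alpha> \<ge> 0" and \<beta>: "\<beta> \<ge> 0" and ne: "\<alpha> \<noteq> \<beta>"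
    and g1: "\<And>x. x \<in> posdef_mats \<Longrightarrow> (g1 has_derivative (\<lambda>h. trace (G1 x ** h))) (at x within posdef_mats)"
    and g2: "\<And>x. x \<in> posdef_mats \<Longrightarrow> (g2 has_derivative (\<lambda>h. trace (G2 x ** h))) (at x within posdef_mats)"
    and G1: "\<And>x. x \<in> posdef_mats \<Longrightarrow> transpose (G1 x) = G1 x"
    and G2: "\<And>x. x \<in> posdef_mats \<Longrightarrow> transpose (G2 x) = G2 x"
    and DG1: "\<And>x. x \<in> posdef_mats \<Longrightarrow> (G1 has_derivative DG1 x) (at x within posdef_mats)"
    and DG2: "\<And>x. x \<in> posdef_mats \<Longrightarrow> (G2 has_derivative DG2 x) (at x within posdef_mats)"
    and sep: "\<And>u u' v v'. u \<in> posdef_mats \<Longrightarrow> u' \<in> posdef_mats \<Longrightarrow> v \<in> posdef_mats \<Longrightarrow> v' \<in> posdef_mats \<Longrightarrow>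
       g1 (mgig_U \<alpha> \<beta> u v) + g2 (mgig_V \<alpha> \<beta> u v) + (g1 (mgig_U \<alpha> \<beta> u' v') + g2 (mgig_V \<alpha> \<beta> u' v'))
     = g1 (mgig_U \<alpha> \<beta> u v') + g2 (mgig_V \<alpha> \<beta> u v') + (g1 (mgig_U \<alpha> \<beta> u' v) + g2 (mgig_V \<alpha> \<beta> u' v))"
  obtains lam a b k1 k2 where "transpose a = a" "transpose b = b"
    "\<And>x. x \<in> posdef_mats \<Longrightarrow> g1 x = lam * ln (det x) - \<alpha> * trace (a ** x) - trace (b ** matrix_inv x) + k1"
    "\<And>x. x \<in> posdef_mats \<Longrightarrow> g2 x = - lam * ln (det x) - trace (a ** x) - \<beta> * trace (b ** matrix_inv x) + k2"
proof -
  let ?q = "\<lambda>x. x ** G1 x ** x" and ?p = "\<lambda>y. y ** G2 y ** y"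
  have D: "((\<lambda>x. x ** G x ** x) has_derivative (\<lambda>h. (x ** G x) ** h + (x ** DG x h + h ** G x) ** x)) (at x within posdef_mats)"
    if "(G has_derivative DG x) (at x within posdef_mats)" for G DG and x :: "real^'n^'n"
    by (intro matrix_mult.FDERIV has_derivative_ident that)
  have M: "grad_V \<alpha> \<beta> ?q ?p x y = grad_V \<alpha> \<beta> ?q ?p x' y'"
    if "x \<in> posdef_mats" "y \<in> posdef_mats" "x' \<in> posdef_mats" "y' \<in> posdef_mats"
      "mgig_V \<alpha> \<beta> x y = mgig_V \<alpha> \<beta> x' y'" for x y x' y'
    by (rule grad_V_eq_of_V_eq[OF \<alpha> \<beta> g1 g2 G1 G2 _ that]) (assumption | rule sep)+
  have qsym: "transpose (?q x) = ?q x" "transpose (?p x) = ?p x" if "x \<in> posdef_mats" for x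
    using that by (simp_all add: matrix_transpose_mul G1 G2 posdef_sym matrix_mul_assoc)
  obtain b l a where dec:
    "\<And>y. y \<in> posdef_mats \<Longrightarrow> transpose (b y) = b y"
    "\<And>y. y \<in> posdef_mats \<Longrightarrow> transpose (l y) = l y"
    "\<And>y. y \<in> posdef_mats \<Longrightarrow> transpose (a y) = a y"
    "\<And>y. y \<in> posdef_mats \<Longrightarrow> ?q y = b y + l y - \<alpha> *\<^sub>R a y"
    "\<And>y. y \<in> posdef_mats \<Longrightarrow> ?p y = \<beta> *\<^sub>R b y - l y - a y"
    "\<And>y t. y \<in> posdef_mats \<Longrightarrow> t > 0 \<Longrightarrow> l (t *\<^sub>R y) = t *\<^sub>R l y"
    "\<And>y n. y \<in> posdef_mats \<Longrightarrow> transpose n = n \<Longrightarrow>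
      ((\<lambda>t. b (y + t *\<^sub>R n)) has_vector_derivative 0) (at 0)"
    "\<And>y n. y \<in> posdef_mats \<Longrightarrow> transpose n = n \<Longrightarrow>
      ((\<lambda>t. l (y + t *\<^sub>R n)) has_vector_derivative (1/2) *\<^sub>R (n ** matrix_inv y ** l y + l y ** matrix_inv y ** n)) (at 0)"
    "\<And>y n. y \<in> posdef_mats \<Longrightarrow> transpose n = n \<Longrightarrow>
      ((\<lambda>t. a (y + t *\<^sub>R n)) has_vector_derivative (n ** matrix_inv y ** a y + a y ** matrix_inv y ** n)) (at 0)"
    by (rule ray_decomposition[where q = ?q and p = ?p
          and Dq = "\<lambda>x h. (x ** G1 x) ** h + (x ** DG1 x h + h ** G1 x) ** x"
          and Dp = "\<lambda>x h. (x ** G2 x) ** h + (x ** DG2 x h + h ** G2 x) ** x",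
          OF \<alpha> \<beta> ne D[of G1 DG1, OF DG1] D[of G2 DG2, OF DG2] qsym M]) (assumption | rule that)+
  obtain c where c: "\<And>x. x \<in> posdef_mats \<Longrightarrow> ?q x = b (mat 1) + c *\<^sub>R x - \<alpha> *\<^sub>R (x ** a (mat 1) ** x)"
    "\<And>y. y \<in> posdef_mats \<Longrightarrow> ?p y = \<beta> *\<^sub>R b (mat 1) - c *\<^sub>R y - y ** a (mat 1) ** y"
    by (rule solve_decomposition[OF \<alpha> \<beta> ne M dec(2) dec(4-9)]) (assumption | rule that)+
  obtain k1 where k1: "\<And>x. x \<in> posdef_mats \<Longrightarrow> g1 x = c * ln (det x) - trace ((\<alpha> *\<^sub>R a (mat 1)) ** x) - trace (b (mat 1) ** matrix_inv x) + k1"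
    by (rule potential_eq[OF g1, of "b (mat 1)" c "\<alpha> *\<^sub>R a (mat 1)"])
      (auto simp: c matrix_mult.scaleR_left matrix_mult.scaleR_right)
  obtain k2 where k2: "\<And>x. x \<in> posdef_mats \<Longrightarrow> g2 x = (- c) * ln (det x) - trace (a (mat 1) ** x) - trace ((\<beta> *\<^sub>R b (mat 1)) ** matrix_inv x) + k2"
    by (rule potential_eq[OF g2, of "\<beta> *\<^sub>R b (mat 1)" "- c" "a (mat 1)"])
      (auto simp: c)
  show ?thesis
    by (rule that[of "a (mat 1)" "b (mat 1)" c k1 k2])
      (use dec posdef_mat_1 k1 k2 in \<open>auto simp: matrix_mult.scaleR_left trace_algebra\<close>)
qed

subsection \<open>Lebesgue measure on symmetric matrices\<close>

text \<open>The unordered pairs are made a finite type so that symmetric matrices have coordinates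
  in a Euclidean space \<open>real^'n sym_idx\<close>, where \<open>lborel\<close> and the
  differential change of variables are available.\<close>

typedef 'n sym_idx = "sym_index :: 'n set set"
  by (auto simp: sym_index_def)

instance sym_idx :: (finite) finite
proof
  have "(UNIV :: 'a sym_idx set) = Abs_sym_idx ` sym_index"
    using type_definition.Abs_image[OF type_definition_sym_idx] by auto
  then show "finite (UNIV :: 'a sym_idx set)"
    by (metis finite finite_imageI)
qed

definition sym_idx_rank :: "'n::finite sym_idx \<Rightarrow> nat" where
  "sym_idx_rank = (SOME f. inj f)"

lemma inj_sym_idx_rank: "inj (sym_idx_rank :: 'n::finite sym_idx \<Rightarrow> nat)"
proof -
  have "\<exists>f :: 'n sym_idx \<Rightarrow> nat. inj f"
    using finite_imp_inj_to_nat_seg[of "UNIV :: 'n sym_idx set"] by auto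
  then show ?thesis unfolding sym_idx_rank_def by (rule someI_ex)
qed

text \<open>The change of variables theorem of the library asks for a well-ordered index type; any order will do.\<close>

instantiation sym_idx :: (finite) wellorder
begin

definition less_eq_sym_idx :: "'a sym_idx \<Rightarrow> 'a sym_idx \<Rightarrow> bool" where
  "less_eq_sym_idx x y \<longleftrightarrow> sym_idx_rank x \<le> sym_idx_rank y"

definition less_sym_idx :: "'a sym_idx \<Rightarrow> 'a sym_idx \<Rightarrow> bool" where
  "less_sym_idx x y \<longleftrightarrow> sym_idx_rank x < sym_idx_rank y"

instance
proof
  fix P :: "'a sym_idx \<Rightarrow> bool" and a
  assume step: "\<And>x. (\<And>y. y < x \<Longrightarrow> P y) \<Longrightarrow> P x"
  show "P a"
    by (induction a rule: measure_induct_rule[of sym_idx_rank]) (auto intro: step simp: less_sym_idx_def)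
qed (use inj_sym_idx_rank in \<open>auto simp: less_eq_sym_idx_def less_sym_idx_def dest: injD\<close>)

end

definition sidx :: "'n \<Rightarrow> 'n \<Rightarrow> 'n sym_idx" where
  "sidx i j = Abs_sym_idx {i, j}"

lemma Rep_sidx: "Rep_sym_idx (sidx i j) = {i, j}"
  unfolding sidx_def by (rule Abs_sym_idx_inverse) (auto simp: sym_index_def)

lemma sidx_eq_iff: "sidx i j = sidx k l \<longleftrightarrow> (i = k \<and> j = l) \<or> (i = l \<and> j = k)"
  by (metis Rep_sidx Rep_sym_idx_inject doubleton_eq_iff)

lemma sidx_cases: obtains i j where "m = sidx i j"
proof -
  have "Rep_sym_idx m \<in> sym_index" by (rule Rep_sym_idx)
  then obtain i j where "Rep_sym_idx m = {i, j}" by (auto simp: sym_index_def)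
  then have "m = sidx i j" by (metis Rep_sidx Rep_sym_idx_inject)
  then show ?thesis by (rule that)
qed

definition sym_of_vec :: "real^('n::finite sym_idx) \<Rightarrow> real^'n^'n" where
  "sym_of_vec e = (\<chi> i j. e $ sidx i j)"

text \<open>An ordered representative of each unordered pair is chosen; for symmetric matrices the
  entry does not depend on the choice, and for all matrices the map is linear.\<close>

definition vec_of_sym :: "real^'n::finite^'n \<Rightarrow> real^('n sym_idx)" where
  "vec_of_sym x = (\<chi> m. x $ fst (SOME ij. m = sidx (fst ij) (snd ij)) $ snd (SOME ij. m = sidx (fst ij) (snd ij)))"

lemma sym_of_vec_sym: "transpose (sym_of_vec e) = sym_of_vec e"
  by (simp add: sym_of_vec_def transpose_def sidx_eq_iff vec_eq_iff)
     (metis sidx_eq_iff)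

lemma vec_of_sym_nth:
  assumes "transpose x = x"
  shows "vec_of_sym x $ sidx i j = x $ i $ j"
proof -
  define ij where "ij = (SOME ij. sidx i j = sidx (fst ij) (snd ij))"
  have "sidx i j = sidx (fst ij) (snd ij)"
    unfolding ij_def by (rule someI[of _ "(i, j)"]) simp
  moreover have "x $ j $ i = x $ i $ j"
    using arg_cong[OF assms, of "\<lambda>x. x $ i $ j"] by (simp add: transpose_def)
  moreover have "vec_of_sym x $ sidx i j = x $ fst ij $ snd ij"
    by (simp only: vec_of_sym_def vec_lambda_beta ij_def)
  ultimately show ?thesis
    by (auto simp: sidx_eq_iff)
qed

lemma sym_of_vec_of_sym: "transpose x = x \<Longrightarrow> sym_of_vec (vec_of_sym x) = x"
  by (simp add: sym_of_vec_def vec_of_sym_nth vec_eq_iff)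

lemma vec_of_sym_of_vec: "vec_of_sym (sym_of_vec e) = e"
proof -
  have "vec_of_sym (sym_of_vec e) $ m = e $ m" for m
  proof (rule sidx_cases[of m])
    fix i j assume "m = sidx i j"
    then show ?thesis by (simp add: vec_of_sym_nth[OF sym_of_vec_sym]) (simp add: sym_of_vec_def)
  qed
  then show ?thesis by (simp add: vec_eq_iff)
qed

lemma linear_sym_of_vec: "linear sym_of_vec"
  by (auto intro!: linearI simp: sym_of_vec_def vec_eq_iff)

lemma linear_vec_of_sym: "linear vec_of_sym"
  by (auto intro!: linearI simp: vec_of_sym_def vec_eq_iff)

lemma bounded_linear_sym_of_vec: "bounded_linear (sym_of_vec :: _ \<Rightarrow> real^'n::finite^'n)"
  using linear_sym_of_vec by (simp add: linear_conv_bounded_linear)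

lemma bounded_linear_vec_of_sym: "bounded_linear (vec_of_sym :: real^'n::finite^'n \<Rightarrow> _)"
  using linear_vec_of_sym by (simp add: linear_conv_bounded_linear)

lemma borel_measurable_sym_of_vec [measurable]: "sym_of_vec \<in> borel_measurable borel"
  by (intro borel_measurable_continuous_onI linear_continuous_on bounded_linear_sym_of_vec)

lemma borel_measurable_vec_of_sym [measurable]: "vec_of_sym \<in> borel_measurable borel"
  by (intro borel_measurable_continuous_onI linear_continuous_on bounded_linear_vec_of_sym)

text \<open>Replaces the product measure on functions by \<open>lborel\<close> on vectors: the image
  of the product measure gives boxes their volume, which characterises
  \<open>lborel\<close>.\<close>

lemma lebesgue_sym_eq: "lebesgue_sym = distr lborel borel (sym_of_vec :: _ \<Rightarrow> real^'n::finite^'n)"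
proof -
  define P :: "('n set \<Rightarrow> real) measure" where "P = PiM sym_index (\<lambda>_. lborel)"
  define c :: "('n set \<Rightarrow> real) \<Rightarrow> real^('n sym_idx)" where "c = (\<lambda>f. \<chi> m. f (Rep_sym_idx m))"
  have c: "c \<in> measurable P borel"
    unfolding c_def P_def
    by (intro borel_measurable_vecI, unfold vec_lambda_beta)
      (rule measurable_component_singleton[OF Rep_sym_idx, where M = "\<lambda>_. lborel", unfolded measurable_cong_sets[OF refl sets_lborel]])
  interpret product_sigma_finite "\<lambda>_ :: 'n set. lborel :: real measure" ..
  have "lborel = distr P borel c"
  proof (rule lborel_eqI)
    fix l u :: "real^('n sym_idx)"
    assume lu: "\<And>b. b \<in> Basis \<Longrightarrow> l \<bullet> b \<le> u \<bullet> b"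
    have lu': "l $ m \<le> u $ m" for m
      using lu[of "axis m 1"] by (simp add: inner_axis)
    have "c -` box l u \<inter> space P = (\<Pi>\<^sub>E i\<in>sym_index. {l $ Abs_sym_idx i <..< u $ Abs_sym_idx i})"
    proof (intro set_eqI iffI)
      fix f assume f: "f \<in> c -` box l u \<inter> space P"
      then have "f \<in> extensional sym_index" by (simp add: P_def space_PiM PiE_def)
      moreover have "f i \<in> {l $ Abs_sym_idx i <..< u $ Abs_sym_idx i}" if "i \<in> sym_index" for i
      proof -
        have "l $ Abs_sym_idx i < c f $ Abs_sym_idx i \<and> c f $ Abs_sym_idx i < u $ Abs_sym_idx i"
          using f by (auto simp: mem_box_cart)
        then show ?thesis by (simp add: c_def Abs_sym_idx_inverse[OF that])
      qed
      ultimately show "f \<in> (\<Pi>\<^sub>E i\<in>sym_index. {l $ Abs_sym_idx i <..< u $ Abs_sym_idx i})"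
        by (auto simp: PiE_def)
    next
      fix f assume f: "f \<in> (\<Pi>\<^sub>E i\<in>sym_index. {l $ Abs_sym_idx i <..< u $ Abs_sym_idx i})"
      have "l $ m < c f $ m \<and> c f $ m < u $ m" for m
        using PiE_mem[OF f Rep_sym_idx[of m]] by (simp add: c_def Rep_sym_idx_inverse)
      then show "f \<in> c -` box l u \<inter> space P"
        using f by (auto simp: mem_box_cart P_def space_PiM PiE_def)
    qed
    then have "emeasure (distr P borel c) (box l u) = emeasure P (\<Pi>\<^sub>E i\<in>sym_index. {l $ Abs_sym_idx i <..< u $ Abs_sym_idx i})"
      by (subst emeasure_distr[OF c]) auto
    also have "\<dots> = (\<Prod>i\<in>sym_index. ennreal (u $ Abs_sym_idx i - l $ Abs_sym_idx i))"
      unfolding P_def by (subst emeasure_PiM) (auto simp: lu')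
    also have "\<dots> = ennreal (\<Prod>i\<in>sym_index. (u - l) $ Abs_sym_idx i)"
      by (simp add: prod_ennreal lu')
    also have "(\<Prod>i\<in>sym_index. (u - l) $ Abs_sym_idx i) = (\<Prod>m\<in>UNIV. (u - l) $ m)"
      by (rule prod.reindex_bij_betw)
        (use type_definition.Abs_image[OF type_definition_sym_idx] in \<open>auto simp: bij_betw_def inj_on_def Abs_sym_idx_inject\<close>)
    also have "\<dots> = (\<Prod>b\<in>Basis. (u - l) \<bullet> b)"
    proof -
      have B: "(Basis :: (real^('n sym_idx)) set) = range (\<lambda>m. axis m 1)"
        by (auto simp: Basis_vec_def)
      show ?thesis
        unfolding B by (subst prod.reindex) (auto simp: inj_on_def axis_eq_axis inner_axis)
    qed
    finally show "emeasure (distr P borel c) (box l u) = ennreal (\<Prod>b\<in>Basis. (u - l) \<bullet> b)" .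
  qed simp
  then have "distr lborel borel (sym_of_vec :: _ \<Rightarrow> real^'n^'n) = distr (distr P borel c) borel sym_of_vec"
    by (rule arg_cong)
  also have "\<dots> = distr P borel (sym_of_vec \<circ> c)"
    by (rule distr_distr[OF borel_measurable_sym_of_vec c])
  also have "sym_of_vec \<circ> c = sym_of_coords"
    by (simp add: fun_eq_iff sym_of_coords_def sym_of_vec_def c_def Rep_sidx)
  finally show ?thesis
    unfolding lebesgue_sym_def P_def ..
qed

lemma sets_lebesgue_sym [simp, measurable_cong]: "sets lebesgue_sym = sets borel"
  by (simp add: lebesgue_sym_def)

lemma space_lebesgue_sym [simp]: "space lebesgue_sym = UNIV"
  by (simp add: lebesgue_sym_def)

lemma nn_integral_lebesgue_sym:
  "f \<in> borel_measurable borel \<Longrightarrow> (\<integral>\<^sup>+x. f x \<partial>lebesgue_sym) = (\<integral>\<^sup>+e. f (sym_of_vec e) \<partial>lborel)"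
  unfolding lebesgue_sym_eq by (rule nn_integral_distr) auto

lemma sigma_finite_lebesgue_sym: "sigma_finite_measure (lebesgue_sym :: (real^'n::finite^'n) measure)"
proof (rule sigma_finite_measure_distr)
  have "distr lebesgue_sym borel (vec_of_sym :: real^'n^'n \<Rightarrow> _) = distr lborel borel (vec_of_sym \<circ> (sym_of_vec :: _ \<Rightarrow> real^'n^'n))"
    unfolding lebesgue_sym_eq by (rule distr_distr) auto
  also have "\<dots> = lborel"
    by (simp add: comp_def vec_of_sym_of_vec distr_id2)
  finally show "sigma_finite_measure (distr lebesgue_sym borel (vec_of_sym :: real^'n^'n \<Rightarrow> _))"
    by (simp add: sigma_finite_lborel)
qed (simp add: measurable_cong_sets[OF sets_lebesgue_sym refl])

lemma nn_integral_lebesgue_sym_translate: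
  fixes f :: "real^'n::finite^'n \<Rightarrow> ennreal"
  assumes [measurable]: "f \<in> borel_measurable borel" and c: "transpose c = c"
  shows "(\<integral>\<^sup>+x. f x \<partial>lebesgue_sym) = (\<integral>\<^sup>+x. f (x + c) \<partial>lebesgue_sym)"
proof -
  have "(\<integral>\<^sup>+x. f x \<partial>lebesgue_sym) = (\<integral>\<^sup>+e. f (sym_of_vec e) \<partial>distr lborel borel ((+) (vec_of_sym c)))"
    by (simp add: nn_integral_lebesgue_sym lborel_distr_plus)
  also have "\<dots> = (\<integral>\<^sup>+e. f (sym_of_vec (vec_of_sym c + e)) \<partial>lborel)"
    by (rule nn_integral_distr) auto
  also have "\<dots> = (\<integral>\<^sup>+e. f (sym_of_vec e + c) \<partial>lborel)"
    by (simp add: linear_add[OF linear_sym_of_vec] sym_of_vec_of_sym[OF c] add.commute)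
  also have "\<dots> = (\<integral>\<^sup>+x. f (x + c) \<partial>lebesgue_sym)"
    by (rule nn_integral_lebesgue_sym[symmetric]) simp
  finally show ?thesis .
qed

text \<open>In coordinates symmetry is automatic, so only the open condition on the quadratic form
  remains.\<close>

lemma open_posdef_vec: "open {e. sym_of_vec e \<in> (posdef_mats :: (real^'n::finite^'n) set)}"
proof -
  have "{e. sym_of_vec e \<in> (posdef_mats :: (real^'n::finite^'n) set)} =
      sym_of_vec -` {x. \<forall>v. norm v = 1 \<longrightarrow> v \<bullet> (x *v v) > 0}"
    by (auto simp: posdef_eq_sym_Int sym_mats_def sym_of_vec_sym)
  then show ?thesis
    by (simp only:) (intro open_vimage open_posdef_part linear_continuous_on bounded_linear_sym_of_vec)
qed

text \<open>The part of the cone on which two continuous functions differ is open in coordinates,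
  hence empty or of positive measure.\<close>

lemma AE_lebesgue_sym_posdef_eq:
  fixes f g :: "real^'n::finite^'n \<Rightarrow> real"
  assumes ae: "AE x in lebesgue_sym. x \<in> posdef_mats \<longrightarrow> f x = g x"
    and f: "continuous_on posdef_mats f" and g: "continuous_on posdef_mats g"
    and x: "x \<in> posdef_mats"
  shows "f x = g x"
proof (rule ccontr)
  assume ne: "f x \<noteq> g x"
  let ?S = "{e. sym_of_vec e \<in> (posdef_mats :: (real^'n^'n) set)}"
  let ?U = "{e\<in>?S. f (sym_of_vec e) - g (sym_of_vec e) \<in> - {0}}"
  have ct: "continuous_on ?S (\<lambda>e. f (sym_of_vec e) - g (sym_of_vec e))"
    by (intro continuous_intros continuous_on_compose2[OF f] continuous_on_compose2[OF g]
        linear_continuous_on bounded_linear_sym_of_vec) auto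
  have "open (?S \<inter> (\<lambda>e. f (sym_of_vec e) - g (sym_of_vec e)) -` (- {0}))"
    by (rule continuous_open_preimage[OF ct open_posdef_vec]) auto
  moreover have "?S \<inter> (\<lambda>e. f (sym_of_vec e) - g (sym_of_vec e)) -` (- {0}) = ?U"
    by auto
  ultimately have op: "open ?U" by simp
  have "vec_of_sym x \<in> ?U"
    using x ne by (simp add: sym_of_vec_of_sym posdef_sym)
  then have "\<not> negligible ?U"
    using open_not_negligible[OF op] by blast
  moreover have "AE e in lborel. e \<notin> ?U"
  proof -
    have "AE e in lborel. sym_of_vec e \<in> posdef_mats \<longrightarrow> f (sym_of_vec e) = g (sym_of_vec e)"
      using ae unfolding lebesgue_sym_eq by (rule AE_distrD[rotated]) simp
    then show ?thesis by eventually_elim auto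
  qed
  then have "?U \<in> null_sets lborel"
    using op by (intro AE_iff_null_sets[THEN iffD2]) auto
  then have "negligible ?U"
    by (simp add: negligible_iff_null_sets null_sets_completionI)
  ultimately show False by simp
qed

text \<open>\<open>has_measure_differentiable_image\<close> computes measures of images from
  Henstock integrals. The equality is first proved as one of measures, set by set, and then
  transferred to nonnegative integrands.\<close>

lemma nn_integral_change_of_variables:
  fixes g :: "real^'m::{finite,wellorder} \<Rightarrow> real^'m::_" and f :: "real^'m::_ \<Rightarrow> ennreal"
  assumes [measurable]: "S \<in> sets borel" "g ` S \<in> sets borel" "g \<in> borel_measurable borel"
      "j \<in> borel_measurable borel" "f \<in> borel_measurable borel"
    and der: "\<And>x. x \<in> S \<Longrightarrow> (g has_derivative g' x) (at x within S)"
    and inj: "inj_on g S" and j: "\<And>x. x \<in> S \<Longrightarrow> j x = \<bar>det (matrix (g' x))\<bar>"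
  shows "(\<integral>\<^sup>+x. f x * indicator (g ` S) x \<partial>lborel) = (\<integral>\<^sup>+x. f (g x) * (ennreal (j x) * indicator S x) \<partial>lborel)"
proof -
  let ?M = "density lborel (indicator (g ` S))"
  let ?N = "density lborel (\<lambda>x. ennreal (j x) * indicator S x)"
  have eq: "?M = distr ?N borel g"
  proof (rule measure_eqI)
    fix A assume "A \<in> sets ?M"
    then have [measurable]: "A \<in> sets borel" by simp
    define T where "T = S \<inter> g -` A"
    have T [measurable]: "T \<in> sets borel"
      unfolding T_def using measurable_sets[of g borel borel A] by simp
    have gT: "g ` T = g ` S \<inter> A" by (auto simp: T_def)
    define h where "h = (\<lambda>x. indicator T x * j x)"
    have h [measurable]: "h \<in> borel_measurable borel" unfolding h_def by simp
    have h0: "h x \<ge> 0" for x using j by (auto simp: h_def T_def indicator_def)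
    have int_iff: "((\<lambda>x. \<bar>det (matrix (g' x))\<bar>) has_integral m) T \<longleftrightarrow> (h has_integral m) UNIV" for m
    proof -
      have "(h has_integral m) UNIV \<longleftrightarrow> ((\<lambda>x. if x \<in> T then \<bar>det (matrix (g' x))\<bar> else 0) has_integral m) UNIV"
        by (intro has_integral_cong) (auto simp: h_def j T_def)
      then show ?thesis by (simp add: has_integral_restrict_UNIV)
    qed
    have image: "g ` T \<in> lmeasurable \<and> measure lebesgue (g ` T) = m \<longleftrightarrow> (h has_integral m) UNIV" for m
      unfolding int_iff[symmetric]
      by (rule has_measure_differentiable_image)
        (auto simp: T_def intro: has_derivative_subset[OF der] inj_on_subset[OF inj] sets_completionI_sets)
    have gT_b: "g ` T \<in> sets borel" unfolding gT by simp
    have lm: "g ` T \<in> lmeasurable \<longleftrightarrow> emeasure lborel (g ` T) < \<infinity>"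
      "emeasure lebesgue (g ` T) = emeasure lborel (g ` T)"
      using gT_b by (auto simp: fmeasurable_def intro: sets_completionI_sets)
    have "emeasure lborel (g ` T) = (\<integral>\<^sup>+x. ennreal (h x) \<partial>lborel)"
    proof (cases "(\<integral>\<^sup>+x. ennreal (h x) \<partial>lborel)")
      case (real r)
      then have "(h has_integral r) UNIV"
        by (intro nn_integral_has_integral h h0) auto
      then have "g ` T \<in> lmeasurable" "measure lebesgue (g ` T) = r"
        using image[of r] by auto
      then have "emeasure lebesgue (g ` T) = ennreal r"
        by (simp add: emeasure_eq_measure2)
      then show ?thesis using lm real by simp
    next
      \<comment> \<open>An image of finite measure would make \<open>h\<close> integrable, so an
        infinite integral forces an image of infinite measure.\<close>
      case top
      have "\<not> emeasure lborel (g ` T) < \<infinity>"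
      proof
        assume "emeasure lborel (g ` T) < \<infinity>"
        then have "(h has_integral measure lebesgue (g ` T)) UNIV"
          using lm image by blast
        from nn_integral_has_integral_lborel[OF h h0 this] top show False by simp
      qed
      then have "emeasure lborel (g ` T) = \<infinity>"
        by (simp add: less_top[symmetric])
      then show ?thesis using top by simp
    qed
    moreover have "emeasure ?M A = emeasure lborel (g ` T)"
    proof -
      have "emeasure ?M A = (\<integral>\<^sup>+x. indicator (g ` S) x * indicator A x \<partial>lborel)"
        by (rule emeasure_density) auto
      also have "\<dots> = (\<integral>\<^sup>+x. indicator (g ` T) x \<partial>lborel)"
        unfolding gT by (simp only: indicator_inter_arith)
      also have "\<dots> = emeasure lborel (g ` T)"
        using gT_b by (intro nn_integral_indicator) simp
      finally show ?thesis .
    qed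
    moreover have "emeasure (distr ?N borel g) A = (\<integral>\<^sup>+x. ennreal (h x) \<partial>lborel)"
    proof -
      have "emeasure (distr ?N borel g) A = emeasure ?N (g -` A)"
        by (subst emeasure_distr) auto
      also have "\<dots> = (\<integral>\<^sup>+x. (ennreal (j x) * indicator S x) * indicator (g -` A) x \<partial>lborel)"
        using measurable_sets[of g borel borel A] by (intro emeasure_density) auto
      also have "\<dots> = (\<integral>\<^sup>+x. ennreal (h x) \<partial>lborel)"
        by (intro nn_integral_cong) (auto simp: h_def T_def indicator_def)
      finally show ?thesis .
    qed
    ultimately show "emeasure ?M A = emeasure (distr ?N borel g) A" by simp
  qed simp
  have "(\<integral>\<^sup>+x. f x * indicator (g ` S) x \<partial>lborel) = (\<integral>\<^sup>+x. f x \<partial>?M)"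
    by (subst nn_integral_density) (auto simp: mult.commute)
  also have "\<dots> = (\<integral>\<^sup>+x. f (g x) \<partial>?N)"
    unfolding eq by (subst nn_integral_distr) auto
  also have "\<dots> = (\<integral>\<^sup>+x. f (g x) * (ennreal (j x) * indicator S x) \<partial>lborel)"
    by (subst nn_integral_density) (auto simp: mult.commute)
  finally show ?thesis .
qed

subsection \<open>Congruences and inversion\<close>

lemma eq_eq_trans: "a = b \<Longrightarrow> a = c \<Longrightarrow> b = d \<Longrightarrow> c = d"
  by simp

lemma abs_det_minus: "\<bar>det (- A)\<bar> = \<bar>det (A :: real^'n::finite^'n)\<bar>"
proof -
  have "- A = (- mat 1) ** A" by (simp add: matrix_mult.minus_left)
  moreover have "det (- mat 1 :: real^'n^'n) * det (- mat 1 :: real^'n^'n) = 1"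
    by (simp add: det_mul[symmetric] matrix_mult.minus_left)
  then have "\<bar>det (- mat 1 :: real^'n^'n)\<bar> = 1"
    by (auto simp: square_eq_1_iff)
  ultimately show ?thesis by (simp add: det_mul abs_mult)
qed

definition congr :: "real^'n::finite^'n \<Rightarrow> real^('n sym_idx) \<Rightarrow> real^('n sym_idx)" where
  "congr A e = vec_of_sym (A ** sym_of_vec e ** transpose A)"

lemma congr_sym: "transpose x = x \<Longrightarrow> transpose (A ** x ** transpose A) = A ** x ** transpose (A :: real^'n::finite^'n)"
  by (simp add: matrix_transpose_mul matrix_mul_assoc)

lemma sym_of_vec_congr: "sym_of_vec (congr A e) = A ** sym_of_vec e ** transpose A"
  unfolding congr_def by (intro sym_of_vec_of_sym congr_sym sym_of_vec_sym)

lemma linear_congr: "linear (congr A)"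
  unfolding congr_def
  by (auto intro!: linearI simp: linear_add[OF linear_sym_of_vec] linear_scale[OF linear_sym_of_vec]
      linear_add[OF linear_vec_of_sym] linear_scale[OF linear_vec_of_sym] matrix_algebra)

lemma congr_mult: "congr (A ** B) = congr A \<circ> congr B"
  by (auto simp: fun_eq_iff congr_def[of "A ** B"] congr_def[of A] sym_of_vec_congr matrix_transpose_mul matrix_mul_assoc)

lemma congr_mat_1: "congr (mat 1) = id"
  by (auto simp: fun_eq_iff congr_def vec_of_sym_of_vec)

definition congr_det :: "real^'n::finite^'n \<Rightarrow> real" where
  "congr_det A = det (matrix (congr A))"

lemma congr_det_mult: "congr_det (A ** B) = congr_det A * congr_det B"
  unfolding congr_det_def congr_mult by (simp add: matrix_compose linear_congr det_mul)

lemma congr_det_1: "congr_det (mat 1) = 1"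
  unfolding congr_det_def congr_mat_1 by (simp add: matrix_id_mat_1)

text \<open>An unordered pair with distinct elements comes from two ordered pairs, a singleton from
  one ordered pair and one diagonal index. Multiplying over ordered pairs and then over diagonal
  indices thus counts every coordinate twice, and the square of the product is found.\<close>

lemma prod_sym_idx:
  fixes d :: "'n::finite \<Rightarrow> real" and F :: "'n sym_idx \<Rightarrow> real"
  assumes F: "\<And>i j. F (sidx i j) = d i * d j"
  shows "\<bar>\<Prod>m\<in>UNIV. F m\<bar> = \<bar>\<Prod>i\<in>UNIV. d i\<bar> ^ (CARD('n) + 1)"
proof -
  let ?S = "\<lambda>m. {ij. sidx (fst ij) (snd ij) = m}" and ?D = "\<lambda>m. {i. sidx i i = m}"
  have card: "card (?S m) + card (?D m) = 2" for m :: "'n sym_idx"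
  proof (rule sidx_cases[of m])
    fix k l assume m: "m = sidx k l"
    have S: "?S m = {(k, l), (l, k)}" by (auto simp: m sidx_eq_iff)
    have D: "?D m = (if k = l then {k} else {})" by (auto simp: m sidx_eq_iff)
    show ?thesis by (cases "k = l") (simp_all add: S D)
  qed
  have "(\<Prod>ij\<in>UNIV. F (sidx (fst ij) (snd ij))) = (\<Prod>m\<in>UNIV. \<Prod>ij\<in>?S m. F m)"
    by (subst prod.group[of UNIV UNIV "\<lambda>ij. sidx (fst ij) (snd ij)", symmetric]) auto
  moreover have "(\<Prod>i\<in>UNIV. F (sidx i i)) = (\<Prod>m\<in>UNIV. \<Prod>i\<in>?D m. F m)"
    by (subst prod.group[of UNIV UNIV "\<lambda>i. sidx i i", symmetric]) auto
  ultimately have "(\<Prod>ij\<in>UNIV. F (sidx (fst ij) (snd ij))) * (\<Prod>i\<in>UNIV. F (sidx i i)) = (\<Prod>m\<in>UNIV. F m ^ 2)"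
    by (simp add: prod.distrib[symmetric] power_add[symmetric] card)
  moreover have "(\<Prod>ij\<in>UNIV. F (sidx (fst ij) (snd ij))) = (\<Prod>i\<in>UNIV. d i) ^ (2 * CARD('n))"
  proof -
    have "(\<Prod>ij\<in>UNIV. F (sidx (fst ij) (snd ij))) = (\<Prod>i\<in>UNIV. \<Prod>j\<in>UNIV. d i * d j)"
      by (simp add: F prod.cartesian_product split_def UNIV_Times_UNIV[symmetric] del: UNIV_Times_UNIV)
    also have "\<dots> = (\<Prod>i\<in>UNIV. d i ^ CARD('n)) * (\<Prod>i\<in>(UNIV::'n set). \<Prod>j\<in>UNIV. d j)"
      by (simp add: prod.distrib)
    also have "\<dots> = (\<Prod>i\<in>UNIV. d i) ^ (2 * CARD('n))"
      by (simp add: prod_power_distrib mult_2 power_add)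
    finally show ?thesis .
  qed
  moreover have "(\<Prod>i\<in>UNIV. F (sidx i i)) = (\<Prod>i\<in>UNIV. d i) ^ 2"
    by (simp add: F prod.distrib power2_eq_square)
  ultimately have "(\<Prod>m\<in>UNIV. F m ^ 2) = (\<Prod>i\<in>UNIV. d i) ^ (2 * CARD('n)) * (\<Prod>i\<in>UNIV. d i) ^ 2"
    by (simp only:)
  also have "\<dots> = ((\<Prod>i\<in>UNIV. d i) ^ (CARD('n) + 1)) ^ 2"
    unfolding power_add[symmetric] power_mult[symmetric] by (simp add: algebra_simps)
  finally have "(\<Prod>m\<in>UNIV. F m) ^ 2 = ((\<Prod>i\<in>UNIV. d i) ^ (CARD('n) + 1)) ^ 2"
    by (simp only: prod_power_distrib)
  then have "\<bar>\<Prod>m\<in>UNIV. F m\<bar> = \<bar>(\<Prod>i\<in>UNIV. d i) ^ (CARD('n) + 1)\<bar>"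
    unfolding power2_eq_iff by (metis abs_minus_cancel)
  then show ?thesis
    by (simp only: power_abs)
qed

text \<open>Both sides are multiplicative in A, so elementary factors suffice. A zero row makes both
  sides vanish, a diagonal matrix acts diagonally on the coordinates, and transpositions and shears
  have determinants \<plusminus>1 on both sides.\<close>

lemma abs_congr_det: "\<bar>congr_det A\<bar> = \<bar>det A\<bar> ^ (CARD('n) + 1)" for A :: "real^'n::finite^'n"
proof (induction A rule: induct_matrix_elementary)
  case (1 A B)
  then show ?case by (simp add: congr_det_mult det_mul abs_mult power_mult_distrib)
next
  case (2 A i)
  note zero_row = this
  have Ai: "A $ i = 0" using zero_row by (simp add: row_def vec_eq_iff)
  have "congr A e $ sidx i i = 0" for e
    unfolding congr_def vec_of_sym_nth[OF congr_sym[OF sym_of_vec_sym]]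
    by (simp add: matrix_matrix_mult_def Ai)
  then have "row (sidx i i) (matrix (congr A)) = 0"
    by (simp add: row_def matrix_def vec_eq_iff)
  then have "congr_det A = 0" unfolding congr_det_def by (rule det_zero_row)
  moreover have "det A = 0" using zero_row by (rule det_zero_row)
  ultimately show ?case by simp
next
  case (3 A)
  note diagonal = this
  have e: "congr A e $ sidx i j = A$i$i * A$j$j * e $ sidx i j" for e i j
  proof -
    have "congr A e $ sidx i j = (A ** sym_of_vec e ** transpose A) $ i $ j"
      unfolding congr_def by (rule vec_of_sym_nth[OF congr_sym[OF sym_of_vec_sym]])
    also have "\<dots> = (\<Sum>k\<in>UNIV. (\<Sum>l\<in>UNIV. A$i$l * sym_of_vec e $ l $ k) * A$j$k)"
      by (simp add: matrix_matrix_mult_def transpose_def)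
    also have "\<dots> = (\<Sum>k\<in>{j}. (\<Sum>l\<in>{i}. A$i$l * sym_of_vec e $ l $ k) * A$j$k)"
    proof (rule sum.mono_neutral_cong_right)
      fix k
      have "(\<Sum>l\<in>UNIV. A$i$l * sym_of_vec e $ l $ k) = (\<Sum>l\<in>{i}. A$i$l * sym_of_vec e $ l $ k)"
        by (rule sum.mono_neutral_right) (use diagonal in auto)
      then show "(\<Sum>l\<in>UNIV. A$i$l * sym_of_vec e $ l $ k) * A$j$k = (\<Sum>l\<in>{i}. A$i$l * sym_of_vec e $ l $ k) * A$j$k"
        by simp
    qed (use diagonal in auto)
    finally show ?thesis by (simp add: sym_of_vec_def mult_ac)
  qed
  define F where "F = (\<lambda>m. matrix (congr A) $ m $ m)"
  have F: "F (sidx i j) = A$i$i * A$j$j" for i j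
    by (simp add: F_def matrix_def e axis_def)
  have "matrix (congr A) $ m $ n = 0" if "m \<noteq> n" for m n
    by (rule sidx_cases[of m]) (use that in \<open>auto simp: matrix_def e axis_def\<close>)
  then have "congr_det A = (\<Prod>m\<in>UNIV. F m)"
    unfolding congr_det_def F_def by (rule det_diagonal)
  moreover have "det A = (\<Prod>i\<in>UNIV. A$i$i)"
    using diagonal by (rule det_diagonal)
  ultimately show ?case using prod_sym_idx[of F "\<lambda>i. A$i$i", OF F] by simp
next
  case (4 m n)
  let ?A = "(\<chi> i j. mat 1 $ i $ Transposition.transpose m n j) :: real^'n^'n"
  have AA: "?A ** ?A = mat 1"
  proof -
    have "(?A ** ?A) $ i $ j = (mat 1 :: real^'n^'n) $ i $ j" for i j
    proof -
      define \<tau> where "\<tau> = Transposition.transpose m n"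
      have \<tau>: "\<tau> (\<tau> j) = j" by (simp add: \<tau>_def)
      have "(?A ** ?A) $ i $ j = (\<Sum>k\<in>UNIV. if k = \<tau> j then (mat 1 :: real^'n^'n) $ i $ \<tau> k else 0)"
        unfolding matrix_matrix_mult_def \<tau>_def[symmetric] vec_lambda_beta
        by (rule sum.cong) (simp_all add: mat_def)
      then show ?thesis by (simp add: \<tau>)
    qed
    then show ?thesis by (simp add: vec_eq_iff)
  qed
  have "congr_det ?A * congr_det ?A = 1" "det ?A * det ?A = 1"
    unfolding congr_det_mult[symmetric] det_mul[symmetric] AA by (simp_all add: congr_det_1)
  then have "\<bar>congr_det ?A\<bar> = 1" "\<bar>det ?A\<bar> = 1"
    by (auto simp: square_eq_1_iff)
  then show ?case by simp
next
  case (5 m n c)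
  note idplus = this
  define E where "E = (\<lambda>c. (\<chi> i j. if i = m \<and> j = n then c else of_bool (i = j)) :: real^'n^'n)"
  define D where "D = ((\<chi> i j. if i = j then (if i = m then -1 else 1) else 0) :: real^'n^'n)"
  have DA: "(D ** A) $ i $ j = (if i = m then - 1 else 1) * A $ i $ j" for A i j
    by (simp add: D_def matrix_matrix_mult_def if_distrib[of "\<lambda>x. x * y" for y] cong: if_cong)
  have AD: "(A ** D) $ i $ j = A $ i $ j * (if j = m then - 1 else 1)" for A i j
    by (simp add: D_def matrix_matrix_mult_def if_distrib[of "\<lambda>x. y * x" for y] cong: if_cong)
  have DD: "D ** D = mat 1"
    by (auto simp: vec_eq_iff DA) (auto simp: D_def mat_def)
  have DED: "D ** E c ** D = E (- c)"
    using idplus by (auto simp: vec_eq_iff DA AD) (auto simp: E_def)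
  have EE: "E c ** E (- c) = mat 1"
  proof -
    have "(E c ** E (- c)) $ i $ j = mat 1 $ i $ j" for i j
    proof -
      have Ec: "E c $ i $ k = (if k = i then 1 else 0) + (if k = n then if i = m then c else 0 else 0)" for k
        using idplus by (auto simp: E_def)
      have "(E c ** E (- c)) $ i $ j = E (- c) $ i $ j + (if i = m then c else 0) * E (- c) $ n $ j"
        by (simp add: matrix_matrix_mult_def Ec distrib_right sum.distrib if_distrib[of "\<lambda>x. x * y" for y] cong: if_cong)
      then show ?thesis using idplus by (auto simp: E_def mat_def)
    qed
    then show ?thesis by (simp add: vec_eq_iff)
  qed
  \<comment> \<open>A multiplicative f with f(1) = 1 satisfies f(D)^2 = 1, so conjugation by D
    preserves f(E c). Conjugation also turns E c into its inverse E (-c).\<close>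
  have sq: "f (E c) * f (E c) = 1" if f: "\<And>A B. f (A ** B) = f A * f B" "f (mat 1) = 1" for f :: "real^'n^'n \<Rightarrow> real"
  proof -
    have "f D * f D = 1" using f DD by metis
    then have "f (E c) * f (E c) = (f D * f D) * (f (E c) * f (E c))" by simp
    also have "\<dots> = f (E c) * (f D * f (E c) * f D)" by (simp add: mult_ac)
    also have "\<dots> = 1" unfolding f(1)[symmetric] DED EE by (rule f(2))
    finally show ?thesis .
  qed
  have "congr_det (E c) * congr_det (E c) = 1" "det (E c) * det (E c) = 1"
    by (rule sq; simp add: congr_det_mult congr_det_1 det_mul)+
  then have "\<bar>congr_det (E c)\<bar> = 1" "\<bar>det (E c)\<bar> = 1"
    by (auto simp: square_eq_1_iff)
  then show ?case by (simp add: E_def)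
qed

lemma nn_integral_lebesgue_sym_congruence:
  fixes f :: "real^'n::finite^'n \<Rightarrow> ennreal"
  assumes [measurable]: "f \<in> borel_measurable borel" and A: "invertible A"
  shows "(\<integral>\<^sup>+x. f x \<partial>lebesgue_sym) = (\<integral>\<^sup>+x. f (A ** x ** transpose A) * ennreal (\<bar>det A\<bar> ^ (CARD('n) + 1)) \<partial>lebesgue_sym)"
proof -
  have inv: "congr A (congr (matrix_inv A) e) = e" "congr (matrix_inv A) (congr A e) = e" for e
    using fun_cong[OF congr_mult[of A "matrix_inv A"], of e] fun_cong[OF congr_mult[of "matrix_inv A" A], of e]
    by (simp_all add: matrix_inv_props(1,2)[OF A] congr_mat_1)
  have sur: "range (congr A) = UNIV" using inv(1) by (metis surjI)
  have inj: "inj (congr A)" using inv(2) by (metis injI)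
  have [measurable]: "congr A \<in> borel_measurable borel"
    using linear_congr by (intro borel_measurable_continuous_onI linear_continuous_on) (simp add: linear_conv_bounded_linear)
  have [measurable]: "(\<lambda>x. A ** x ** transpose A) \<in> borel_measurable borel"
    by (intro borel_measurable_continuous_onI continuous_intros matrix_mult.continuous_on)
  have "(\<integral>\<^sup>+e. f (sym_of_vec e) * indicator (range (congr A)) e \<partial>lborel) =
     (\<integral>\<^sup>+e. f (sym_of_vec (congr A e)) * (ennreal (\<bar>det A\<bar> ^ (CARD('n) + 1)) * indicator UNIV e) \<partial>lborel)"
  proof (rule nn_integral_change_of_variables)
    show "(congr A has_derivative congr A) (at x within UNIV)" for x
      using linear_congr by (intro linear_imp_has_derivative)
    show "\<bar>det A\<bar> ^ (CARD('n) + 1) = \<bar>det (matrix (congr A))\<bar>" for x :: "real^'n sym_idx"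
      using abs_congr_det[of A] by (simp add: congr_det_def)
  qed (use inj in \<open>auto simp: sur\<close>)
  then have "(\<integral>\<^sup>+e. f (sym_of_vec e) \<partial>lborel) = (\<integral>\<^sup>+e. f (A ** sym_of_vec e ** transpose A) * ennreal (\<bar>det A\<bar> ^ (CARD('n) + 1)) \<partial>lborel)"
    by (simp add: sur sym_of_vec_congr)
  then show ?thesis
    by (simp add: nn_integral_lebesgue_sym)
qed

text \<open>The derivative of the inversion at x is minus the congruence by x^-1, so its Jacobian is
  the congruence determinant of x^-1.\<close>

lemma nn_integral_lebesgue_sym_inverse:
  fixes f :: "real^'n::finite^'n \<Rightarrow> ennreal"
  assumes [measurable]: "f \<in> borel_measurable borel"
  shows "(\<integral>\<^sup>+x. f x * indicator posdef_mats x \<partial>lebesgue_sym) =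
    (\<integral>\<^sup>+x. f (matrix_inv x) * (ennreal ((1 / det x) ^ (CARD('n) + 1)) * indicator posdef_mats x) \<partial>lebesgue_sym)"
proof -
  let ?S = "{e. sym_of_vec e \<in> (posdef_mats :: (real^'n^'n) set)}"
  define g where "g = (\<lambda>e. vec_of_sym (matrix_inv (sym_of_vec e :: real^'n^'n)))"
  define j where "j = (\<lambda>e. (1 / det (sym_of_vec e :: real^'n^'n)) ^ (CARD('n) + 1))"
  have sg: "sym_of_vec (g e) = matrix_inv (sym_of_vec e)" if "e \<in> ?S" for e
    unfolding g_def using that by (intro sym_of_vec_of_sym posdef_sym posdef_matrix_inv) auto
  have gS: "g e \<in> ?S" if "e \<in> ?S" for e
    using that sg[OF that] posdef_matrix_inv by simp
  have gg: "g (g e) = e" if "e \<in> ?S" for e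
  proof -
    have "g (g e) = vec_of_sym (matrix_inv (sym_of_vec (g e)))" by (simp add: g_def)
    also have "\<dots> = e"
      unfolding sg[OF that] using that by (simp add: invertible_matrix_inv posdef_invertible vec_of_sym_of_vec)
    finally show ?thesis .
  qed
  have img: "g ` ?S = ?S"
  proof (intro equalityI subsetI)
    show "e \<in> g ` ?S" if "e \<in> ?S" for e
      by (rule image_eqI[of _ g "g e"]) (use gg[OF that] gS[OF that] in auto)
  qed (use gS in auto)
  have [measurable]: "g \<in> borel_measurable borel" unfolding g_def by simp
  have [measurable]: "j \<in> borel_measurable borel" unfolding j_def by simp
  have [measurable]: "?S \<in> sets borel" using open_posdef_vec by (rule borel_open)
  have "(\<integral>\<^sup>+e. f (sym_of_vec e) * indicator (g ` ?S) e \<partial>lborel) = (\<integral>\<^sup>+e. f (sym_of_vec (g e)) * (ennreal (j e) * indicator ?S e) \<partial>lborel)"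
  proof (rule nn_integral_change_of_variables[where g' = "\<lambda>e h. - congr (matrix_inv (sym_of_vec e)) h"])
    fix e assume e: "e \<in> ?S"
    let ?x = "sym_of_vec e :: real^'n^'n"
    have x: "?x \<in> posdef_mats" using e by simp
    have "(g has_derivative (\<lambda>h. vec_of_sym (- (matrix_inv ?x ** sym_of_vec h ** matrix_inv ?x)))) (at e)"
      unfolding g_def
      by (intro bounded_linear.has_derivative[OF bounded_linear_vec_of_sym]
          has_derivative_compose[OF bounded_linear_imp_has_derivative[OF bounded_linear_sym_of_vec]]
          has_derivative_matrix_inv posdef_invertible x)
    moreover have "vec_of_sym (- (matrix_inv ?x ** sym_of_vec h ** matrix_inv ?x)) = - congr (matrix_inv ?x) h" for h
      unfolding congr_def posdef_sym[OF posdef_matrix_inv[OF x]] by (rule linear_neg[OF linear_vec_of_sym])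
    ultimately show "(g has_derivative (\<lambda>h. - congr (matrix_inv ?x) h)) (at e within ?S)"
      by (simp add: has_derivative_at_withinI)
    have "matrix (\<lambda>h. - congr (matrix_inv ?x) h) = - matrix (congr (matrix_inv ?x))"
      by (simp add: matrix_def vec_eq_iff)
    then have "\<bar>det (matrix (\<lambda>h. - congr (matrix_inv ?x) h))\<bar> = \<bar>congr_det (matrix_inv ?x)\<bar>"
      by (simp add: congr_det_def abs_det_minus)
    also have "\<dots> = \<bar>det (matrix_inv ?x)\<bar> ^ (CARD('n) + 1)"
      by (rule abs_congr_det)
    also have "\<dots> = j e"
      using det_posdef[OF x] by (simp add: j_def det_matrix_inv[OF posdef_invertible[OF x]])
    finally show "j e = \<bar>det (matrix (\<lambda>h. - congr (matrix_inv ?x) h))\<bar>" ..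
  next
    show "inj_on g ?S" by (rule inj_on_inverseI[of _ g]) (rule gg)
  qed (simp_all add: img)
  then have "(\<integral>\<^sup>+e. f (sym_of_vec e) * indicator posdef_mats (sym_of_vec e :: real^'n^'n) \<partial>lborel) =
     (\<integral>\<^sup>+e. f (matrix_inv (sym_of_vec e)) * (ennreal ((1 / det (sym_of_vec e)) ^ (CARD('n) + 1)) * indicator posdef_mats (sym_of_vec e :: real^'n^'n)) \<partial>lborel)"
    unfolding img
  proof (rule eq_eq_trans)
    show "(\<integral>\<^sup>+e. f (sym_of_vec e) * indicator ?S e \<partial>lborel) = (\<integral>\<^sup>+e. f (sym_of_vec e) * indicator posdef_mats (sym_of_vec e :: real^'n^'n) \<partial>lborel)"
      by (intro nn_integral_cong) (auto simp: indicator_def)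
    show "(\<integral>\<^sup>+e. f (sym_of_vec (g e)) * (ennreal (j e) * indicator ?S e) \<partial>lborel) =
      (\<integral>\<^sup>+e. f (matrix_inv (sym_of_vec e)) * (ennreal ((1 / det (sym_of_vec e)) ^ (CARD('n) + 1)) * indicator posdef_mats (sym_of_vec e :: real^'n^'n)) \<partial>lborel)"
      by (intro nn_integral_cong) (auto simp: indicator_def j_def sg)
  qed
  then show ?thesis
    by (simp add: nn_integral_lebesgue_sym)
qed

subsection \<open>Substitution under the integral\<close>

interpretation lsym: sigma_finite_measure "lebesgue_sym :: (real^'n::finite^'n) measure"
  by (rule sigma_finite_lebesgue_sym)

interpretation lsym_pair: pair_sigma_finite "lebesgue_sym :: (real^'n::finite^'n) measure" "lebesgue_sym :: (real^'n::finite^'n) measure" ..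

lemma borel_measurable_mgig_V [measurable]:
  "(\<lambda>z. mgig_V \<alpha> \<beta> (fst z) (snd z)) \<in> borel_measurable (borel \<Otimes>\<^sub>M borel)"
  unfolding mgig_V_def by measurable

lemma borel_measurable_mgig_U [measurable]:
  "(\<lambda>z. mgig_U \<alpha> \<beta> (fst z) (snd z)) \<in> borel_measurable (borel \<Otimes>\<^sub>M borel)"
  unfolding mgig_U_def by measurable

text \<open>The changes of variable are s = \<alpha> x + y, a = x^-1, v = a + \<delta> s^-1, w = s -
  \<beta> v^-1, u = w^-1, each with the other variable fixed, and with the order of integration
  exchanged when needed. The shears are translations, so the Jacobian comes from the two inversions:
  the first gives the power r+1 of det x, the second that of 1 / det u.\<close>

lemma nn_integral_mgig_substitution:
  fixes p :: "(real^'n::finite^'n) \<times> (real^'n^'n) \<Rightarrow> ennreal"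
  assumes \<alpha>: "\<alpha> \<ge> 0" and \<beta>: "\<beta> \<ge> 0"
    and p [measurable]: "p \<in> borel_measurable (borel \<Otimes>\<^sub>M borel)"
  shows "(\<integral>\<^sup>+x. \<integral>\<^sup>+y. p (x, y) * (indicator posdef_mats x * indicator posdef_mats y) \<partial>lebesgue_sym \<partial>lebesgue_sym) =
    (\<integral>\<^sup>+u. \<integral>\<^sup>+v. p (mgig_U \<alpha> \<beta> u v, mgig_V \<alpha> \<beta> u v) * ennreal ((det (mgig_U \<alpha> \<beta> u v) / det u) ^ (CARD('n) + 1))
       * (indicator posdef_mats u * indicator posdef_mats v) \<partial>lebesgue_sym \<partial>lebesgue_sym)"
proof -
  let ?L = "lebesgue_sym :: (real^'n^'n) measure"
  define I :: "real^'n^'n \<Rightarrow> ennreal" where "I = indicator posdef_mats"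
  define J :: "real^'n^'n \<Rightarrow> ennreal" where "J = (\<lambda>x. ennreal ((1 / det x) ^ (CARD('n) + 1)))"
  define \<delta> where "\<delta> = \<beta> - \<alpha>"
  have [measurable]: "I \<in> borel_measurable borel" "J \<in> borel_measurable borel"
    unfolding I_def J_def by measurable
  have I0: "I x = 0" if "x \<notin> posdef_mats" for x using that by (simp add: I_def)
  have I1: "I x = 1" if "x \<in> posdef_mats" for x using that by (simp add: I_def)
  \<comment> \<open>The integrand after the first two changes, in the variables a = x^-1 and s,
    together with its domain and the Jacobian of a.\<close>
  define k2 where "k2 = (\<lambda>a s. p (matrix_inv a, s - \<alpha> *\<^sub>R matrix_inv a) * I (s - \<alpha> *\<^sub>R matrix_inv a) * I s * (J a * I a))"
  have k2 [measurable]: "(\<lambda>z. k2 (f z) (g z)) \<in> borel_measurable N"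
    if [measurable]: "f \<in> borel_measurable N" "g \<in> borel_measurable N" for f g and N :: "'z measure"
    unfolding k2_def by measurable
  have imp_V: "mgig_V \<alpha> \<beta> (matrix_inv a) (s - \<alpha> *\<^sub>R matrix_inv a) = a + \<delta> *\<^sub>R matrix_inv s" if "a \<in> posdef_mats" for a s
    using that by (simp add: mgig_V_def \<delta>_def invertible_matrix_inv posdef_invertible)
  \<comment> \<open>Wherever the integrand is nonzero, the next variable is automatically positive
    definite. The indicator inserted here, and that in \<open>k2_U\<close>, let each translation be
    followed by a change of variables on the cone.\<close>
  have k2_V: "k2 a s = k2 a s * I (a + \<delta> *\<^sub>R matrix_inv s)" for a s
  proof (cases "a \<in> posdef_mats \<and> s - \<alpha> *\<^sub>R matrix_inv a \<in> posdef_mats")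
    case True
    then have "mgig_V \<alpha> \<beta> (matrix_inv a) (s - \<alpha> *\<^sub>R matrix_inv a) \<in> posdef_mats"
      by (intro mgig_V_posdef \<alpha> \<beta> posdef_matrix_inv) auto
    then show ?thesis using True by (simp add: imp_V I1)
  qed (auto simp: k2_def I0)
  have k2_U: "k2 a s = k2 a s * I (s - \<beta> *\<^sub>R matrix_inv (a + \<delta> *\<^sub>R matrix_inv s))" for a s
  proof (cases "a \<in> posdef_mats \<and> s - \<alpha> *\<^sub>R matrix_inv a \<in> posdef_mats")
    case True
    then have "matrix_inv (mgig_U \<alpha> \<beta> (matrix_inv a) (s - \<alpha> *\<^sub>R matrix_inv a)) \<in> posdef_mats"
      by (intro mgig_U_posdef \<alpha> \<beta> posdef_matrix_inv) auto
    moreover have "matrix_inv (mgig_U \<alpha> \<beta> (matrix_inv a) (s - \<alpha> *\<^sub>R matrix_inv a)) = s - \<beta> *\<^sub>R matrix_inv (a + \<delta> *\<^sub>R matrix_inv s)"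
      using matrix_inv_mgig_U[OF \<alpha> \<beta> posdef_matrix_inv, of a "s - \<alpha> *\<^sub>R matrix_inv a"] True by (simp add: imp_V)
    ultimately show ?thesis by (simp add: I1)
  qed (auto simp: k2_def I0)
  have "(\<integral>\<^sup>+x. \<integral>\<^sup>+y. p (x, y) * (I x * I y) \<partial>?L \<partial>?L) =
      (\<integral>\<^sup>+x. \<integral>\<^sup>+s. p (x, s - \<alpha> *\<^sub>R x) * I (s - \<alpha> *\<^sub>R x) * I s * I x \<partial>?L \<partial>?L)"
  proof (rule nn_integral_cong)
    fix x :: "real^'n^'n"
    show "(\<integral>\<^sup>+y. p (x, y) * (I x * I y) \<partial>?L) = (\<integral>\<^sup>+s. p (x, s - \<alpha> *\<^sub>R x) * I (s - \<alpha> *\<^sub>R x) * I s * I x \<partial>?L)"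
    proof (cases "x \<in> posdef_mats")
      case True
      have "(\<integral>\<^sup>+y. p (x, y) * (I x * I y) \<partial>?L) = (\<integral>\<^sup>+s. p (x, s + - \<alpha> *\<^sub>R x) * (I x * I (s + - \<alpha> *\<^sub>R x)) \<partial>?L)"
        by (rule nn_integral_lebesgue_sym_translate) (measurable, simp add: transpose_algebra posdef_sym True)
      also have "\<dots> = (\<integral>\<^sup>+s. p (x, s - \<alpha> *\<^sub>R x) * I (s - \<alpha> *\<^sub>R x) * I s * I x \<partial>?L)"
      proof (rule nn_integral_cong)
        fix s :: "real^'n^'n"
        have "s \<in> posdef_mats" if "s - \<alpha> *\<^sub>R x \<in> posdef_mats"
          using posdef_scaleR_add[OF True that \<alpha>] by simp
        then show "p (x, s + - \<alpha> *\<^sub>R x) * (I x * I (s + - \<alpha> *\<^sub>R x)) = p (x, s - \<alpha> *\<^sub>R x) * I (s - \<alpha> *\<^sub>R x) * I s * I x"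
          by (cases "s - \<alpha> *\<^sub>R x \<in> posdef_mats") (simp_all add: I0 I1 mult_ac)
      qed
      finally show ?thesis .
    qed (simp add: I0)
  qed
  also have "\<dots> = (\<integral>\<^sup>+s. \<integral>\<^sup>+x. p (x, s - \<alpha> *\<^sub>R x) * I (s - \<alpha> *\<^sub>R x) * I s * I x \<partial>?L \<partial>?L)"
    by (rule lsym_pair.Fubini'[symmetric]) measurable
  also have "\<dots> = (\<integral>\<^sup>+s. \<integral>\<^sup>+a. k2 a s \<partial>?L \<partial>?L)"
    unfolding k2_def I_def J_def
    by (intro nn_integral_cong nn_integral_lebesgue_sym_inverse[of "\<lambda>x. p (x, s - \<alpha> *\<^sub>R x) * indicator posdef_mats (s - \<alpha> *\<^sub>R x) * indicator posdef_mats s" for s]) measurable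
  also have "\<dots> = (\<integral>\<^sup>+s. \<integral>\<^sup>+v. k2 (v - \<delta> *\<^sub>R matrix_inv s) s * I v \<partial>?L \<partial>?L)"
  proof (rule nn_integral_cong)
    fix s :: "real^'n^'n"
    show "(\<integral>\<^sup>+a. k2 a s \<partial>?L) = (\<integral>\<^sup>+v. k2 (v - \<delta> *\<^sub>R matrix_inv s) s * I v \<partial>?L)"
    proof (cases "s \<in> posdef_mats")
      case True
      have "(\<integral>\<^sup>+a. k2 a s \<partial>?L) = (\<integral>\<^sup>+v. k2 (v + - \<delta> *\<^sub>R matrix_inv s) s \<partial>?L)"
        by (rule nn_integral_lebesgue_sym_translate) (measurable, simp add: transpose_algebra posdef_sym posdef_matrix_inv True)
      also have "\<dots> = (\<integral>\<^sup>+v. k2 (v - \<delta> *\<^sub>R matrix_inv s) s * I v \<partial>?L)"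
      proof (rule nn_integral_cong)
        fix v show "k2 (v + - \<delta> *\<^sub>R matrix_inv s) s = k2 (v - \<delta> *\<^sub>R matrix_inv s) s * I v"
          using k2_V[of "v - \<delta> *\<^sub>R matrix_inv s" s] by simp
      qed
      finally show ?thesis .
    qed (simp add: k2_def I0)
  qed
  also have "\<dots> = (\<integral>\<^sup>+v. \<integral>\<^sup>+s. k2 (v - \<delta> *\<^sub>R matrix_inv s) s * I v \<partial>?L \<partial>?L)"
    by (rule lsym_pair.Fubini') measurable
  also have "\<dots> = (\<integral>\<^sup>+v. \<integral>\<^sup>+w. k2 (v - \<delta> *\<^sub>R matrix_inv (w + \<beta> *\<^sub>R matrix_inv v)) (w + \<beta> *\<^sub>R matrix_inv v) * I v * I w \<partial>?L \<partial>?L)"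
  proof (rule nn_integral_cong)
    fix v :: "real^'n^'n"
    show "(\<integral>\<^sup>+s. k2 (v - \<delta> *\<^sub>R matrix_inv s) s * I v \<partial>?L) =
      (\<integral>\<^sup>+w. k2 (v - \<delta> *\<^sub>R matrix_inv (w + \<beta> *\<^sub>R matrix_inv v)) (w + \<beta> *\<^sub>R matrix_inv v) * I v * I w \<partial>?L)"
    proof (cases "v \<in> posdef_mats")
      case True
      have "(\<integral>\<^sup>+s. k2 (v - \<delta> *\<^sub>R matrix_inv s) s * I v \<partial>?L) =
          (\<integral>\<^sup>+w. k2 (v - \<delta> *\<^sub>R matrix_inv (w + \<beta> *\<^sub>R matrix_inv v)) (w + \<beta> *\<^sub>R matrix_inv v) * I v \<partial>?L)"
        by (rule nn_integral_lebesgue_sym_translate) (measurable, simp add: transpose_algebra posdef_sym posdef_matrix_inv True)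
      also have "\<dots> = (\<integral>\<^sup>+w. k2 (v - \<delta> *\<^sub>R matrix_inv (w + \<beta> *\<^sub>R matrix_inv v)) (w + \<beta> *\<^sub>R matrix_inv v) * I v * I w \<partial>?L)"
      proof (rule nn_integral_cong)
        fix w
        show "k2 (v - \<delta> *\<^sub>R matrix_inv (w + \<beta> *\<^sub>R matrix_inv v)) (w + \<beta> *\<^sub>R matrix_inv v) * I v =
          k2 (v - \<delta> *\<^sub>R matrix_inv (w + \<beta> *\<^sub>R matrix_inv v)) (w + \<beta> *\<^sub>R matrix_inv v) * I v * I w"
          using k2_U[of "v - \<delta> *\<^sub>R matrix_inv (w + \<beta> *\<^sub>R matrix_inv v)" "w + \<beta> *\<^sub>R matrix_inv v"]
          by (simp add: mult.assoc mult.commute[of "I v"])  (simp add: mult.assoc[symmetric])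
      qed
      finally show ?thesis .
    qed (simp add: I0)
  qed
  also have "\<dots> = (\<integral>\<^sup>+v. \<integral>\<^sup>+u. k2 (v - \<delta> *\<^sub>R matrix_inv (matrix_inv u + \<beta> *\<^sub>R matrix_inv v)) (matrix_inv u + \<beta> *\<^sub>R matrix_inv v) * I v * (J u * I u) \<partial>?L \<partial>?L)"
  proof (rule nn_integral_cong)
    fix v :: "real^'n^'n"
    show "(\<integral>\<^sup>+w. k2 (v - \<delta> *\<^sub>R matrix_inv (w + \<beta> *\<^sub>R matrix_inv v)) (w + \<beta> *\<^sub>R matrix_inv v) * I v * I w \<partial>?L) =
      (\<integral>\<^sup>+u. k2 (v - \<delta> *\<^sub>R matrix_inv (matrix_inv u + \<beta> *\<^sub>R matrix_inv v)) (matrix_inv u + \<beta> *\<^sub>R matrix_inv v) * I v * (J u * I u) \<partial>?L)"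
      unfolding I_def J_def
      by (rule nn_integral_lebesgue_sym_inverse[of "\<lambda>w. k2 (v - \<delta> *\<^sub>R matrix_inv (w + \<beta> *\<^sub>R matrix_inv v)) (w + \<beta> *\<^sub>R matrix_inv v) * indicator posdef_mats v"]) measurable
  qed
  also have "\<dots> = (\<integral>\<^sup>+v. \<integral>\<^sup>+u. p (mgig_U \<alpha> \<beta> u v, mgig_V \<alpha> \<beta> u v) * ennreal ((det (mgig_U \<alpha> \<beta> u v) / det u) ^ (CARD('n) + 1))
       * (I u * I v) \<partial>?L \<partial>?L)"
  proof (intro nn_integral_cong)
    fix u v :: "real^'n^'n"
    show "k2 (v - \<delta> *\<^sub>R matrix_inv (matrix_inv u + \<beta> *\<^sub>R matrix_inv v)) (matrix_inv u + \<beta> *\<^sub>R matrix_inv v) * I v * (J u * I u) =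
      p (mgig_U \<alpha> \<beta> u v, mgig_V \<alpha> \<beta> u v) * ennreal ((det (mgig_U \<alpha> \<beta> u v) / det u) ^ (CARD('n) + 1)) * (I u * I v)"
    proof (cases "u \<in> posdef_mats \<and> v \<in> posdef_mats")
      case True
      then have u: "u \<in> posdef_mats" and v: "v \<in> posdef_mats" by auto
      define x where "x = mgig_U \<alpha> \<beta> u v"
      define y where "y = mgig_V \<alpha> \<beta> u v"
      have x: "x \<in> posdef_mats" and y: "y \<in> posdef_mats"
        unfolding x_def y_def by (intro mgig_U_posdef mgig_V_posdef \<alpha> \<beta> u v)+
      have s: "matrix_inv u + \<beta> *\<^sub>R matrix_inv v = \<alpha> *\<^sub>R x + y"
        unfolding x_def y_def by (rule mgig_sum_eq[OF \<alpha> \<beta> u v, symmetric])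
      have "mgig_V \<alpha> \<beta> x y = v"
        unfolding x_def y_def by (rule mgig_V_involution[OF \<alpha> \<beta> u v])
      then have a: "v - \<delta> *\<^sub>R matrix_inv (matrix_inv u + \<beta> *\<^sub>R matrix_inv v) = matrix_inv x"
        unfolding s \<delta>_def by (simp add: mgig_V_def) (simp add: algebra_simps)
      have sp: "\<alpha> *\<^sub>R x + y \<in> posdef_mats" by (intro posdef_scaleR_add \<alpha> x y)
      have "k2 (matrix_inv x) (\<alpha> *\<^sub>R x + y) = p (x, y) * J (matrix_inv x)"
        unfolding k2_def using x y sp by (simp add: invertible_matrix_inv posdef_invertible posdef_matrix_inv I1)
      moreover have "J (matrix_inv x) * J u = ennreal ((det x / det u) ^ (CARD('n) + 1))"
        unfolding J_def using det_posdef[OF x] det_posdef[OF u]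
        by (simp add: det_matrix_inv[OF posdef_invertible[OF x]] ennreal_mult[symmetric] power_divide power_one_over field_simps)
      ultimately show ?thesis
        unfolding a unfolding s using u v by (simp add: I1 x_def[symmetric] y_def[symmetric] mult.assoc)
    qed (auto simp: I0)
  qed
  also have "\<dots> = (\<integral>\<^sup>+u. \<integral>\<^sup>+v. p (mgig_U \<alpha> \<beta> u v, mgig_V \<alpha> \<beta> u v) * ennreal ((det (mgig_U \<alpha> \<beta> u v) / det u) ^ (CARD('n) + 1))
       * (I u * I v) \<partial>?L \<partial>?L)"
    by (rule lsym_pair.Fubini') (use borel_measurable_mgig_U borel_measurable_mgig_V in \<open>measurable\<close>)
  finally show ?thesis unfolding I_def .
qed

subsection \<open>The joint density\<close>

text \<open>The marginal densities are partial integrals of H. Their product is a second density of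
  the product measure, and densities are unique almost everywhere.\<close>

lemma product_density:
  fixes H :: "(real^'n::finite^'n) \<times> (real^'n^'n) \<Rightarrow> ennreal"
  assumes H [measurable]: "H \<in> borel_measurable (borel \<Otimes>\<^sub>M borel)"
    and A: "prob_space A" and B: "prob_space B"
    and sA [measurable_cong]: "sets A = sets borel" and sB [measurable_cong]: "sets B = sets borel"
    and eq: "A \<Otimes>\<^sub>M B = density (lebesgue_sym \<Otimes>\<^sub>M lebesgue_sym) H"
  defines "p \<equiv> \<lambda>u. \<integral>\<^sup>+v. H (u, v) \<partial>lebesgue_sym" and "q \<equiv> \<lambda>v. \<integral>\<^sup>+u. H (u, v) \<partial>lebesgue_sym"
  shows "A = density lebesgue_sym p" "B = density lebesgue_sym q"
    "AE z in lebesgue_sym \<Otimes>\<^sub>M lebesgue_sym. H z = p (fst z) * q (snd z)"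
proof -
  interpret A: prob_space A by (rule A)
  interpret B: prob_space B by (rule B)
  have spA: "space A = UNIV" and spB: "space B = UNIV"
    using sets_eq_imp_space_eq[OF sA] sets_eq_imp_space_eq[OF sB] by auto
  have HL [measurable]: "H \<in> borel_measurable (lebesgue_sym \<Otimes>\<^sub>M lebesgue_sym)" by measurable
  have pm [measurable]: "p \<in> borel_measurable borel" unfolding p_def by measurable
  have qm [measurable]: "q \<in> borel_measurable borel" unfolding q_def by measurable
  show 1: "A = density lebesgue_sym p"
  proof (rule measure_eqI)
    fix S assume "S \<in> sets A"
    then have S [measurable]: "S \<in> sets borel" by (simp add: sA)
    have "emeasure A S = emeasure (A \<Otimes>\<^sub>M B) (S \<times> UNIV)"
      using B.emeasure_pair_measure_Times[of S A UNIV] B.emeasure_space_1 spB sB by (simp add: sA)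
    also have "\<dots> = (\<integral>\<^sup>+z. H z * indicator (S \<times> UNIV) z \<partial>(lebesgue_sym \<Otimes>\<^sub>M lebesgue_sym))"
      unfolding eq by (rule emeasure_density) measurable
    also have "\<dots> = (\<integral>\<^sup>+u. \<integral>\<^sup>+v. H (u, v) * indicator (S \<times> UNIV) (u, v) \<partial>lebesgue_sym \<partial>lebesgue_sym)"
      by (rule lsym.nn_integral_fst[symmetric]) measurable
    also have "\<dots> = (\<integral>\<^sup>+u. p u * indicator S u \<partial>lebesgue_sym)"
      unfolding p_def by (intro nn_integral_cong) (auto simp: indicator_def)
    also have "\<dots> = emeasure (density lebesgue_sym p) S"
      by (rule emeasure_density[symmetric]) measurable
    finally show "emeasure A S = emeasure (density lebesgue_sym p) S" .
  qed (simp add: sA)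
  show 2: "B = density lebesgue_sym q"
  proof (rule measure_eqI)
    fix S assume "S \<in> sets B"
    then have S [measurable]: "S \<in> sets borel" by (simp add: sB)
    have "emeasure B S = emeasure (A \<Otimes>\<^sub>M B) (UNIV \<times> S)"
      using B.emeasure_pair_measure_Times[of UNIV A S] A.emeasure_space_1 spA sA by (simp add: sB)
    also have "\<dots> = (\<integral>\<^sup>+z. H z * indicator (UNIV \<times> S) z \<partial>(lebesgue_sym \<Otimes>\<^sub>M lebesgue_sym))"
      unfolding eq by (rule emeasure_density) measurable
    also have "\<dots> = (\<integral>\<^sup>+v. \<integral>\<^sup>+u. H (u, v) * indicator (UNIV \<times> S) (u, v) \<partial>lebesgue_sym \<partial>lebesgue_sym)"
      by (rule lsym_pair.nn_integral_snd[symmetric]) measurable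
    also have "\<dots> = (\<integral>\<^sup>+v. q v * indicator S v \<partial>lebesgue_sym)"
      unfolding q_def by (intro nn_integral_cong) (auto simp: indicator_def)
    also have "\<dots> = emeasure (density lebesgue_sym q) S"
      by (rule emeasure_density[symmetric]) measurable
    finally show "emeasure B S = emeasure (density lebesgue_sym q) S" .
  qed (simp add: sB)
  have "density (lebesgue_sym \<Otimes>\<^sub>M lebesgue_sym) H = density lebesgue_sym p \<Otimes>\<^sub>M density lebesgue_sym q"
    using eq 1 2 by simp
  also have "\<dots> = density (lebesgue_sym \<Otimes>\<^sub>M lebesgue_sym) (\<lambda>(u, v). p u * q v)"
  proof (rule pair_measure_density)
    show "sigma_finite_measure (density lebesgue_sym q)"
      using B.sigma_finite_measure_axioms unfolding 2[symmetric] .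
  qed (measurable, rule sigma_finite_lebesgue_sym)
  finally have "AE z in lebesgue_sym \<Otimes>\<^sub>M lebesgue_sym. H z = (case z of (u, v) \<Rightarrow> p u * q v)"
    by (intro sigma_finite_measure.density_unique[OF sigma_finite_pair_measure[OF sigma_finite_lebesgue_sym sigma_finite_lebesgue_sym]]) measurable
  then show "AE z in lebesgue_sym \<Otimes>\<^sub>M lebesgue_sym. H z = p (fst z) * q (snd z)"
    by (simp add: split_def)
qed

text \<open>The probability of a set S is the integral of the joint density of (X, Y) over its
  preimage. After the substitution the involution turns the indicator of the preimage back into that
  of S.\<close>

lemma distr_joint_mgig:
  fixes X Y :: "'s \<Rightarrow> real^'n::finite^'n" and fX fY :: "real^'n^'n \<Rightarrow> real"
  assumes M: "prob_space M" and \<alpha>: "\<alpha> \<ge> 0" and \<beta>: "\<beta> \<ge> 0"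
    and X: "\<forall>\<omega>\<in>space M. X \<omega> \<in> posdef_mats" and Y: "\<forall>\<omega>\<in>space M. Y \<omega> \<in> posdef_mats"
    and dX: "distributed M lebesgue_sym X (\<lambda>x. ennreal (fX x))"
    and dY: "distributed M lebesgue_sym Y (\<lambda>x. ennreal (fY x))"
    and indep: "prob_space.indep_var M borel X borel Y"
  shows "distr M (borel \<Otimes>\<^sub>M borel) (\<lambda>\<omega>. (mgig_U \<alpha> \<beta> (X \<omega>) (Y \<omega>), mgig_V \<alpha> \<beta> (X \<omega>) (Y \<omega>))) =
    density (lebesgue_sym \<Otimes>\<^sub>M lebesgue_sym) (\<lambda>(u, v). ennreal (fX (mgig_U \<alpha> \<beta> u v)) * ennreal (fY (mgig_V \<alpha> \<beta> u v)) *
      ennreal ((det (mgig_U \<alpha> \<beta> u v) / det u) ^ (CARD('n) + 1)) * (indicator posdef_mats u * indicator posdef_mats v))"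
    (is "_ = density _ ?H")
proof -
  interpret prob_space M by (rule M)
  let ?L = "lebesgue_sym :: (real^'n^'n) measure"
  note [measurable] = distributed_measurable[OF dX, unfolded measurable_cong_sets[OF refl sets_lebesgue_sym]]
    distributed_measurable[OF dY, unfolded measurable_cong_sets[OF refl sets_lebesgue_sym]]
  have fm [measurable]: "(\<lambda>x. ennreal (fX x)) \<in> borel_measurable borel" "(\<lambda>x. ennreal (fY x)) \<in> borel_measurable borel"
    using distributed_borel_measurable[OF dX] distributed_borel_measurable[OF dY] by simp_all
  have DX: "distr M borel X = density ?L fX"
    using distributed_distr_eq_density[OF dX] distr_cong[of M M borel ?L X X] by simp
  have DY: "distr M borel Y = density ?L fY"
    using distributed_distr_eq_density[OF dY] distr_cong[of M M borel ?L Y Y] by simp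
  have sf: "sigma_finite_measure (density ?L fY)"
    unfolding DY[symmetric] using prob_space_imp_sigma_finite[OF prob_space_distr[of Y borel]] by simp
  have joint: "distr M (borel \<Otimes>\<^sub>M borel) (\<lambda>\<omega>. (X \<omega>, Y \<omega>)) = density (?L \<Otimes>\<^sub>M ?L) (\<lambda>(x, y). ennreal (fX x) * ennreal (fY y))"
    using indep_var_distribution_eq[THEN iffD1, OF indep] unfolding DX DY
    by (subst pair_measure_density[symmetric]) (auto intro: sf sigma_finite_lebesgue_sym)
  have mU [measurable]: "(\<lambda>z. mgig_U \<alpha> \<beta> (fst z) (snd z) :: real^'n^'n) \<in> borel_measurable (borel \<Otimes>\<^sub>M borel)"
    and mV [measurable]: "(\<lambda>z. mgig_V \<alpha> \<beta> (fst z) (snd z) :: real^'n^'n) \<in> borel_measurable (borel \<Otimes>\<^sub>M borel)"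
    by measurable
  have mUXY [measurable]: "(\<lambda>\<omega>. mgig_U \<alpha> \<beta> (X \<omega>) (Y \<omega>)) \<in> borel_measurable M"
    using measurable_compose[of "\<lambda>\<omega>. (X \<omega>, Y \<omega>)" M "borel \<Otimes>\<^sub>M borel", OF _ mU] by simp
  have mVXY [measurable]: "(\<lambda>\<omega>. mgig_V \<alpha> \<beta> (X \<omega>) (Y \<omega>)) \<in> borel_measurable M"
    using measurable_compose[of "\<lambda>\<omega>. (X \<omega>, Y \<omega>)" M "borel \<Otimes>\<^sub>M borel", OF _ mV] by simp
  have mH [measurable]: "?H \<in> borel_measurable (borel \<Otimes>\<^sub>M borel)"
    unfolding split_def by measurable
  show ?thesis
  proof (rule measure_eqI)
    fix S assume "S \<in> sets (distr M (borel \<Otimes>\<^sub>M borel) (\<lambda>\<omega>. (mgig_U \<alpha> \<beta> (X \<omega>) (Y \<omega>), mgig_V \<alpha> \<beta> (X \<omega>) (Y \<omega>))))"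
    then have S [measurable]: "S \<in> sets (borel \<Otimes>\<^sub>M borel)" by simp
    define I :: "real^'n^'n \<Rightarrow> ennreal" where "I = indicator posdef_mats"
    have Im [measurable]: "I \<in> borel_measurable borel" unfolding I_def by measurable
    define h :: "(real^'n^'n) \<times> (real^'n^'n) \<Rightarrow> ennreal" where "h = (\<lambda>z. indicator S (mgig_U \<alpha> \<beta> (fst z) (snd z), mgig_V \<alpha> \<beta> (fst z) (snd z)))"
    have hm [measurable]: "h \<in> borel_measurable (borel \<Otimes>\<^sub>M borel)" unfolding h_def by measurable
    have "emeasure (distr M (borel \<Otimes>\<^sub>M borel) (\<lambda>\<omega>. (mgig_U \<alpha> \<beta> (X \<omega>) (Y \<omega>), mgig_V \<alpha> \<beta> (X \<omega>) (Y \<omega>)))) S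
        = (\<integral>\<^sup>+z. indicator S z \<partial>distr M (borel \<Otimes>\<^sub>M borel) (\<lambda>\<omega>. (mgig_U \<alpha> \<beta> (X \<omega>) (Y \<omega>), mgig_V \<alpha> \<beta> (X \<omega>) (Y \<omega>))))"
      by (rule nn_integral_indicator[symmetric]) simp
    also have "\<dots> = (\<integral>\<^sup>+\<omega>. indicator S (mgig_U \<alpha> \<beta> (X \<omega>) (Y \<omega>), mgig_V \<alpha> \<beta> (X \<omega>) (Y \<omega>)) \<partial>M)"
      by (rule nn_integral_distr) measurable
    also have "\<dots> = (\<integral>\<^sup>+\<omega>. h (X \<omega>, Y \<omega>) * (I (X \<omega>) * I (Y \<omega>)) \<partial>M)"
      using X Y by (intro nn_integral_cong) (simp add: h_def I_def)
    also have "\<dots> = (\<integral>\<^sup>+z. h z * (I (fst z) * I (snd z)) \<partial>distr M (borel \<Otimes>\<^sub>M borel) (\<lambda>\<omega>. (X \<omega>, Y \<omega>)))"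
    proof -
      have "(\<lambda>\<omega>. (X \<omega>, Y \<omega>)) \<in> measurable M (borel \<Otimes>\<^sub>M borel)" by measurable
      moreover have "(\<lambda>z. h z * (I (fst z) * I (snd z))) \<in> borel_measurable (borel \<Otimes>\<^sub>M borel)" by measurable
      ultimately show ?thesis by (simp add: nn_integral_distr)
    qed
    also have "\<dots> = (\<integral>\<^sup>+z. (case z of (x, y) \<Rightarrow> ennreal (fX x) * ennreal (fY y)) * (h z * (I (fst z) * I (snd z))) \<partial>(?L \<Otimes>\<^sub>M ?L))"
      unfolding joint by (rule nn_integral_density) measurable
    also have "\<dots> = (\<integral>\<^sup>+x. \<integral>\<^sup>+y. (h (x, y) * ennreal (fX x) * ennreal (fY y)) * (I x * I y) \<partial>?L \<partial>?L)"
    proof -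
      have "(\<lambda>z. (case z of (x, y) \<Rightarrow> ennreal (fX x) * ennreal (fY y)) * (h z * (I (fst z) * I (snd z)))) \<in> borel_measurable (?L \<Otimes>\<^sub>M ?L)"
        by measurable
      from lsym.nn_integral_fst[OF this, symmetric] show ?thesis
        by (simp add: mult_ac)
    qed
    also have "\<dots> = (\<integral>\<^sup>+u. \<integral>\<^sup>+v. (h (mgig_U \<alpha> \<beta> u v, mgig_V \<alpha> \<beta> u v) * ennreal (fX (mgig_U \<alpha> \<beta> u v)) * ennreal (fY (mgig_V \<alpha> \<beta> u v)))
         * ennreal ((det (mgig_U \<alpha> \<beta> u v) / det u) ^ (CARD('n) + 1)) * (I u * I v) \<partial>?L \<partial>?L)"
      unfolding I_def
      using nn_integral_mgig_substitution[OF \<alpha> \<beta>, of "\<lambda>z. h z * ennreal (fX (fst z)) * ennreal (fY (snd z))"] by simp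
    also have "\<dots> = (\<integral>\<^sup>+u. \<integral>\<^sup>+v. ?H (u, v) * indicator S (u, v) \<partial>?L \<partial>?L)"
    proof (intro nn_integral_cong)
      fix u v :: "real^'n^'n"
      show "(h (mgig_U \<alpha> \<beta> u v, mgig_V \<alpha> \<beta> u v) * ennreal (fX (mgig_U \<alpha> \<beta> u v)) * ennreal (fY (mgig_V \<alpha> \<beta> u v)))
         * ennreal ((det (mgig_U \<alpha> \<beta> u v) / det u) ^ (CARD('n) + 1)) * (I u * I v) = ?H (u, v) * indicator S (u, v)"
        by (cases "u \<in> posdef_mats \<and> v \<in> posdef_mats")
          (auto simp: h_def I_def mgig_U_involution[OF \<alpha> \<beta>] mgig_V_involution[OF \<alpha> \<beta>] mult_ac)
    qed
    also have "\<dots> = (\<integral>\<^sup>+z. ?H z * indicator S z \<partial>(?L \<Otimes>\<^sub>M ?L))"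
      by (rule lsym.nn_integral_fst) measurable
    also have "\<dots> = emeasure (density (?L \<Otimes>\<^sub>M ?L) ?H) S"
      by (rule emeasure_density[symmetric]) measurable
    finally show "emeasure (distr M (borel \<Otimes>\<^sub>M borel) (\<lambda>\<omega>. (mgig_U \<alpha> \<beta> (X \<omega>) (Y \<omega>), mgig_V \<alpha> \<beta> (X \<omega>) (Y \<omega>)))) S
      = emeasure (density (?L \<Otimes>\<^sub>M ?L) ?H) S" .
  qed (simp add: sets_pair_measure_cong[OF sets_lebesgue_sym sets_lebesgue_sym])
qed

text \<open>The cross ratio removes the factors p and q, which are known only almost everywhere.
  What remains is continuous in each variable separately, so exceptional sets are removed one
  variable at a time: v', v, u', u.\<close>

lemma product_form_everywhere:
  fixes h :: "real^'n::finite^'n \<Rightarrow> real^'n^'n \<Rightarrow> real" and p q :: "real^'n^'n \<Rightarrow> ennreal"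
  assumes ae: "AE u in lebesgue_sym. AE v in lebesgue_sym. u \<in> posdef_mats \<longrightarrow> v \<in> posdef_mats \<longrightarrow> ennreal (h u v) = p u * q v"
    and pos: "\<And>u v. u \<in> posdef_mats \<Longrightarrow> v \<in> posdef_mats \<Longrightarrow> h u v > 0"
    and c1: "\<And>v. v \<in> posdef_mats \<Longrightarrow> continuous_on posdef_mats (\<lambda>u. h u v)"
    and c2: "\<And>u. u \<in> posdef_mats \<Longrightarrow> continuous_on posdef_mats (\<lambda>v. h u v)"
    and u: "u \<in> posdef_mats" and u': "u' \<in> posdef_mats" and v: "v \<in> posdef_mats" and v': "v' \<in> posdef_mats"
  shows "h u v * h u' v' = h u v' * h u' v"
proof -
  define G where "G = (\<lambda>u. AE v in lebesgue_sym. v \<in> posdef_mats \<longrightarrow> ennreal (h u v) = p u * q v)"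
  have G: "AE u in lebesgue_sym. u \<in> posdef_mats \<longrightarrow> G u"
    using ae
  proof eventually_elim
    case (elim u)
    show ?case
    proof
      assume "u \<in> posdef_mats"
      with elim show "G u" unfolding G_def by auto
    qed
  qed
  have key: "h u v * h u' v' = h u v' * h u' v"
    if u: "u \<in> posdef_mats" "G u" and u': "u' \<in> posdef_mats" "G u'" and v: "v \<in> posdef_mats" and v': "v' \<in> posdef_mats"
    for u u' v v'
  proof -
    have one: "h u v * h u' v' = h u v' * h u' v"
      if v: "v \<in> posdef_mats" "ennreal (h u v) = p u * q v" "ennreal (h u' v) = p u' * q v" and v': "v' \<in> posdef_mats" for v v'
    proof (rule AE_lebesgue_sym_posdef_eq[OF _ _ _ v', of "\<lambda>v'. h u v * h u' v'" "\<lambda>v'. h u v' * h u' v"])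
      show "AE v' in lebesgue_sym. v' \<in> posdef_mats \<longrightarrow> h u v * h u' v' = h u v' * h u' v"
        using u(2)[unfolded G_def] u'(2)[unfolded G_def]
      proof eventually_elim
        case (elim w)
        show ?case
        proof
          assume w: "w \<in> posdef_mats"
          have "ennreal (h u v * h u' w) = ennreal (h u v) * ennreal (h u' w)"
            using pos u u' v w by (simp add: ennreal_mult less_imp_le)
          also have "\<dots> = ennreal (h u w) * ennreal (h u' v)"
            using elim w v by (simp add: mult_ac)
          also have "\<dots> = ennreal (h u w * h u' v)"
            using pos u u' v w by (simp add: ennreal_mult less_imp_le)
          finally show "h u v * h u' w = h u w * h u' v"
            using pos u u' v w by (subst (asm) ennreal_inj) (auto simp: less_imp_le)
        qed
      qed
    qed (intro continuous_intros c2 u u')+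
    show ?thesis
    proof (rule AE_lebesgue_sym_posdef_eq[OF _ _ _ v, of "\<lambda>v. h u v * h u' v'" "\<lambda>v. h u v' * h u' v"])
      show "AE v in lebesgue_sym. v \<in> posdef_mats \<longrightarrow> h u v * h u' v' = h u v' * h u' v"
        using u(2)[unfolded G_def] u'(2)[unfolded G_def]
        by eventually_elim (use one v' in auto)
    qed (intro continuous_intros c2 u u')+
  qed
  have key2: "h u v * h u' v' = h u v' * h u' v" if u: "u \<in> posdef_mats" "G u" and u': "u' \<in> posdef_mats" for u u'
  proof (rule AE_lebesgue_sym_posdef_eq[OF _ _ _ u', of "\<lambda>u'. h u v * h u' v'" "\<lambda>u'. h u v' * h u' v"])
    show "AE u' in lebesgue_sym. u' \<in> posdef_mats \<longrightarrow> h u v * h u' v' = h u v' * h u' v"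
      using G by eventually_elim (use key[OF u _ _ v v'] in auto)
  qed (intro continuous_intros c1 v v')+
  show ?thesis
  proof (rule AE_lebesgue_sym_posdef_eq[OF _ _ _ u, of "\<lambda>u. h u v * h u' v'" "\<lambda>u. h u v' * h u' v"])
    show "AE u in lebesgue_sym. u \<in> posdef_mats \<longrightarrow> h u v * h u' v' = h u v' * h u' v"
      using G by eventually_elim (use key2[OF _ _ u'] in auto)
  qed (intro continuous_intros c1 v v')+
qed

subsection \<open>Kernels of matrix GIG laws\<close>

lemma mgig_kernel_exp:
  fixes x :: "real^'n::finite^'n"
  assumes "x \<in> posdef_mats"
  shows "mgig_kernel lam a b x =
    exp ((lam - (real CARD('n) + 1) / 2) * ln (det x) - trace (a ** x) - trace (b ** matrix_inv x))"
  using assms det_posdef[OF assms]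
  by (simp add: mgig_kernel_def powr_def exp_add[symmetric])

lemma mgig_kernel_nonneg: "mgig_kernel lam a b x \<ge> 0"
  by (simp add: mgig_kernel_def)

lemma borel_measurable_trace [measurable]: "trace \<in> borel_measurable (borel :: (real^'n::finite^'n) measure)"
  by (intro borel_measurable_continuous_onI linear_continuous_on bounded_linear_trace)

lemma borel_measurable_matrix_mult_left [measurable]:
  "(\<lambda>x. a ** x) \<in> borel_measurable (borel :: (real^'n::finite^'n) measure)"
  by (intro borel_measurable_continuous_onI linear_continuous_on matrix_mult.bounded_linear_right)

lemma borel_measurable_mgig_kernel [measurable]:
  "mgig_kernel lam a b \<in> borel_measurable (borel :: (real^'n::finite^'n) measure)"
proof -
  have [measurable]: "(\<lambda>x. b ** matrix_inv x) \<in> borel_measurable (borel :: (real^'n::finite^'n) measure)"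
    using measurable_compose[OF borel_measurable_matrix_inv borel_measurable_matrix_mult_left] .
  show ?thesis unfolding mgig_kernel_def[abs_def] by measurable
qed

text \<open>Total mass one forces c to be the reciprocal of the normalising integral. The constant
  is an \<open>ennreal\<close> because for U and V it contains an integral; finiteness of the kernel
  integral is a conclusion, used later for a and b.\<close>

lemma MGIG_eqI:
  fixes a b :: "real^'n::finite^'n"
  assumes A: "A = density lebesgue_sym (\<lambda>x. c * ennreal (mgig_kernel lam a b x))" and P: "prob_space A"
  shows "A = MGIG lam a b" "(\<integral>\<^sup>+x. ennreal (mgig_kernel lam a b x) \<partial>lebesgue_sym) < \<infinity>"
proof -
  let ?Z = "\<integral>\<^sup>+x. ennreal (mgig_kernel lam a b x) \<partial>lebesgue_sym"
  have "1 = emeasure A (space A)" using prob_space.emeasure_space_1[OF P] by simp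
  also have "\<dots> = (\<integral>\<^sup>+x. c * ennreal (mgig_kernel lam a b x) \<partial>lebesgue_sym)"
    unfolding A by (simp add: emeasure_density)
  also have "\<dots> = c * ?Z"
    by (rule nn_integral_cmult) measurable
  finally have cZ: "c * ?Z = 1" by simp
  then have Z: "?Z \<noteq> 0" "?Z \<noteq> \<infinity>"
    by (auto simp: ennreal_mult_eq_top_iff ennreal_mult_top split: if_splits)
  then show "?Z < \<infinity>" by (simp add: less_top)
  have "ennreal k / ?Z = c * ennreal k" for k
  proof -
    have "(c * ennreal k) * ?Z = (c * ?Z) * ennreal k" by (simp only: mult_ac)
    then have "ennreal k / ?Z = (c * ennreal k) * ?Z / ?Z"
      unfolding cZ by simp
    also have "\<dots> = c * ennreal k"
      using Z by (intro ennreal_mult_divide_eq) auto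
    finally show ?thesis .
  qed
  then show "A = MGIG lam a b" unfolding A MGIG_def by simp
qed

text \<open>The Jacobian exponent r+1 is twice the shift (r+1)/2 in the kernel, so inversion keeps
  the shape of the kernel. This carries results about a over to b.\<close>

lemma nn_integral_mgig_kernel_inverse:
  fixes a b :: "real^'n::finite^'n"
  shows "(\<integral>\<^sup>+x. ennreal (mgig_kernel lam a b x) \<partial>lebesgue_sym) = (\<integral>\<^sup>+x. ennreal (mgig_kernel (- lam) b a x) \<partial>lebesgue_sym)"
proof -
  have "(\<integral>\<^sup>+x. ennreal (mgig_kernel lam a b x) \<partial>lebesgue_sym) = (\<integral>\<^sup>+x. ennreal (mgig_kernel lam a b x) * indicator posdef_mats x \<partial>lebesgue_sym)"
    by (intro nn_integral_cong) (auto simp: mgig_kernel_def indicator_def)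
  also have "\<dots> = (\<integral>\<^sup>+x. ennreal (mgig_kernel lam a b (matrix_inv x)) * (ennreal ((1 / det x) ^ (CARD('n) + 1)) * indicator posdef_mats x) \<partial>lebesgue_sym)"
    by (rule nn_integral_lebesgue_sym_inverse) measurable
  also have "\<dots> = (\<integral>\<^sup>+x. ennreal (mgig_kernel (- lam) b a x) \<partial>lebesgue_sym)"
  proof (rule nn_integral_cong)
    fix x :: "real^'n^'n"
    show "ennreal (mgig_kernel lam a b (matrix_inv x)) * (ennreal ((1 / det x) ^ (CARD('n) + 1)) * indicator posdef_mats x) = ennreal (mgig_kernel (- lam) b a x)"
    proof (cases "x \<in> posdef_mats")
      case True
      have d: "det x > 0" by (rule det_posdef[OF True])
      have "(1 / det x) ^ (CARD('n) + 1) = exp (- (real CARD('n) + 1) * ln (det x))"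
      proof -
        have "exp (- (real CARD('n) + 1) * ln (det x)) = exp (real (CARD('n) + 1) * ln (1 / det x))"
          using d by (simp add: ln_div algebra_simps)
        also have "\<dots> = (1 / det x) ^ (CARD('n) + 1)"
          using d by (subst exp_of_nat_mult) (simp add: ln_div exp_minus inverse_eq_divide)
        finally show ?thesis ..
      qed
      then have "mgig_kernel lam a b (matrix_inv x) * (1 / det x) ^ (CARD('n) + 1) = mgig_kernel (- lam) b a x"
        unfolding mgig_kernel_exp[OF True] mgig_kernel_exp[OF posdef_matrix_inv[OF True]]
        by (simp only: exp_add[symmetric] det_matrix_inv_posdef[OF True] invertible_matrix_inv(2)[OF posdef_invertible[OF True]])
          (simp add: field_simps)
      then show ?thesis
        using True d by (simp add: mgig_kernel_nonneg ennreal_mult[symmetric])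
    qed (simp add: mgig_kernel_def)
  qed
  finally show ?thesis .
qed

text \<open>A minimiser w of the quadratic form on the unit sphere is an eigenvector: the form minus
  \<mu> is nonnegative and vanishes at w, so its first-order variation in the direction d = a w -
  \<mu> w is zero.\<close>

lemma eigenvector_nonpos:
  fixes a :: "real^'n::finite^'n"
  assumes a: "transpose a = a" and "a \<notin> posdef_mats"
  obtains v \<mu> where "norm v = 1" "a *v v = \<mu> *\<^sub>R v" "\<mu> \<le> 0"
proof -
  have "continuous_on (sphere 0 1) (\<lambda>v. v \<bullet> (a *v v))"
    by (intro continuous_intros linear_continuous_on matrix_vector_mul_bounded_linear)
  moreover have "sphere (0::real^'n) 1 \<noteq> {}"
    using norm_axis_1 by (metis empty_iff mem_sphere_0)
  ultimately obtain w where w: "w \<in> sphere 0 1" "\<forall>v\<in>sphere 0 1. w \<bullet> (a *v w) \<le> v \<bullet> (a *v v)"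
    using continuous_attains_inf[OF compact_sphere] by blast
  define \<mu> where "\<mu> = w \<bullet> (a *v w)"
  have nw: "norm w = 1" using w(1) by simp
  obtain z where z: "norm z = 1" "z \<bullet> (a *v z) \<le> 0"
    using assms unfolding posdef_eq_sym_Int sym_mats_def by (auto simp: not_less)
  have \<mu>: "\<mu> \<le> 0" using w(2) z unfolding \<mu>_def by force
  have low: "z \<bullet> (a *v z) - \<mu> * (z \<bullet> z) \<ge> 0" for z
  proof (cases "z = 0")
    case False
    let ?z = "(1 / norm z) *\<^sub>R z"
    have "\<mu> \<le> ?z \<bullet> (a *v ?z)" unfolding \<mu>_def by (rule w(2)[rule_format]) (use False in simp)
    also have "\<dots> = (z \<bullet> (a *v z)) / (norm z)^2"
      by (simp add: matrix_vector_mult.scaleR_right power2_eq_square)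
    finally show ?thesis
      using False by (simp add: field_simps power2_norm_eq_inner)
  qed simp
  define d where "d = a *v w - \<mu> *\<^sub>R w"
  define C where "C = d \<bullet> (a *v d) - \<mu> * (d \<bullet> d)"
  have q: "2 * t * (d \<bullet> d) + t^2 * C \<ge> 0" for t
  proof -
    have sw: "w \<bullet> (a *v d) = d \<bullet> (a *v w)"
      using inner_matrix_vector_transpose[of w a d] by (simp add: a inner_commute)
    have "(w + t *\<^sub>R d) \<bullet> (a *v (w + t *\<^sub>R d)) - \<mu> * ((w + t *\<^sub>R d) \<bullet> (w + t *\<^sub>R d)) =
      (w \<bullet> (a *v w) - \<mu> * (w \<bullet> w)) + 2 * t * (d \<bullet> (a *v w) - \<mu> * (d \<bullet> w)) + t^2 * C"
      by (simp add: C_def sw matrix_vector_mult.add_right matrix_vector_mult.scaleR_right inner_add_left inner_add_right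
          inner_commute[of w d] power2_eq_square algebra_simps)
    moreover have "w \<bullet> (a *v w) - \<mu> * (w \<bullet> w) = 0"
      using nw by (simp add: \<mu>_def power2_norm_eq_inner[symmetric])
    moreover have "d \<bullet> (a *v w) - \<mu> * (d \<bullet> w) = d \<bullet> d"
      by (simp add: d_def inner_diff_right)
    ultimately show ?thesis using low[of "w + t *\<^sub>R d"] by simp
  qed
  have "d \<bullet> d = 0"
  proof (rule ccontr)
    assume "d \<bullet> d \<noteq> 0"
    then have A: "d \<bullet> d > 0" by simp
    define A where "A = d \<bullet> d"
    \<comment> \<open>A negative t small compared with 1/|C| makes the linear term dominate the
      quadratic one.\<close>
    have "2 * (- A / (1 + \<bar>C\<bar>)) * A + (- A / (1 + \<bar>C\<bar>))^2 * C \<ge> 0"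
      using q[of "- A / (1 + \<bar>C\<bar>)"] by (simp add: A_def)
    then have "(2 * (- A / (1 + \<bar>C\<bar>)) * A + (- A / (1 + \<bar>C\<bar>))^2 * C) * (1 + \<bar>C\<bar>)^2 \<ge> 0"
      by simp
    moreover have "(2 * (- A / (1 + \<bar>C\<bar>)) * A + (- A / (1 + \<bar>C\<bar>))^2 * C) * (1 + \<bar>C\<bar>)^2 = A^2 * (C - 2 * (1 + \<bar>C\<bar>))"
    proof -
      define D where "D = 1 + \<bar>C\<bar>"
      have "D \<noteq> 0" unfolding D_def by linarith
      then show ?thesis unfolding D_def[symmetric] by (simp add: field_simps power2_eq_square)
    qed
    moreover have "A^2 * (C - 2 * (1 + \<bar>C\<bar>)) < 0"
      using A unfolding A_def[symmetric] by (intro mult_pos_neg) auto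
    ultimately show False by linarith
  qed
  then have "a *v w = \<mu> *\<^sub>R w" by (simp add: d_def)
  with that nw \<mu> show ?thesis by blast
qed

subsection \<open>Positive definiteness of the parameters\<close>

lemma ennreal_suminf_const_pos:
  fixes c :: ennreal
  assumes "c > 0"
  shows "(\<Sum>n::nat. c) = \<infinity>"
proof (cases c)
  case (real r)
  then have "r > 0" using assms by (simp add: ennreal_less_zero_iff)
  show ?thesis
  proof (rule ccontr)
    assume "(\<Sum>n::nat. c) \<noteq> \<infinity>"
    then have "summable (\<lambda>n::nat. r)"
      using real by (intro summable_suminf_not_top) auto
    then show False using \<open>r > 0\<close> by (simp add: summable_const_iff)
  qed
next
  case top
  have "(\<Sum>n\<in>{0::nat}. c) \<le> (\<Sum>n::nat. c)"
    by (rule sum_le_suminf) auto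
  then show ?thesis using top by (simp add: top_unique)
qed

context
  fixes v :: "real^'n::finite"
  assumes nv: "norm v = 1"
begin

private definition W :: "real^'n^'n" where "W = (\<chi> i j. v$i * v$j)"

text \<open>Multiplies v by s and fixes its orthogonal complement, since \<open>W\<close> is the
  orthogonal projection onto the line of v.\<close>

private definition stretch :: "real \<Rightarrow> real^'n^'n" where "stretch s = mat 1 + (s - 1) *\<^sub>R W"

private lemma vv: "v \<bullet> v = 1"
  using nv by (simp add: power2_norm_eq_inner[symmetric])

private lemma W_vec: "W *v z = (v \<bullet> z) *\<^sub>R v"
  unfolding W_def by (rule rank_one_mult_vec)

private lemma W_sym: "transpose W = W"
  unfolding W_def by (rule rank_one_sym)

private lemma W_mult: "W ** W = W"
  by (simp add: matrix_eq matrix_vector_mul_assoc[symmetric] W_vec vv)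

private lemma stretch_sym: "transpose (stretch s) = stretch s"
  by (simp add: stretch_def transpose_algebra W_sym)

private lemma stretch_vec: "stretch s *v v = s *\<^sub>R v"
  by (simp add: stretch_def matrix_vector_mult.add_left matrix_vector_mult.scaleR_left W_vec vv algebra_simps)

private lemma stretch_inv:
  assumes "s \<noteq> 0"
  shows "invertible (stretch s)" "matrix_inv (stretch s) = stretch (1/s)"
proof -
  have "(mat 1 + p *\<^sub>R W) ** (mat 1 + q *\<^sub>R W) = mat 1 + (p + q + p * q) *\<^sub>R W" for p q
    by (simp add: matrix_algebra W_mult scaleR_add_left scaleR_add_right mult.commute)
  then have "stretch s ** stretch (1/s) = mat 1 + ((s - 1) + (1/s - 1) + (s - 1) * (1/s - 1)) *\<^sub>R W"
    unfolding stretch_def .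
  also have "(s - 1) + (1/s - 1) + (s - 1) * (1/s - 1) = 0" using assms by (simp add: field_simps)
  finally have "stretch s ** stretch (1/s) = mat 1" by simp
  from matrix_inv_unique[OF this] show "invertible (stretch s)" "matrix_inv (stretch s) = stretch (1/s)" by auto
qed

private lemma trace_W: "trace (W ** x) = v \<bullet> (x *v v)"
  unfolding trace_def matrix_matrix_mult_def W_def inner_vec_def matrix_vector_mult_def
  by (simp add: sum_distrib_left) (subst sum.swap, simp add: mult_ac)

private lemma norm_stretch:
  assumes "0 < s" "s \<le> 1"
  shows "norm (stretch s) \<le> norm (mat 1 :: real^'n^'n) + norm W"
proof -
  have "norm (stretch s) \<le> norm (mat 1 :: real^'n^'n) + \<bar>s - 1\<bar> * norm W"
    unfolding stretch_def by (metis norm_triangle_ineq norm_scaleR)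
  also have "\<dots> \<le> norm (mat 1 :: real^'n^'n) + 1 * norm W"
    using assms by (intro add_left_mono mult_right_mono) auto
  finally show ?thesis by simp
qed

text \<open>The bounds 1/2 and 3/2 make the stretched neighbourhoods disjoint: stretching by 2^n
  multiplies v \<bullet> (w v) by 4^n, and 3/2 is below 4/2.\<close>

private lemma stretch_neighbourhood:
  obtains \<epsilon> where "\<epsilon> > 0"
    "\<And>w. w \<in> ball (mat 1) \<epsilon> \<Longrightarrow> norm w \<le> norm (mat 1 :: real^'n^'n) + 1 \<and> norm (matrix_inv w) \<le> norm (mat 1 :: real^'n^'n) + 1
       \<and> \<bar>ln (det w)\<bar> \<le> 1 \<and> 1/2 < v \<bullet> (w *v v) \<and> v \<bullet> (w *v v) < 3/2"
proof -
  have id: "((\<lambda>w. w) \<longlongrightarrow> (mat 1 :: real^'n^'n)) (nhds (mat 1 :: real^'n^'n))" by (rule filterlim_ident)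
  have 1: "((\<lambda>w. norm w) \<longlongrightarrow> norm (mat 1 :: real^'n^'n)) (nhds (mat 1 :: real^'n^'n))" by (rule tendsto_norm[OF id])
  have 2: "((\<lambda>w. norm (matrix_inv w)) \<longlongrightarrow> norm (matrix_inv (mat 1 :: real^'n^'n))) (nhds (mat 1 :: real^'n^'n))"
    by (intro tendsto_norm tendsto_matrix_inv id) (simp add: invertible_det_nz)
  have 3: "((\<lambda>w. ln (det w)) \<longlongrightarrow> ln (det (mat 1 :: real^'n^'n))) (nhds (mat 1 :: real^'n^'n))"
    by (intro tendsto_ln tendsto_det id) simp
  have 4: "((\<lambda>w. v \<bullet> (w *v v)) \<longlongrightarrow> v \<bullet> ((mat 1 :: real^'n^'n) *v v)) (nhds (mat 1 :: real^'n^'n))"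
    by (intro tendsto_intros bounded_linear.tendsto[OF matrix_vector_mult.bounded_linear_left] id)
  have "eventually (\<lambda>w. norm w < norm (mat 1 :: real^'n^'n) + 1) (nhds (mat 1 :: real^'n^'n))"
    by (rule order_tendstoD(2)[OF 1]) simp
  moreover have "eventually (\<lambda>w. norm (matrix_inv w) < norm (mat 1 :: real^'n^'n) + 1) (nhds (mat 1 :: real^'n^'n))"
    by (rule order_tendstoD(2)[OF 2]) simp
  moreover have "eventually (\<lambda>w. ln (det w) < 1) (nhds (mat 1 :: real^'n^'n))"
    by (rule order_tendstoD(2)[OF 3]) simp
  moreover have "eventually (\<lambda>w. ln (det w) > -1) (nhds (mat 1 :: real^'n^'n))"
    by (rule order_tendstoD(1)[OF 3]) simp
  moreover have "eventually (\<lambda>w. v \<bullet> (w *v v) < 3/2) (nhds (mat 1 :: real^'n^'n))"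
    by (rule order_tendstoD(2)[OF 4]) (simp add: vv)
  moreover have "eventually (\<lambda>w. v \<bullet> (w *v v) > 1/2) (nhds (mat 1 :: real^'n^'n))"
    by (rule order_tendstoD(1)[OF 4]) (simp add: vv)
  ultimately have "eventually (\<lambda>w. norm w \<le> norm (mat 1 :: real^'n^'n) + 1 \<and> norm (matrix_inv w) \<le> norm (mat 1 :: real^'n^'n) + 1
       \<and> \<bar>ln (det w)\<bar> \<le> 1 \<and> 1/2 < v \<bullet> (w *v v) \<and> v \<bullet> (w *v v) < 3/2) (nhds (mat 1 :: real^'n^'n))"
    by eventually_elim auto
  then obtain \<epsilon> where "\<epsilon> > 0" "\<And>w. dist w (mat 1) < \<epsilon> \<Longrightarrow> norm w \<le> norm (mat 1 :: real^'n^'n) + 1 \<and> norm (matrix_inv w) \<le> norm (mat 1 :: real^'n^'n) + 1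
       \<and> \<bar>ln (det w)\<bar> \<le> 1 \<and> 1/2 < v \<bullet> (w *v v) \<and> v \<bullet> (w *v v) < 3/2"
    unfolding eventually_nhds_metric by blast
  then show ?thesis by (intro that[of \<epsilon>]) (auto simp: dist_commute)
qed

text \<open>Stretching adds a nonpositive multiple of \<mu> \<le> 0 to trace (a x) and keeps x^-1
  bounded, so only the determinant can grow. The factor \<open>c\<close> covers both \<alpha> a and
  a, including \<alpha> = 0.\<close>

private lemma kernel_lower_bound:
  fixes a b :: "real^'n^'n"
  assumes a: "transpose a = a" and ev: "a *v v = \<mu> *\<^sub>R v" and \<mu>: "\<mu> \<le> 0" and c: "c \<ge> 0"
  obtains c0 where "c0 > 0" "\<And>s w. s \<ge> 1 \<Longrightarrow> w \<in> posdef_mats \<Longrightarrow>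
      norm w \<le> norm (mat 1 :: real^'n^'n) + 1 \<Longrightarrow> norm (matrix_inv w) \<le> norm (mat 1 :: real^'n^'n) + 1 \<Longrightarrow> \<bar>ln (det w)\<bar> \<le> 1 \<Longrightarrow>
      mgig_kernel lam (c *\<^sub>R a) b (stretch s ** w ** transpose (stretch s)) * \<bar>det (stretch s)\<bar> ^ (CARD('n) + 1)
        \<ge> c0 * exp (2 * lam * ln \<bar>det (stretch s)\<bar>)"
proof -
  define K where "K = norm (mat 1 :: real^'n^'n) + 1"
  define K' where "K' = norm (mat 1 :: real^'n^'n) + norm W"
  obtain B where B: "\<And>(x :: real^'n^'n) (y :: real^'n^'n). norm (x ** y) \<le> norm x * norm y * B" "B > 0"
    using matrix_mult.pos_bounded by blast
  obtain T where T: "\<And>x :: real^'n^'n. norm (trace x) \<le> norm x * T" "T > 0"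
    using bounded_linear.pos_bounded[OF bounded_linear_trace] by blast
  define C1 where "C1 = norm a * K * B * T"
  define C2 where "C2 = norm b * (K' * K * B * K' * B) * B * T"
  define C3 where "C3 = \<bar>lam - (real CARD('n) + 1) / 2\<bar>"
  have aW: "a ** W = \<mu> *\<^sub>R W"
    by (simp add: matrix_eq matrix_vector_mul_assoc[symmetric] W_vec matrix_vector_mult.scaleR_right matrix_vector_mult.scaleR_left ev)
  have Wa: "W ** a = \<mu> *\<^sub>R W"
    using arg_cong[OF aW, of transpose] by (simp add: transpose_algebra W_sym a)
  have main: "mgig_kernel lam (c *\<^sub>R a) b (stretch s ** w ** transpose (stretch s)) * \<bar>det (stretch s)\<bar> ^ (CARD('n) + 1)
        \<ge> exp (- C3 - c * C1 - C2) * exp (2 * lam * ln \<bar>det (stretch s)\<bar>)"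
    if s: "s \<ge> 1" and w: "w \<in> posdef_mats" and nw: "norm w \<le> K" "norm (matrix_inv w) \<le> K" and dw: "\<bar>ln (det w)\<bar> \<le> 1" for s w
  proof -
    let ?g = "stretch s" and ?h = "stretch (1/s)"
    define d where "d = \<bar>det ?g\<bar>"
    have s0: "s \<noteq> 0" using s by simp
    note ig = stretch_inv[OF s0]
    have d: "d > 0" using ig(1) by (simp add: d_def invertible_det_nz)
    let ?x = "?g ** w ** ?g"
    have x: "?x \<in> posdef_mats" using posdef_congruence[OF w ig(1)] by (simp add: stretch_sym)
    have lx: "ln (det ?x) = 2 * ln d + ln (det w)"
    proof -
      have "det ?x = d * d * det w" by (simp add: det_mul d_def)
      then show ?thesis using d det_posdef[OF w] by (simp add: ln_mult)
    qed
    have xi: "matrix_inv ?x = ?h ** matrix_inv w ** ?h"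
      using ig posdef_invertible[OF w] by (simp add: matrix_inv_mult matrix_mul_assoc)
    have "trace (a ** ?x) = trace ((a ** ?g ** w) ** ?g)" by (simp add: matrix_mul_assoc)
    also have "\<dots> = trace (?g ** (a ** ?g ** w))" by (rule trace_matrix_mult_commute)
    also have "?g ** (a ** ?g ** w) = a ** w + ((s^2 - 1) * \<mu>) *\<^sub>R (W ** w)"
    proof -
      have "?g ** a ** ?g = a + ((s - 1) * \<mu> + (s - 1) * \<mu> + (s - 1) * ((s - 1) * \<mu>)) *\<^sub>R W"
        unfolding stretch_def by (simp add: matrix_algebra aW Wa W_mult) (simp add: algebra_simps)
      also have "(s - 1) * \<mu> + (s - 1) * \<mu> + (s - 1) * ((s - 1) * \<mu>) = (s^2 - 1) * \<mu>"
        by (simp add: algebra_simps power2_eq_square)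
      finally have "?g ** a ** ?g ** w = (a + ((s^2 - 1) * \<mu>) *\<^sub>R W) ** w" by simp
      then show ?thesis by (simp add: matrix_algebra)
    qed
    finally have "trace (a ** ?x) = trace (a ** w) + ((s^2 - 1) * \<mu>) * (v \<bullet> (w *v v))"
      by (simp add: trace_algebra trace_W)
    moreover have "((s^2 - 1) * \<mu>) * (v \<bullet> (w *v v)) \<le> 0"
    proof -
      have "v \<noteq> 0" using nv by auto
      then have "v \<bullet> (w *v v) > 0" using posdef_pos[OF w] by blast
      moreover have "s^2 - 1 \<ge> 0" using s by simp
      ultimately show ?thesis using \<mu> by (simp add: mult_nonneg_nonpos mult_nonpos_nonneg)
    qed
    moreover have "trace (a ** w) \<le> C1"
    proof -
      have "trace (a ** w) \<le> norm (a ** w) * T" using T(1)[of "a ** w"] by simp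
      also have "\<dots> \<le> (norm a * norm w * B) * T" using B T by (intro mult_right_mono) auto
      also have "\<dots> \<le> C1" unfolding C1_def using nw B T by (intro mult_right_mono mult_left_mono) auto
      finally show ?thesis .
    qed
    ultimately have ta: "trace (a ** ?x) \<le> C1" by linarith
    have tb: "trace (b ** matrix_inv ?x) \<le> C2"
    proof -
      have nh: "norm ?h \<le> K'" unfolding K'_def using s by (intro norm_stretch) auto
      have K0: "K' \<ge> 0" unfolding K'_def by simp
      have "norm (?h ** matrix_inv w) \<le> norm ?h * norm (matrix_inv w) * B" by (rule B)
      also have "\<dots> \<le> K' * K * B" using nh nw B K0 by (intro mult_right_mono mult_mono) auto
      finally have h1: "norm (?h ** matrix_inv w) \<le> K' * K * B" .
      have "norm (matrix_inv ?x) \<le> norm (?h ** matrix_inv w) * norm ?h * B" unfolding xi by (rule B)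
      also have "\<dots> \<le> K' * K * B * K' * B"
        using h1 nh B K0 order_trans[OF norm_ge_zero h1] by (intro mult_right_mono mult_mono) auto
      finally have h2: "norm (matrix_inv ?x) \<le> K' * K * B * K' * B" .
      have "trace (b ** matrix_inv ?x) \<le> norm (b ** matrix_inv ?x) * T" using T(1)[of "b ** matrix_inv ?x"] by simp
      also have "\<dots> \<le> (norm b * norm (matrix_inv ?x) * B) * T" using B T by (intro mult_right_mono) auto
      also have "\<dots> \<le> C2" unfolding C2_def using h2 B T by (intro mult_right_mono mult_left_mono) auto
      finally show ?thesis .
    qed
    have dp: "d ^ (CARD('n) + 1) = exp ((real CARD('n) + 1) * ln d)"
    proof -
      have "exp (real (CARD('n) + 1) * ln d) = d ^ (CARD('n) + 1)"
        using d by (subst exp_of_nat_mult) simp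
      then show ?thesis by (simp add: add.commute)
    qed
    have "mgig_kernel lam (c *\<^sub>R a) b ?x * d ^ (CARD('n) + 1) =
      exp ((lam - (real CARD('n) + 1) / 2) * (2 * ln d + ln (det w)) - c * trace (a ** ?x) - trace (b ** matrix_inv ?x) + (real CARD('n) + 1) * ln d)"
      unfolding mgig_kernel_exp[OF x] dp exp_add[symmetric] lx by (simp add: matrix_mult.scaleR_left trace_algebra)
    \<comment> \<open>The Jacobian exponent r+1 cancels the shift (r+1)/2, doubled because the
      stretch acts on both sides; only 2 lam ln d survives.\<close>
    also have "(lam - (real CARD('n) + 1) / 2) * (2 * ln d + ln (det w)) - c * trace (a ** ?x) - trace (b ** matrix_inv ?x) + (real CARD('n) + 1) * ln d
      = (lam - (real CARD('n) + 1) / 2) * ln (det w) - c * trace (a ** ?x) - trace (b ** matrix_inv ?x) + 2 * lam * ln d"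
      by (simp add: field_simps)
    also have "exp \<dots> \<ge> exp (- C3 - c * C1 - C2 + 2 * lam * ln d)"
    proof -
      have "\<bar>(lam - (real CARD('n) + 1) / 2) * ln (det w)\<bar> \<le> C3 * 1"
        unfolding abs_mult C3_def using dw by (intro mult_left_mono) auto
      moreover have "c * trace (a ** ?x) \<le> c * C1" using ta c by (intro mult_left_mono)
      ultimately show ?thesis using tb by simp
    qed
    finally show ?thesis
      unfolding stretch_sym d_def[symmetric] exp_add[symmetric] .
  qed
  show ?thesis
    by (rule that[of "exp (- C3 - c * C1 - C2)"]) (use main in \<open>auto simp: K_def\<close>)
qed

lemma not_integrable_of_nonpos_eigenvalue:
  fixes a b1 b2 :: "real^'n^'n"
  assumes a: "transpose a = a" and ev: "a *v v = \<mu> *\<^sub>R v" and \<mu>: "\<mu> \<le> 0" and c1: "c1 \<ge> 0" and c2: "c2 \<ge> 0"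
    and i1: "(\<integral>\<^sup>+x. ennreal (mgig_kernel lam (c1 *\<^sub>R a) b1 x) \<partial>lebesgue_sym) < \<infinity>"
    and i2: "(\<integral>\<^sup>+x. ennreal (mgig_kernel (- lam) (c2 *\<^sub>R a) b2 x) \<partial>lebesgue_sym) < \<infinity>"
  shows False
proof -
  let ?L = "lebesgue_sym :: (real^'n^'n) measure"
  obtain \<epsilon> where \<epsilon>: "\<epsilon> > 0"
    "\<And>w. w \<in> ball (mat 1) \<epsilon> \<Longrightarrow> norm w \<le> norm (mat 1 :: real^'n^'n) + 1 \<and> norm (matrix_inv w) \<le> norm (mat 1 :: real^'n^'n) + 1
       \<and> \<bar>ln (det w)\<bar> \<le> 1 \<and> 1/2 < v \<bullet> (w *v v) \<and> v \<bullet> (w *v v) < 3/2"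
    using stretch_neighbourhood by blast
  obtain k1 where k1: "k1 > 0" "\<And>s w. s \<ge> 1 \<Longrightarrow> w \<in> posdef_mats \<Longrightarrow>
      norm w \<le> norm (mat 1 :: real^'n^'n) + 1 \<Longrightarrow> norm (matrix_inv w) \<le> norm (mat 1 :: real^'n^'n) + 1 \<Longrightarrow> \<bar>ln (det w)\<bar> \<le> 1 \<Longrightarrow>
      mgig_kernel lam (c1 *\<^sub>R a) b1 (stretch s ** w ** transpose (stretch s)) * \<bar>det (stretch s)\<bar> ^ (CARD('n) + 1)
        \<ge> k1 * exp (2 * lam * ln \<bar>det (stretch s)\<bar>)"
    using kernel_lower_bound[OF a ev \<mu> c1, of lam b1] by blast
  obtain k2 where k2: "k2 > 0" "\<And>s w. s \<ge> 1 \<Longrightarrow> w \<in> posdef_mats \<Longrightarrow>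
      norm w \<le> norm (mat 1 :: real^'n^'n) + 1 \<Longrightarrow> norm (matrix_inv w) \<le> norm (mat 1 :: real^'n^'n) + 1 \<Longrightarrow> \<bar>ln (det w)\<bar> \<le> 1 \<Longrightarrow>
      mgig_kernel (- lam) (c2 *\<^sub>R a) b2 (stretch s ** w ** transpose (stretch s)) * \<bar>det (stretch s)\<bar> ^ (CARD('n) + 1)
        \<ge> k2 * exp (2 * (- lam) * ln \<bar>det (stretch s)\<bar>)"
    using kernel_lower_bound[OF a ev \<mu> c2, of "- lam" b2] by blast
  define k where "k = min k1 k2"
  have k: "k > 0" using k1 k2 by (simp add: k_def)
  define B where "B = ball (mat 1 :: real^'n^'n) \<epsilon> \<inter> posdef_mats"
  have B [measurable]: "B \<in> sets borel" unfolding B_def by measurable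
  define f where "f = (\<lambda>x. mgig_kernel lam (c1 *\<^sub>R a) b1 x + mgig_kernel (- lam) (c2 *\<^sub>R a) b2 x)"
  have f [measurable]: "f \<in> borel_measurable borel" unfolding f_def by measurable
  define N where "N = density ?L (\<lambda>x. ennreal (f x))"
  define A where "A = (\<lambda>n::nat. {x. stretch ((1/2)^n) ** x ** stretch ((1/2)^n) \<in> B})"
  have cong_m [measurable]: "(\<lambda>x. g ** x ** h) \<in> borel_measurable borel" for g h :: "real^'n^'n"
    by (intro borel_measurable_continuous_onI continuous_intros matrix_mult.continuous_on)
  have A_m [measurable]: "A n \<in> sets borel" for n
    unfolding A_def using measurable_sets[OF cong_m B] by (simp add: vimage_def)
  have inv: "stretch ((1/2)^n) ** stretch (2^n) = mat 1" "stretch (2^n) ** stretch ((1/2)^n) = mat 1" for n :: nat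
    using matrix_inv_props(1,2)[OF stretch_inv(1), of "2^n"] stretch_inv(2)[of "2^n"] by (simp_all add: power_one_over)
  have disj: "disjoint_family A"
  proof -
    have bounds: "4^n / 2 < v \<bullet> (x *v v) \<and> v \<bullet> (x *v v) < 3/2 * 4^n" if "x \<in> A n" for x n
    proof -
      let ?h = "stretch ((1/2)^n)"
      have "?h ** x ** ?h \<in> ball (mat 1) \<epsilon>" using that by (simp add: A_def B_def)
      then have "1/2 < v \<bullet> ((?h ** x ** ?h) *v v) \<and> v \<bullet> ((?h ** x ** ?h) *v v) < 3/2" using \<epsilon>(2) by blast
      moreover have "v \<bullet> ((?h ** x ** ?h) *v v) = (1/2)^n * (1/2)^n * (v \<bullet> (x *v v))"
      proof -
        have "v \<bullet> ((?h ** x ** ?h) *v v) = (transpose ?h *v v) \<bullet> (x *v (?h *v v))"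
          by (simp only: matrix_vector_mul_assoc[symmetric] inner_matrix_vector_transpose[of v])
        then show ?thesis by (simp only: stretch_sym stretch_vec) (simp add: matrix_vector_mult.scaleR_right)
      qed
      moreover have "(1/2::real)^n * (1/2)^n = 1 / 4^n" by (simp add: power_mult_distrib[symmetric] power_one_over)
      ultimately have "1/2 < 1 / 4^n * (v \<bullet> (x *v v)) \<and> 1 / 4^n * (v \<bullet> (x *v v)) < 3/2" by simp
      then show ?thesis by (simp add: field_simps)
    qed
    \<comment> \<open>On \<open>A n\<close> the value v \<bullet> (x v) lies between 4^n / 2 and 3/2
      times 4^n, and these intervals are disjoint for different n.\<close>
    have "A m \<inter> A n = {}" if "m < n" for m n
    proof (rule ccontr)
      assume "A m \<inter> A n \<noteq> {}"
      then obtain x where x: "x \<in> A m" "x \<in> A n" by blast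
      have "(4::real) * 4^m \<le> 4^n"
        using power_increasing[of "Suc m" n "4::real"] that by simp
      then show False using bounds[OF x(1)] bounds[OF x(2)] by linarith
    qed
    then show ?thesis
      unfolding disjoint_family_on_def by (metis Int_commute linorder_neqE_nat)
  qed
  have lower: "emeasure N (A n) \<ge> ennreal k * emeasure ?L B" for n
  proof -
    let ?g = "stretch (2^n)"
    have ig: "invertible ?g" by (rule stretch_inv) simp
    have fm: "(\<lambda>x. ennreal (f x) * indicator (A n) x) \<in> borel_measurable borel" by measurable
    have "emeasure N (A n) = (\<integral>\<^sup>+x. ennreal (f x) * indicator (A n) x \<partial>?L)"
      unfolding N_def by (rule emeasure_density) measurable
    also have "\<dots> = (\<integral>\<^sup>+x. (ennreal (f (?g ** x ** transpose ?g)) * indicator (A n) (?g ** x ** transpose ?g)) * ennreal (\<bar>det ?g\<bar> ^ (CARD('n) + 1)) \<partial>?L)"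
      by (rule nn_integral_lebesgue_sym_congruence[OF fm ig])
    also have "\<dots> \<ge> (\<integral>\<^sup>+x. ennreal k * indicator B x \<partial>?L)"
    proof (rule nn_integral_mono)
      fix w :: "real^'n^'n"
      show "ennreal k * indicator B w \<le> (ennreal (f (?g ** w ** transpose ?g)) * indicator (A n) (?g ** w ** transpose ?g)) * ennreal (\<bar>det ?g\<bar> ^ (CARD('n) + 1))"
      proof (cases "w \<in> B")
        case True
        have hw: "stretch ((1/2)^n) ** (?g ** w ** transpose ?g) ** stretch ((1/2)^n) = w"
        proof -
          have "stretch ((1/2)^n) ** (?g ** w ** transpose ?g) ** stretch ((1/2)^n)
             = (stretch ((1/2)^n) ** ?g) ** w ** (?g ** stretch ((1/2)^n))"
            by (simp add: matrix_mul_assoc stretch_sym)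
          then show ?thesis by (simp add: inv)
        qed
        have wA: "?g ** w ** transpose ?g \<in> A n"
          unfolding A_def mem_Collect_eq hw by (rule True)
        have w: "w \<in> posdef_mats" "w \<in> ball (mat 1) \<epsilon>" using True by (auto simp: B_def)
        define D where "D = \<bar>det ?g\<bar> ^ (CARD('n) + 1)"
        define t where "t = 2 * lam * ln \<bar>det ?g\<bar>"
        have b1: "mgig_kernel lam (c1 *\<^sub>R a) b1 (?g ** w ** transpose ?g) * D \<ge> k1 * exp t"
          unfolding D_def t_def by (rule k1(2)) (use w \<epsilon>(2)[OF w(2)] in auto)
        have b2: "mgig_kernel (- lam) (c2 *\<^sub>R a) b2 (?g ** w ** transpose ?g) * D \<ge> k2 * exp (- t)"
          using k2(2)[of "2^n" w] w \<epsilon>(2)[OF w(2)] by (auto simp: D_def t_def)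
        \<comment> \<open>One of exp t and exp (- t) is at least 1, whatever the sign of lam; this
          is why the two kernels are added.\<close>
        have "k \<le> k1 * exp t + k2 * exp (- t)"
        proof (cases "t \<ge> 0")
          case True
          then have "k1 * 1 \<le> k1 * exp t" using k1 by (intro mult_left_mono) auto
          moreover have "k2 * exp (- t) \<ge> 0" using k2 by simp
          ultimately show ?thesis by (simp add: k_def)
        next
          case False
          then have "k2 * 1 \<le> k2 * exp (- t)" using k2 by (intro mult_left_mono) auto
          moreover have "k1 * exp t \<ge> 0" using k1 by simp
          ultimately show ?thesis by (simp add: k_def)
        qed
        also have "\<dots> \<le> f (?g ** w ** transpose ?g) * D"
          using b1 b2 by (simp add: f_def distrib_right)
        finally have "ennreal k \<le> ennreal (f (?g ** w ** transpose ?g) * D)"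
          by (rule ennreal_leI)
        also have "\<dots> = ennreal (f (?g ** w ** transpose ?g)) * ennreal D"
          by (rule ennreal_mult) (auto simp: f_def mgig_kernel_nonneg D_def)
        finally show ?thesis using True wA by (simp add: D_def)
      qed simp
    qed
    finally show ?thesis by (simp add: nn_integral_cmult_indicator)
  qed
  have Bpos: "emeasure ?L B > 0"
  proof (rule ccontr)
    assume "\<not> emeasure ?L B > 0"
    then have "B \<in> null_sets ?L" by (auto simp: null_sets_def)
    then have "AE x in ?L. x \<notin> B" by (rule AE_not_in)
    \<comment> \<open>A continuous bump that vanishes outside the ball and is positive at the
      identity reduces positivity of the measure of \<open>B\<close> to the uniqueness of continuous
      functions.\<close>
    then have "AE x in ?L. x \<in> posdef_mats \<longrightarrow> max 0 (\<epsilon> - dist (mat 1) x) = 0"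
      by eventually_elim (auto simp: B_def)
    from AE_lebesgue_sym_posdef_eq[OF this _ _ posdef_mat_1] have "max 0 (\<epsilon> - dist (mat 1) (mat 1 :: real^'n^'n)) = 0"
      by (simp add: continuous_intros)
    then show False using \<epsilon>(1) by simp
  qed
  have fin: "emeasure N UNIV < \<infinity>"
  proof -
    have "emeasure N UNIV = (\<integral>\<^sup>+x. ennreal (mgig_kernel lam (c1 *\<^sub>R a) b1 x) + ennreal (mgig_kernel (- lam) (c2 *\<^sub>R a) b2 x) \<partial>?L)"
      unfolding N_def by (simp add: emeasure_density f_def mgig_kernel_nonneg)
    also have "\<dots> = (\<integral>\<^sup>+x. ennreal (mgig_kernel lam (c1 *\<^sub>R a) b1 x) \<partial>?L) + (\<integral>\<^sup>+x. ennreal (mgig_kernel (- lam) (c2 *\<^sub>R a) b2 x) \<partial>?L)"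
      by (rule nn_integral_add) measurable
    finally show ?thesis using i1 i2 by simp
  qed
  have "(\<Sum>n. emeasure N (A n)) \<le> emeasure N UNIV"
  proof -
    have "(\<Sum>n. emeasure N (A n)) = emeasure N (\<Union>n. A n)"
      by (rule suminf_emeasure) (use disj in \<open>auto simp: N_def\<close>)
    also have "\<dots> \<le> emeasure N UNIV"
      by (rule emeasure_mono) (auto simp: N_def)
    finally show ?thesis .
  qed
  moreover have "(\<Sum>n. emeasure N (A n)) \<ge> (\<Sum>n::nat. ennreal k * emeasure ?L B)"
    by (rule suminf_le) (use lower in auto)
  moreover have "(\<Sum>n::nat. ennreal k * emeasure ?L B) = \<infinity>"
    using k Bpos by (intro ennreal_suminf_const_pos) (auto simp: ennreal_zero_less_mult_iff)
  ultimately show False using fin by (simp add: top_unique)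
qed

end

lemma mgig_parameter_posdef:
  fixes a b1 b2 :: "real^'n::finite^'n"
  assumes "transpose a = a" "c1 \<ge> 0" "c2 \<ge> 0"
    and "(\<integral>\<^sup>+x. ennreal (mgig_kernel lam (c1 *\<^sub>R a) b1 x) \<partial>lebesgue_sym) < \<infinity>"
    and "(\<integral>\<^sup>+x. ennreal (mgig_kernel (- lam) (c2 *\<^sub>R a) b2 x) \<partial>lebesgue_sym) < \<infinity>"
  shows "a \<in> posdef_mats"
proof (rule ccontr)
  assume "a \<notin> posdef_mats"
  then obtain v \<mu> where "norm v = 1" "a *v v = \<mu> *\<^sub>R v" "\<mu> \<le> 0"
    using eigenvector_nonpos assms(1) by blast
  with assms show False
    using not_integrable_of_nonpos_eigenvalue by blast
qed

subsection \<open>The characterization\<close>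

lemma continuous_on_matrix_inv:
  fixes f :: "'a::topological_space \<Rightarrow> real^'n::finite^'n"
  assumes "continuous_on S f" "\<And>x. x \<in> S \<Longrightarrow> invertible (f x)"
  shows "continuous_on S (\<lambda>x. matrix_inv (f x))"
  using assms unfolding continuous_on_def by (auto intro: tendsto_matrix_inv)

lemma continuous_on_mgig:
  assumes \<alpha>: "\<alpha> \<ge> 0" and \<beta>: "\<beta> \<ge> 0"
    and f: "continuous_on S f" and g: "continuous_on S g"
    and pd: "\<And>x. x \<in> S \<Longrightarrow> f x \<in> posdef_mats" "\<And>x. x \<in> S \<Longrightarrow> g x \<in> posdef_mats"
  shows "continuous_on S (\<lambda>x. mgig_V \<alpha> \<beta> (f x) (g x :: real^'n::finite^'n))"
    "continuous_on S (\<lambda>x. mgig_U \<alpha> \<beta> (f x) (g x))"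
proof -
  have s: "continuous_on S (\<lambda>x. \<alpha> *\<^sub>R f x + g x)" by (intro continuous_intros f g)
  show V: "continuous_on S (\<lambda>x. mgig_V \<alpha> \<beta> (f x) (g x))"
    unfolding mgig_V_def
    by (intro continuous_on_add continuous_on_scaleR continuous_on_const continuous_on_matrix_inv s f
        posdef_invertible posdef_scaleR_add pd \<alpha>)
  show "continuous_on S (\<lambda>x. mgig_U \<alpha> \<beta> (f x) (g x))"
    unfolding mgig_U_def
  proof (intro continuous_on_diff continuous_on_scaleR continuous_on_const continuous_on_matrix_inv s V)
    fix x assume x: "x \<in> S"
    show "invertible (mgig_V \<alpha> \<beta> (f x) (g x))" by (intro invertible_mgig_V \<alpha> \<beta> pd x)
    show "invertible (\<alpha> *\<^sub>R f x + g x - \<beta> *\<^sub>R matrix_inv (mgig_V \<alpha> \<beta> (f x) (g x)))"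
      unfolding matrix_inv_mgig_U[OF \<alpha> \<beta> pd(1)[OF x] pd(2)[OF x], symmetric]
      by (intro invertible_matrix_inv invertible_mgig_U \<alpha> \<beta> pd x)
  qed
qed

lemma twice_diff_on_posdef_continuous: "twice_diff_on_posdef f \<Longrightarrow> continuous_on posdef_mats f"
  unfolding twice_diff_on_posdef_def continuous_on_eq_continuous_within
  using has_derivative_continuous by blast

text \<open>The sum identity at (u, v) exchanges the traces with a, and at (x, y) those with b. The
  determinant relation takes care of the powers and the Jacobian.\<close>

lemma mgig_kernel_mgig_map:
  fixes u v :: "real^'n::finite^'n"
  assumes \<alpha>: "\<alpha> \<ge> 0" and \<beta>: "\<beta> \<ge> 0" and u: "u \<in> posdef_mats" and v: "v \<in> posdef_mats"
  shows "mgig_kernel lam (\<alpha> *\<^sub>R a) b (mgig_U \<alpha> \<beta> u v) * mgig_kernel (- lam) a (\<beta> *\<^sub>R b) (mgig_V \<alpha> \<beta> u v)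
      * (det (mgig_U \<alpha> \<beta> u v) / det u) ^ (CARD('n) + 1) =
    mgig_kernel lam (\<alpha> *\<^sub>R b) a u * mgig_kernel (- lam) b (\<beta> *\<^sub>R a) v"
proof -
  let ?x = "mgig_U \<alpha> \<beta> u v" and ?y = "mgig_V \<alpha> \<beta> u v"
  define K where "K = real CARD('n) + 1"
  have x: "?x \<in> posdef_mats" and y: "?y \<in> posdef_mats"
    by (intro mgig_U_posdef mgig_V_posdef \<alpha> \<beta> u v)+
  note d = det_posdef[OF x] det_posdef[OF y] det_posdef[OF u] det_posdef[OF v]
  have ld: "ln (det ?x) + ln (det v) = ln (det ?y) + ln (det u)"
    using arg_cong[OF mgig_det_eq[OF \<alpha> \<beta> u v], of ln] d by (simp add: ln_mult)
  have pw: "(det ?x / det u) ^ (CARD('n) + 1) = exp (K * (ln (det ?x) - ln (det u)))"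
  proof -
    have "exp (real (CARD('n) + 1) * ln (det ?x / det u)) = (det ?x / det u) ^ (CARD('n) + 1)"
      using d by (subst exp_of_nat_mult) simp
    then show ?thesis using d by (simp add: ln_div K_def add.commute)
  qed
  have s1: "\<alpha> * trace (a ** ?x) + trace (a ** ?y) = trace (a ** matrix_inv u) + \<beta> * trace (a ** matrix_inv v)"
    using arg_cong[OF mgig_sum_eq[OF \<alpha> \<beta> u v], of "\<lambda>z. trace (a ** z)"]
    by (simp add: matrix_algebra trace_algebra)
  have s2: "trace (b ** matrix_inv ?x) + \<beta> * trace (b ** matrix_inv ?y) = \<alpha> * trace (b ** u) + trace (b ** v)"
    using arg_cong[OF mgig_sum_eq[OF \<alpha> \<beta> x y], of "\<lambda>z. trace (b ** z)"]
    unfolding mgig_U_involution[OF \<alpha> \<beta> u v] mgig_V_involution[OF \<alpha> \<beta> u v]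
    by (simp add: matrix_algebra trace_algebra)
  have l1: "ln (det ?y) = ln (det ?x) + ln (det v) - ln (det u)" using ld by simp
  have "(lam - K / 2) * ln (det ?x) - \<alpha> * trace (a ** ?x) - trace (b ** matrix_inv ?x) +
      ((- lam - K / 2) * ln (det ?y) - trace (a ** ?y) - \<beta> * trace (b ** matrix_inv ?y)) + K * (ln (det ?x) - ln (det u)) =
    ((lam - K / 2) * ln (det u) - \<alpha> * trace (b ** u) - trace (a ** matrix_inv u)) +
    ((- lam - K / 2) * ln (det v) - trace (b ** v) - \<beta> * trace (a ** matrix_inv v))"
  proof -
    have "(lam - K / 2) * ln (det ?x) + (- lam - K / 2) * ln (det ?y) + K * (ln (det ?x) - ln (det u)) =
      (lam - K / 2) * ln (det u) + (- lam - K / 2) * ln (det v)"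
      unfolding l1 by (simp add: field_simps)
    then show ?thesis using s1 s2 by linarith
  qed
  then show ?thesis
    unfolding mgig_kernel_exp[OF x] mgig_kernel_exp[OF y] mgig_kernel_exp[OF u] mgig_kernel_exp[OF v] pw exp_add[symmetric] K_def
    by (simp add: matrix_mult.scaleR_left trace_algebra)
qed

theorem theorem4:
  fixes M :: "'s measure"
    and X Y :: "'s \<Rightarrow> real^'n::finite^'n"
    and fX fY :: "real^'n^'n \<Rightarrow> real"
    and \<alpha> \<beta> :: real
  assumes "prob_space M"
    and "\<alpha> \<ge> 0" and "\<beta> \<ge> 0" and "\<alpha> \<noteq> \<beta>"
    and "\<forall>\<omega>\<in>space M. X \<omega> \<in> posdef_mats" and "\<forall>\<omega>\<in>space M. Y \<omega> \<in> posdef_mats"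
    and "distributed M lebesgue_sym X (\<lambda>x. ennreal (fX x))"
    and "distributed M lebesgue_sym Y (\<lambda>x. ennreal (fY x))"
    and "\<forall>x\<in>posdef_mats. fX x > 0" and "\<forall>x\<in>posdef_mats. fY x > 0"
    and "twice_diff_on_posdef fX" and "twice_diff_on_posdef fY"
    and "prob_space.indep_var M borel X borel Y"
    and "prob_space.indep_var M borel
           (\<lambda>\<omega>. matrix_inv (\<alpha> *\<^sub>R X \<omega> + Y \<omega>) ** (\<beta> *\<^sub>R X \<omega> + Y \<omega>) ** matrix_inv (Y \<omega>))
           borel
           (\<lambda>\<omega>. matrix_inv (\<alpha> *\<^sub>R X \<omega> + Y \<omega>) ** (\<beta> *\<^sub>R X \<omega> + Y \<omega>) ** matrix_inv (X \<omega>))"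
  shows "\<exists>lam a b. a \<in> posdef_mats \<and> b \<in> posdef_mats \<and>
           distr M borel X = MGIG lam (\<alpha> *\<^sub>R a) b \<and>
           distr M borel Y = MGIG (- lam) a (\<beta> *\<^sub>R b) \<and>
           distr M borel (\<lambda>\<omega>. matrix_inv (\<alpha> *\<^sub>R X \<omega> + Y \<omega>) ** (\<beta> *\<^sub>R X \<omega> + Y \<omega>) ** matrix_inv (Y \<omega>))
             = MGIG lam (\<alpha> *\<^sub>R b) a \<and>
           distr M borel (\<lambda>\<omega>. matrix_inv (\<alpha> *\<^sub>R X \<omega> + Y \<omega>) ** (\<beta> *\<^sub>R X \<omega> + Y \<omega>) ** matrix_inv (X \<omega>))
             = MGIG (- lam) b (\<beta> *\<^sub>R a)"
proof -
  interpret prob_space M by (rule assms(1))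
  note \<alpha> = assms(2) and \<beta> = assms(3) and ne = assms(4) and X = assms(5) and Y = assms(6)
    and dX = assms(7) and dY = assms(8) and fX = assms(9) and fY = assms(10)
  let ?L = "lebesgue_sym :: (real^'n^'n) measure"
  define U where "U = (\<lambda>\<omega>. matrix_inv (\<alpha> *\<^sub>R X \<omega> + Y \<omega>) ** (\<beta> *\<^sub>R X \<omega> + Y \<omega>) ** matrix_inv (Y \<omega>))"
  define V where "V = (\<lambda>\<omega>. matrix_inv (\<alpha> *\<^sub>R X \<omega> + Y \<omega>) ** (\<beta> *\<^sub>R X \<omega> + Y \<omega>) ** matrix_inv (X \<omega>))"
  have UV: "U \<omega> = mgig_U \<alpha> \<beta> (X \<omega>) (Y \<omega>)" "V \<omega> = mgig_V \<alpha> \<beta> (X \<omega>) (Y \<omega>)" if "\<omega> \<in> space M" for \<omega>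
    using mgig_U_eq[OF \<alpha> \<beta>, of "X \<omega>" "Y \<omega>"] mgig_V_eq[OF \<alpha> \<beta>, of "X \<omega>" "Y \<omega>"] X Y that by (simp_all add: U_def V_def)
  have ind: "random_variable borel U" "random_variable borel V"
    "distr M borel U \<Otimes>\<^sub>M distr M borel V = distr M (borel \<Otimes>\<^sub>M borel) (\<lambda>\<omega>. (U \<omega>, V \<omega>))"
    using indep_var_distribution_eq[THEN iffD1, OF assms(14)] unfolding U_def V_def by auto
  define h where "h = (\<lambda>u v. fX (mgig_U \<alpha> \<beta> u v) * fY (mgig_V \<alpha> \<beta> u v) * (det (mgig_U \<alpha> \<beta> u v) / det u) ^ (CARD('n) + 1))"
  define H where "H = (\<lambda>(u, v). ennreal (fX (mgig_U \<alpha> \<beta> u v)) * ennreal (fY (mgig_V \<alpha> \<beta> u v)) *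
      ennreal ((det (mgig_U \<alpha> \<beta> u v) / det u) ^ (CARD('n) + 1)) * (indicator posdef_mats u * indicator posdef_mats v))"
  have pdUV: "mgig_U \<alpha> \<beta> u v \<in> posdef_mats" "mgig_V \<alpha> \<beta> u v \<in> posdef_mats"
    if "u \<in> posdef_mats" "v \<in> posdef_mats" for u v :: "real^'n^'n"
    using that by (auto intro: mgig_U_posdef mgig_V_posdef \<alpha> \<beta>)
  have hpos: "h u v > 0" if "u \<in> posdef_mats" "v \<in> posdef_mats" for u v
    unfolding h_def using that fX fY pdUV[OF that] det_posdef by (auto intro!: mult_pos_pos zero_less_power divide_pos_pos)
  have Hh: "H (u, v) = ennreal (h u v)" if "u \<in> posdef_mats" "v \<in> posdef_mats" for u v
  proof -
    define D where "D = (det (mgig_U \<alpha> \<beta> u v) / det u) ^ (CARD('n) + 1)"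
    have "fX (mgig_U \<alpha> \<beta> u v) \<ge> 0" "fY (mgig_V \<alpha> \<beta> u v) \<ge> 0" "D \<ge> 0"
      unfolding D_def using fX fY pdUV[OF that] det_posdef that
      by (auto intro!: less_imp_le divide_pos_pos zero_less_power simp del: power_Suc)
    then show ?thesis
      unfolding H_def h_def D_def[symmetric] split using that by (simp add: ennreal_mult mult_nonneg_nonneg)
  qed
  have H0: "H (u, v) = 0" if "u \<notin> posdef_mats \<or> v \<notin> posdef_mats" for u v
    using that by (auto simp: H_def)
  have fm [measurable]: "(\<lambda>x. ennreal (fX x)) \<in> borel_measurable borel" "(\<lambda>x. ennreal (fY x)) \<in> borel_measurable borel"
    using distributed_borel_measurable[OF dX] distributed_borel_measurable[OF dY] by simp_all
  have Hm: "H \<in> borel_measurable (borel \<Otimes>\<^sub>M borel)"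
    unfolding H_def split_def by measurable
  have "distr M (borel \<Otimes>\<^sub>M borel) (\<lambda>\<omega>. (U \<omega>, V \<omega>)) = distr M (borel \<Otimes>\<^sub>M borel) (\<lambda>\<omega>. (mgig_U \<alpha> \<beta> (X \<omega>) (Y \<omega>), mgig_V \<alpha> \<beta> (X \<omega>) (Y \<omega>)))"
    by (rule distr_cong) (auto simp: UV)
  also have "\<dots> = density (?L \<Otimes>\<^sub>M ?L) H"
    unfolding H_def by (rule distr_joint_mgig[OF assms(1) \<alpha> \<beta> X Y dX dY assms(13)])
  finally have joint: "distr M borel U \<Otimes>\<^sub>M distr M borel V = density (?L \<Otimes>\<^sub>M ?L) H"
    using ind(3) by simp
  have PU: "prob_space (distr M borel U)" and PV: "prob_space (distr M borel V)"
    using ind by (auto intro: prob_space_distr)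
  note pd = product_density[OF Hm PU PV _ _ joint, simplified]
  have cross: "h u v * h u' v' = h u v' * h u' v"
    if "u \<in> posdef_mats" "u' \<in> posdef_mats" "v \<in> posdef_mats" "v' \<in> posdef_mats" for u u' v v'
  proof (rule product_form_everywhere[OF _ hpos _ _ that])
    show "AE u in ?L. AE v in ?L. u \<in> posdef_mats \<longrightarrow> v \<in> posdef_mats \<longrightarrow>
       ennreal (h u v) = (\<integral>\<^sup>+v. H (u, v) \<partial>?L) * (\<integral>\<^sup>+u. H (u, v) \<partial>?L)"
      using lsym_pair.AE_pair[OF pd(3)] by eventually_elim (auto simp: Hh elim!: eventually_mono)
    have cf: "continuous_on posdef_mats fX" "continuous_on posdef_mats fY"
      using assms(11,12) by (auto intro: twice_diff_on_posdef_continuous)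
    show "continuous_on posdef_mats (\<lambda>u. h u v)" if v: "v \<in> posdef_mats" for v
      unfolding h_def using v
      by (intro continuous_on_mult continuous_on_power continuous_on_divide
          continuous_on_compose2[OF cf(1)] continuous_on_compose2[OF cf(2)] continuous_on_compose2[OF continuous_on_det[of UNIV]]
          continuous_on_mgig \<alpha> \<beta> continuous_on_id continuous_on_const)
        (auto intro!: pdUV dest: det_posdef)
    show "continuous_on posdef_mats (\<lambda>v. h u v)" if u: "u \<in> posdef_mats" for u
      unfolding h_def using u
      by (intro continuous_on_mult continuous_on_power continuous_on_divide
          continuous_on_compose2[OF cf(1)] continuous_on_compose2[OF cf(2)] continuous_on_compose2[OF continuous_on_det[of UNIV]]
          continuous_on_mgig \<alpha> \<beta> continuous_on_id continuous_on_const)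
        (auto intro!: pdUV dest: det_posdef)
  qed
  define \<kappa> where "\<kappa> = (real CARD('n) + 1) / 2"
  define g1 where "g1 = (\<lambda>x. ln (fX x) + \<kappa> * ln (det x))"
  define g2 where "g2 = (\<lambda>x. ln (fY x) + \<kappa> * ln (det x))"
  have \<Phi>: "g1 (mgig_U \<alpha> \<beta> u v) + g2 (mgig_V \<alpha> \<beta> u v) = ln (h u v) + (\<kappa> * ln (det u) + \<kappa> * ln (det v))"
    if u: "u \<in> posdef_mats" and v: "v \<in> posdef_mats" for u v
  proof -
    let ?x = "mgig_U \<alpha> \<beta> u v" and ?y = "mgig_V \<alpha> \<beta> u v"
    note d = det_posdef[OF pdUV(1)[OF u v]] det_posdef[OF pdUV(2)[OF u v]] det_posdef[OF u] det_posdef[OF v]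
    have f: "fX ?x > 0" "fY ?y > 0" using fX fY pdUV[OF u v] by auto
    have ld: "ln (det ?x) + ln (det v) = ln (det ?y) + ln (det u)"
      using arg_cong[OF mgig_det_eq[OF \<alpha> \<beta> u v], of ln] d by (simp add: ln_mult)
    have l: "ln (h u v) = ln (fX ?x) + ln (fY ?y) + real (CARD('n) + 1) * (ln (det ?x) - ln (det u))"
      unfolding h_def using f d by (simp add: ln_mult ln_div ln_realpow del: power_Suc)
    have k: "real (CARD('n) + 1) = 2 * \<kappa>" by (simp add: \<kappa>_def)
    have "ln (h u v) = ln (fX ?x) + ln (fY ?y) + 2 * \<kappa> * (ln (det ?x) - ln (det u))"
      using l unfolding k .
    moreover have "\<kappa> * ln (det ?y) = \<kappa> * ln (det ?x) + \<kappa> * ln (det v) - \<kappa> * ln (det u)"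
      using arg_cong[OF ld, of "\<lambda>z. \<kappa> * z"] by (simp add: algebra_simps)
    ultimately show ?thesis by (simp add: g1_def g2_def algebra_simps)
  qed
  obtain G1 DG1 where G1: "\<And>x. x \<in> posdef_mats \<Longrightarrow> (g1 has_derivative (\<lambda>h. trace (G1 x ** h))) (at x within posdef_mats)"
      "\<And>x. x \<in> posdef_mats \<Longrightarrow> transpose (G1 x) = G1 x"
      "\<And>x. x \<in> posdef_mats \<Longrightarrow> (G1 has_derivative DG1 x) (at x within posdef_mats)"
    unfolding g1_def using log_density_gradient[OF assms(11) fX, of \<kappa>] by blast
  obtain G2 DG2 where G2: "\<And>x. x \<in> posdef_mats \<Longrightarrow> (g2 has_derivative (\<lambda>h. trace (G2 x ** h))) (at x within posdef_mats)"
      "\<And>x. x \<in> posdef_mats \<Longrightarrow> transpose (G2 x) = G2 x"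
      "\<And>x. x \<in> posdef_mats \<Longrightarrow> (G2 has_derivative DG2 x) (at x within posdef_mats)"
    unfolding g2_def using log_density_gradient[OF assms(12) fY, of \<kappa>] by blast
  obtain lam a b k1 k2 where sol: "transpose a = a" "transpose b = b"
    "\<And>x. x \<in> posdef_mats \<Longrightarrow> g1 x = lam * ln (det x) - \<alpha> * trace (a ** x) - trace (b ** matrix_inv x) + k1"
    "\<And>x. x \<in> posdef_mats \<Longrightarrow> g2 x = - lam * ln (det x) - trace (a ** x) - \<beta> * trace (b ** matrix_inv x) + k2"
  proof (rule separation_equation[OF \<alpha> \<beta> ne G1(1) G2(1) G1(2) G2(2) G1(3) G2(3)])
    fix u u' v v' :: "real^'n^'n"
    assume *: "u \<in> posdef_mats" "u' \<in> posdef_mats" "v \<in> posdef_mats" "v' \<in> posdef_mats"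
    have "ln (h u v) + ln (h u' v') = ln (h u v') + ln (h u' v)"
      using arg_cong[OF cross[OF *], of ln] hpos[OF *(1,3)] hpos[OF *(2,4)] hpos[OF *(1,4)] hpos[OF *(2,3)]
      by (simp add: ln_mult)
    then show "g1 (mgig_U \<alpha> \<beta> u v) + g2 (mgig_V \<alpha> \<beta> u v) + (g1 (mgig_U \<alpha> \<beta> u' v') + g2 (mgig_V \<alpha> \<beta> u' v'))
     = g1 (mgig_U \<alpha> \<beta> u v') + g2 (mgig_V \<alpha> \<beta> u v') + (g1 (mgig_U \<alpha> \<beta> u' v) + g2 (mgig_V \<alpha> \<beta> u' v))"
      using * by (simp add: \<Phi>)
  qed (assumption | rule that)+
  have fX_eq: "fX x = exp k1 * mgig_kernel lam (\<alpha> *\<^sub>R a) b x" if x: "x \<in> posdef_mats" for x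
  proof -
    have "fX x = exp (g1 x - \<kappa> * ln (det x))" using fX x by (simp add: g1_def)
    then show ?thesis
      unfolding sol(3)[OF x] mgig_kernel_exp[OF x] exp_add[symmetric]
      by (simp add: matrix_mult.scaleR_left trace_algebra \<kappa>_def algebra_simps)
  qed
  have fY_eq: "fY x = exp k2 * mgig_kernel (- lam) a (\<beta> *\<^sub>R b) x" if x: "x \<in> posdef_mats" for x
  proof -
    have "fY x = exp (g2 x - \<kappa> * ln (det x))" using fY x by (simp add: g2_def)
    then show ?thesis
      unfolding sol(4)[OF x] mgig_kernel_exp[OF x] exp_add[symmetric]
      by (simp add: matrix_mult.scaleR_left trace_algebra \<kappa>_def algebra_simps)
  qed
  have density_eq: "distr M borel Z = density ?L (\<lambda>x. ennreal (exp k) * ennreal (mgig_kernel l c d x))"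
    if Z: "\<forall>\<omega>\<in>space M. Z \<omega> \<in> posdef_mats" and dZ: "distributed M ?L Z (\<lambda>x. ennreal (f x))"
      and f: "\<And>x. x \<in> posdef_mats \<Longrightarrow> f x = exp k * mgig_kernel l c d x" for Z f k l c d
  proof -
    have [measurable]: "Z \<in> borel_measurable M"
      by (rule distributed_measurable[OF dZ, unfolded measurable_cong_sets[OF refl sets_lebesgue_sym]])
    have fm [measurable]: "(\<lambda>x. ennreal (f x)) \<in> borel_measurable borel"
      using distributed_borel_measurable[OF dZ] by simp
    have D: "distr M borel Z = density ?L f"
      using distributed_distr_eq_density[OF dZ] distr_cong[of M M borel ?L Z Z] by simp
    have "AE x in distr M borel Z. x \<in> posdef_mats"
      using Z by (subst AE_distr_iff) auto
    then have "AE x in ?L. 0 < ennreal (f x) \<longrightarrow> x \<in> posdef_mats"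
      unfolding D by (subst (asm) AE_density) auto
    then have "AE x in ?L. ennreal (f x) = ennreal (exp k) * ennreal (mgig_kernel l c d x)"
    proof eventually_elim
      case (elim x)
      show ?case
      proof (cases "x \<in> posdef_mats")
        case True
        then show ?thesis by (simp add: f ennreal_mult mgig_kernel_nonneg)
      next
        case False
        then show ?thesis using elim by (simp add: mgig_kernel_def zero_less_iff_neq_zero)
      qed
    qed
    then show ?thesis
      unfolding D by (intro density_cong) auto
  qed
  have rv: "random_variable borel X" "random_variable borel Y"
    by (rule distributed_measurable[OF dX, unfolded measurable_cong_sets[OF refl sets_lebesgue_sym]])
      (rule distributed_measurable[OF dY, unfolded measurable_cong_sets[OF refl sets_lebesgue_sym]])
  note MX = MGIG_eqI[OF density_eq[OF X dX fX_eq] prob_space_distr[OF rv(1)]]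
  note MY = MGIG_eqI[OF density_eq[OF Y dY fY_eq] prob_space_distr[OF rv(2)]]
  have a: "a \<in> posdef_mats"
    using mgig_parameter_posdef[OF sol(1) \<alpha> _ MX(2), of 1] MY(2) by simp
  \<comment> \<open>After inversion the kernels have b in place of a, with coefficients \<beta> for
    Y and 1 for X.\<close>
  have b: "b \<in> posdef_mats"
    using mgig_parameter_posdef[of b \<beta> 1 lam a "\<alpha> *\<^sub>R a"] sol(2) \<beta> MX(2) MY(2)
      nn_integral_mgig_kernel_inverse[of lam "\<alpha> *\<^sub>R a" b] nn_integral_mgig_kernel_inverse[of "- lam" a "\<beta> *\<^sub>R b"]
    by simp
  define C where "C = exp (k1 + k2)"
  let ?k1 = "mgig_kernel lam (\<alpha> *\<^sub>R b) a" and ?k2 = "mgig_kernel (- lam) b (\<beta> *\<^sub>R a)"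
  \<comment> \<open>The joint density of (U, V) in product form, so that its partial integrals,
    already known to be the marginal densities, are multiples of kernels.\<close>
  have HC: "H (u, v) = ennreal C * ennreal (?k1 u) * ennreal (?k2 v)" for u v
  proof (cases "u \<in> posdef_mats \<and> v \<in> posdef_mats")
    case True
    then have u: "u \<in> posdef_mats" and v: "v \<in> posdef_mats" by auto
    have "h u v = C * (mgig_kernel lam (\<alpha> *\<^sub>R a) b (mgig_U \<alpha> \<beta> u v) * mgig_kernel (- lam) a (\<beta> *\<^sub>R b) (mgig_V \<alpha> \<beta> u v)
      * (det (mgig_U \<alpha> \<beta> u v) / det u) ^ (CARD('n) + 1))"
      unfolding h_def fX_eq[OF pdUV(1)[OF u v]] fY_eq[OF pdUV(2)[OF u v]] C_def exp_add by (simp add: mult_ac)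
    also have "\<dots> = C * ?k1 u * ?k2 v"
      unfolding mgig_kernel_mgig_map[OF \<alpha> \<beta> u v] by simp
    finally show ?thesis
      using Hh[OF u v] by (simp add: ennreal_mult mgig_kernel_nonneg C_def)
  next
    case False
    then show ?thesis using H0[of u v] by (auto simp: mgig_kernel_def)
  qed
  have U: "distr M borel U = MGIG lam (\<alpha> *\<^sub>R b) a"
  proof (rule MGIG_eqI(1)[OF _ PU])
    have "(\<integral>\<^sup>+v. H (u, v) \<partial>?L) = (ennreal C * (\<integral>\<^sup>+v. ennreal (?k2 v) \<partial>?L)) * ennreal (?k1 u)" for u
    proof -
      have "(\<integral>\<^sup>+v. H (u, v) \<partial>?L) = (ennreal C * ennreal (?k1 u)) * (\<integral>\<^sup>+v. ennreal (?k2 v) \<partial>?L)"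
        unfolding HC by (rule nn_integral_cmult) measurable
      then show ?thesis by (simp add: mult_ac)
    qed
    then show "distr M borel U = density ?L (\<lambda>u. (ennreal C * (\<integral>\<^sup>+v. ennreal (?k2 v) \<partial>?L)) * ennreal (?k1 u))"
      using pd(1) by simp
  qed
  have V: "distr M borel V = MGIG (- lam) b (\<beta> *\<^sub>R a)"
  proof (rule MGIG_eqI(1)[OF _ PV])
    have "(\<integral>\<^sup>+u. H (u, v) \<partial>?L) = (ennreal C * (\<integral>\<^sup>+u. ennreal (?k1 u) \<partial>?L)) * ennreal (?k2 v)" for v
    proof -
      have "(\<integral>\<^sup>+u. H (u, v) \<partial>?L) = (\<integral>\<^sup>+u. (ennreal C * ennreal (?k2 v)) * ennreal (?k1 u) \<partial>?L)"
        unfolding HC by (simp only: mult_ac)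
      also have "\<dots> = (ennreal C * ennreal (?k2 v)) * (\<integral>\<^sup>+u. ennreal (?k1 u) \<partial>?L)"
        by (rule nn_integral_cmult) measurable
      finally show ?thesis by (simp add: mult_ac)
    qed
    then show "distr M borel V = density ?L (\<lambda>v. (ennreal C * (\<integral>\<^sup>+u. ennreal (?k1 u) \<partial>?L)) * ennreal (?k2 v))"
      using pd(2) by simp
  qed
  show ?thesis
    using a b MX(1) MY(1) U V unfolding U_def V_def by blast
qed

end
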